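(* For the quantum Rademacher system $\mathcal A=\{\epsilon_{i,k}:1\le k\le N,\ 1\le i\le3\}\subset M_{2^N}(\mathbb C)$ with $N\ge2$, $$\sqrt{\frac83}\le A_1(\mathcal A)\le\sqrt3 .$$ The lower bound also holds if the coefficients are required to be self-adjoint, i.e. any constant $A$ for which the inequality defining $A_1(\mathcal A)$ holds for every $d$ and all families of self-adjoint coefficients $c_{i,k}\in M_d(\mathbb C)$ satisfies $A\ge\sqrt{8/3}$.
   Context: The Pauli matrices are $\sigma_1=\begin{pmatrix}0&1\\1&0\end{pmatrix}$, $\sigma_2=\begin{pmatrix}0&-i\\i&0\end{pmatrix}$, $\sigma_3=\begin{pmatrix}1&0\\0&-1\end{pmatrix}$. For $1\le k\le N$ and $i\in\{1,2,3\}$, $\epsilon_{i,k}=I_2^{\otimes(k-1)}\otimes\sigma_i\otimes I_2^{\otimes(N-k)}\in M_{2^N}(\mathbb C)$. $\operatorname{tr}$ is the usual unnormalized trace on $M_d(\mathbb C)$ and $\tau=2^{-N}\operatorname{tr}$ is the normalized trace on $M_{2^N}(\mathbb C)$. $A_1(\mathcal A)$ is the least constant such that $$\|(c_{i,k})_{i,k}\|_{S_1^d(\ell_2)}\le A_1(\mathcal A)\,(\operatorname{tr}\otimes\tau)\left(\left|\sum_{i,k}c_{i,k}\otimes\epsilon_{i,k}\right|\right)$$ holds for every $d\in\mathbb N$ and every family $c_{i,k}\in M_d(\mathbb C)$. For a finite family $(C_k)$ in $M_d(\mathbb C)$, $$\|(C_k)\|_{S_1^d(\ell_2)}=\inf\left\{\operatorname{tr}\Big(\sum_kX_k^*X_k\Big)^{1/2}+\operatorname{tr}\Big(\sum_kY_kY_k^*\Big)^{1/2}: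 C_k=X_k+Y_k,\ X_k,Y_k\in M_d(\mathbb C)\right\}.$$ *)

theory Defs
  imports "Jordan_Normal_Form.Schur_Decomposition"
begin

definition mat_trace :: "complex mat \<Rightarrow> complex" where
  "mat_trace A = (\<Sum>i<dim_row A. A $$ (i, i))"

definition self_adjoint_mat :: "complex mat \<Rightarrow> bool" where
  "self_adjoint_mat A \<longleftrightarrow> square_mat A \<and> mat_adjoint A = A"

definition psd_mat :: "complex mat \<Rightarrow> bool" where
  "psd_mat A \<longleftrightarrow> self_adjoint_mat A \<and>
     (\<forall>v \<in> carrier_vec (dim_row A). 0 \<le> Re ((A *\<^sub>v v) \<bullet>c v))"

text \<open>Only meaningful for positive semidefinite \<open>A\<close>, where the positive square root exists
  and is unique.\<close>
definition mat_sqrt :: "complex mat \<Rightarrow> complex mat" where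
  "mat_sqrt A = (THE B. psd_mat B \<and> B * B = A)"

definition mat_abs :: "complex mat \<Rightarrow> complex mat" where
  "mat_abs A = mat_sqrt (mat_adjoint A * A)"

text \<open>Matrices of unspecified dimension form no additive monoid, so a finite sum of
  \<open>n \<times> n\<close> matrices is taken entrywise.\<close>
definition mat_fsum :: "nat \<Rightarrow> ('k \<Rightarrow> complex mat) \<Rightarrow> 'k set \<Rightarrow> complex mat" where
  "mat_fsum n F K = mat n n (\<lambda>(a, b). \<Sum>k\<in>K. F k $$ (a, b))"

definition kron :: "complex mat \<Rightarrow> complex mat \<Rightarrow> complex mat" where
  "kron A B = mat (dim_row A * dim_row B) (dim_col A * dim_col B)
     (\<lambda>(i, j). A $$ (i div dim_row B, j div dim_col B) * B $$ (i mod dim_row B, j mod dim_col B))"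

fun kron_pow :: "complex mat \<Rightarrow> nat \<Rightarrow> complex mat" where
  "kron_pow A 0 = 1\<^sub>m 1"
| "kron_pow A (Suc n) = kron A (kron_pow A n)"

text \<open>\<open>pauli 1\<close>, \<open>pauli 2\<close>, \<open>pauli 3\<close> are the Pauli matrices; other indices are never used.\<close>
definition pauli :: "nat \<Rightarrow> complex mat" where
  "pauli i =
     (if i = 1 then mat_of_rows_list 2 [[0, 1], [1, 0]]
      else if i = 2 then mat_of_rows_list 2 [[0, - \<i>], [\<i>, 0]]
      else mat_of_rows_list 2 [[1, 0], [0, -1]])"

definition qrad_index :: "nat \<Rightarrow> (nat \<times> nat) set" where
  "qrad_index N = {1..3} \<times> {1..N}"

definition qrad :: "nat \<Rightarrow> nat \<times> nat \<Rightarrow> complex mat" where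
  "qrad N = (\<lambda>(i, k). kron (kron (kron_pow (1\<^sub>m 2) (k - 1)) (pauli i)) (kron_pow (1\<^sub>m 2) (N - k)))"

text \<open>The traces below are of positive semidefinite matrices, hence real.\<close>
definition S1_l2_norm :: "nat \<Rightarrow> 'k set \<Rightarrow> ('k \<Rightarrow> complex mat) \<Rightarrow> real" where
  "S1_l2_norm d K C = Inf
     {Re (mat_trace (mat_sqrt (mat_fsum d (\<lambda>k. mat_adjoint (X k) * X k) K)))
      + Re (mat_trace (mat_sqrt (mat_fsum d (\<lambda>k. Y k * mat_adjoint (Y k)) K))) | X Y.
      \<forall>k\<in>K. X k \<in> carrier_mat d d \<and> Y k \<in> carrier_mat d d \<and> C k = X k + Y k}"

text \<open>On \<open>M\<^sub>d \<otimes> M\<^sub>n = M\<^bsub>dn\<^esub>\<close>, with \<open>\<tau>\<close> the normalized trace of \<open>M\<^sub>n\<close>, the functional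
  \<open>tr \<otimes> \<tau>\<close> is \<open>1/n\<close> times the usual trace.\<close>
definition tr_tau :: "nat \<Rightarrow> complex mat \<Rightarrow> complex" where
  "tr_tau n A = mat_trace A / of_nat n"

definition L1_ineq ::
  "nat \<Rightarrow> 'k set \<Rightarrow> ('k \<Rightarrow> complex mat) \<Rightarrow> real \<Rightarrow> nat \<Rightarrow> ('k \<Rightarrow> complex mat) \<Rightarrow> bool" where
  "L1_ineq n K e A d c \<longleftrightarrow>
     S1_l2_norm d K c \<le> A * Re (tr_tau n (mat_abs (mat_fsum (d * n) (\<lambda>k. kron (c k) (e k)) K)))"

text \<open>For a finite system \<open>e k \<in> M\<^sub>n\<close>, \<open>k \<in> K\<close>: the least constant, over all
  matrix-valued coefficients of all sizes \<open>d\<close>.\<close>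
definition A1_const :: "nat \<Rightarrow> 'k set \<Rightarrow> ('k \<Rightarrow> complex mat) \<Rightarrow> real" where
  "A1_const n K e = (LEAST A. \<forall>d c. d \<ge> 1 \<longrightarrow> (\<forall>k\<in>K. c k \<in> carrier_mat d d) \<longrightarrow> L1_ineq n K e A d c)"

end

theory Submission
  imports Defs "HOL-Analysis.L2_Norm"
begin

text \<open>
  Upper bound. Let \<open>F\<close> be the value of a near-optimal decomposition \<open>c = X + Y\<close>. The optimality
  condition yields \<open>x\<close> in the dual unit ball, \<open>\<Sum>x\<^sup>*x \<le> 1\<close> and \<open>\<Sum>xx\<^sup>* \<le> 1\<close>, whose pairing with
  \<open>c\<close> is almost \<open>F\<close>. Put \<open>x' = \<Sum>x\<^sub>k \<otimes> \<epsilon>\<^sub>k\<close> and truncate, \<open>Z = x' (1 + x'\<^sup>*x'/3)\<^sup>-\<^sup>1\<close>; then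
  \<open>\<bar>Z\<bar> \<le> \<surd>3/2\<close> and \<open>\<bar>x' - Z\<bar>\<^sup>2 \<le> \<bar>x'\<bar>\<^sup>4/12\<close>. Since the \<open>\<epsilon>\<^sub>k\<close> commute or anticommute and only paired
  words of length four have nonzero trace, the fourth moment of \<open>x'\<close> is at most 3, so \<open>x' - Z\<close>
  contributes at most \<open>F/2\<close> to the pairing and \<open>F \<le> \<surd>3/2 \<parallel>\<Sum>c\<^sub>k \<otimes> \<epsilon>\<^sub>k\<parallel>\<^sub>1 + F/2\<close>.

  Lower bound. Take \<open>c\<^bsub>i,1\<^esub> = \<sigma>\<^sub>i \<otimes> 1\<close> and \<open>c\<^bsub>i,2\<^esub> = - 1 \<otimes> \<sigma>\<^sub>i\<close> in \<open>M\<^sub>4\<close>, and all other coefficients zero.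
  Each site contributes \<open>\<Sum>\<sigma>\<^sub>i \<otimes> \<sigma>\<^sub>i\<close>, which has the eigenvalues \<open>1\<close> and \<open>-3\<close>, so
  \<open>S = \<Sum>c\<^sub>k \<otimes> \<epsilon>\<^sub>k\<close> has the eigenvalues \<open>0\<close> and \<open>\<plusminus>4\<close>. Hence \<open>\<bar>S\<bar> = S\<^sup>2/4\<close> has trace norm 6, while
  pairing with \<open>c/\<surd>6\<close> shows that the norm of \<open>c\<close> is at least \<open>4\<surd>6\<close>.
\<close>

section \<open>Star algebras with a trace\<close>

text \<open>The constant 3 in the truncation is the best one for this argument. For
  \<open>t / (1 + t^2/a)\<close> the truncated part has norm at most \<open>sqrt a / 2\<close>, and
  the remainder contributes at most \<open>sqrt 3 / (2 * sqrt a) * F\<close>. The resulting bound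
  \<open>a / (2 * sqrt a - sqrt 3)\<close> is smallest at \<open>a = 3\<close>, with value
  \<open>sqrt 3\<close>. The pairing with the remainder is controlled by a weighted Cauchy-Schwarz
  inequality whose weights are roots of Gram sums, so the fourth moment is needed against such a
  weight. The weights lie in the coefficient algebra and commute with every generator, which leaves
  the count of words unchanged. Gram sums may be singular; they are therefore regularised, and all
  errors are expressed through one parameter \<open>t\<close> that tends to 0. In the lower bound
  the minus sign matters: the sum and the difference of the two sites have the same L2 norm, but the
  difference vanishes on 10/16 of the space and has normalised L1 norm \<open>3/2\<close> instead of
  \<open>9/4\<close>.\<close>

class star_trace = real_algebra +
  fixes adj :: "'a \<Rightarrow> 'a" and trc :: "'a \<Rightarrow> real"
  assumes adj_add: "adj (a + b) = adj a + adj b"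
    and adj_mult: "adj (a * b) = adj b * adj a"
    and adj_adj [simp]: "adj (adj a) = a"
    and adj_scaleR: "adj (r *\<^sub>R a) = r *\<^sub>R adj a"
    and trc_add: "trc (a + b) = trc a + trc b"
    and trc_scaleR: "trc (r *\<^sub>R a) = r * trc a"
    and trc_adj [simp]: "trc (adj a) = trc a"
    and trc_comm: "trc (a * b) = trc (b * a)"
    and trc_square_nonneg: "0 \<le> trc (adj a * a)"
    and trc_square_eq_0: "trc (adj a * a) = 0 \<Longrightarrow> a = 0"
    and trc_square_mult_le: "trc (adj (a * b) * (a * b)) \<le> trc (adj a * a) * trc (adj b * b)"

lemma adj_zero [simp]: "adj 0 = 0"
  using adj_scaleR[of 0 0] by simp

lemma adj_minus: "adj (- a) = - adj a"
  using adj_scaleR[of "-1" a] by simp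

lemma adj_diff: "adj (a - b) = adj a - adj b"
  using adj_add[of a "- b"] by (simp add: adj_minus)

lemma trc_zero [simp]: "trc 0 = 0"
  using trc_scaleR[of 0 0] by simp

lemma trc_minus: "trc (- a) = - trc a"
  using trc_scaleR[of "-1" a] by simp

lemma trc_diff: "trc (a - b) = trc a - trc b"
  using trc_add[of a "- b"] by (simp add: trc_minus)

lemma adj_sum: "adj (\<Sum>k\<in>K. f k) = (\<Sum>k\<in>K. adj (f k))"
  by (induction K rule: infinite_finite_induct) (auto simp: adj_add)

lemma trc_sum: "trc (\<Sum>k\<in>K. f k) = (\<Sum>k\<in>K. trc (f k))"
  by (induction K rule: infinite_finite_induct) (auto simp: trc_add)

lemmas adj_simps = adj_add adj_diff adj_minus adj_mult adj_scaleR
lemmas trc_simps = trc_add trc_diff trc_minus trc_scaleR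

text \<open>The algebra has no vectors to test against, so positivity is tested by the trace of all
  congruences. For matrices this agrees with \<open>psd_mat\<close> by
  \<open>psd_mat_iff\<close>.\<close>

definition psd :: "'a :: star_trace \<Rightarrow> bool" where
  "psd a \<longleftrightarrow> adj a = a \<and> (\<forall>q. 0 \<le> trc (adj q * a * q))"

lemma psd_adj: "psd a \<Longrightarrow> adj a = a"
  by (simp add: psd_def)

lemma psd_square: "psd (adj a * a)"
  using trc_square_nonneg[of "a * _"] by (auto simp: psd_def adj_mult mult.assoc)

lemma psd_square': "psd (a * adj a)"
  using psd_square[of "adj a"] by simp

lemma psd_zero [simp]: "psd 0"
  by (simp add: psd_def)

lemma psd_add: "psd a \<Longrightarrow> psd b \<Longrightarrow> psd (a + b)"
  by (simp add: psd_def adj_add ring_distribs trc_add)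

lemma psd_scaleR: "0 \<le> r \<Longrightarrow> psd a \<Longrightarrow> psd (r *\<^sub>R a)"
  by (simp add: psd_def adj_scaleR trc_scaleR)

lemma psd_sum: "(\<And>k. k \<in> K \<Longrightarrow> psd (f k)) \<Longrightarrow> psd (\<Sum>k\<in>K. f k)"
  by (induction K rule: infinite_finite_induct) (auto simp: psd_add)

lemma psd_congr: "psd a \<Longrightarrow> psd (adj q * a * q)"
  unfolding psd_def
proof (intro conjI allI)
  assume *: "adj a = a \<and> (\<forall>q. 0 \<le> trc (adj q * a * q))"
  then show "adj (adj q * a * q) = adj q * a * q"
    by (simp add: adj_mult mult.assoc)
  fix r
  show "0 \<le> trc (adj r * (adj q * a * q) * r)"
    using *[THEN conjunct2, rule_format, of "q * r"] by (simp add: adj_mult mult.assoc)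
qed

lemma psd_congr': "psd a \<Longrightarrow> psd (q * a * adj q)"
  using psd_congr[of a "adj q"] by simp

lemma psd_trc_mult_square: "psd a \<Longrightarrow> 0 \<le> trc (adj r * r * a)"
  proof -
  assume "psd a"
  then have "0 \<le> trc (adj (adj r) * a * adj r)" unfolding psd_def by blast
  then show ?thesis using trc_comm[of "adj r" "r * a"] by (simp add: mult.assoc)
qed

text \<open>The algebra need not be unital; \<open>e\<close> is the unit of the subalgebra \<open>D\<close>.\<close>

locale trace_corner =
  fixes D :: "'a :: star_trace set" and e :: 'a
  assumes add_in [intro]: "a \<in> D \<Longrightarrow> b \<in> D \<Longrightarrow> a + b \<in> D"
    and mult_in [intro]: "a \<in> D \<Longrightarrow> b \<in> D \<Longrightarrow> a * b \<in> D"
    and scaleR_in [intro]: "a \<in> D \<Longrightarrow> r *\<^sub>R a \<in> D"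
    and adj_in [intro]: "a \<in> D \<Longrightarrow> adj a \<in> D"
    and e_in [intro, simp]: "e \<in> D"
    and e_left [simp]: "a \<in> D \<Longrightarrow> e * a = a"
    and e_right [simp]: "a \<in> D \<Longrightarrow> a * e = a"
    and sqrt_ex: "p \<in> D \<Longrightarrow> psd p \<Longrightarrow> \<exists>g\<in>D. psd g \<and> g * g = p"
    and inv_ex: "p \<in> D \<Longrightarrow> psd p \<Longrightarrow> \<exists>r\<in>D. (e + p) * r = e"
begin

lemma zero_in [intro]: "0 \<in> D"
  using scaleR_in[OF e_in, of 0] by simp

lemma minus_in [intro]: "a \<in> D \<Longrightarrow> - a \<in> D"
  using scaleR_in[of a "-1"] by simp

lemma diff_in [intro]: "a \<in> D \<Longrightarrow> b \<in> D \<Longrightarrow> a - b \<in> D"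
  using add_in[of a "- b"] by auto

lemma sum_in [intro]: "(\<And>k. k \<in> K \<Longrightarrow> f k \<in> D) \<Longrightarrow> (\<Sum>k\<in>K. f k) \<in> D"
  by (induction K rule: infinite_finite_induct) auto

lemma adj_e [simp]: "adj e = e"
  by (metis adj_adj adj_in adj_mult e_in e_right)

lemma e_e [simp]: "e * e = e"
  by (rule e_left[OF e_in])

lemma psd_e: "psd e"
  using psd_square[of e] by simp

lemma e_left_assoc [simp]: "a \<in> D \<Longrightarrow> e * (a * b) = a * b"
  by (simp flip: mult.assoc)

lemma e_right_assoc [simp]: "a \<in> D \<Longrightarrow> a * (e * b) = a * b"
  by (simp flip: mult.assoc)

lemma trc_psd_mult_nonneg:
  assumes "a \<in> D" "psd a" "psd b"
  shows "0 \<le> trc (a * b)"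
proof -
  obtain g where g: "psd g" "g * g = a"
    using sqrt_ex[OF assms(1,2)] by blast
  show ?thesis
    using psd_trc_mult_square[OF assms(3), of g] g by (simp add: psd_adj)
qed

lemma trc_psd_mult_mono:
  assumes "a \<in> D" "psd a" "psd (c - b)"
  shows "trc (a * b) \<le> trc (a * c)"
  using trc_psd_mult_nonneg[OF assms] by (simp add: algebra_simps trc_diff)

lemma trc_psd_nonneg:
  assumes "a \<in> D" "psd a"
  shows "0 \<le> trc a"
  using trc_psd_mult_nonneg[OF assms psd_e] assms(1) by simp

text \<open>The axiom \<open>inv_ex\<close> inverts \<open>e + p / \<epsilon>\<close>, and rescaling
  gives a right inverse \<open>r\<close> of \<open>h = p + \<epsilon> e\<close>. Its adjoint is a
  left inverse, so the two agree, and \<open>r = adj r * h * r\<close> is a congruence of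
  \<open>h\<close>, hence positive.\<close>

lemma regular_inverse:
  assumes p: "p \<in> D" "psd p" and \<epsilon>: "0 < \<epsilon>"
  obtains r where "r \<in> D" "psd r" "(p + \<epsilon> *\<^sub>R e) * r = e" "r * (p + \<epsilon> *\<^sub>R e) = e"
proof -
  let ?h = "p + \<epsilon> *\<^sub>R e"
  obtain q where q: "q \<in> D" "(e + (1/\<epsilon>) *\<^sub>R p) * q = e"
    using inv_ex[OF scaleR_in[OF p(1)] psd_scaleR[OF _ p(2), of "1/\<epsilon>"]] \<epsilon> by auto
  define r where "r = (1/\<epsilon>) *\<^sub>R q"
  have hr: "?h * r = e"
    using q(2) p \<epsilon> q(1) by (simp add: r_def algebra_simps)
  have r: "r \<in> D" using q by (auto simp: r_def)
  have h: "?h \<in> D" "psd ?h"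
    using p \<epsilon> psd_e by (auto intro!: psd_add psd_scaleR)
  have "adj (?h * r) = adj e" by (simp only: hr)
  then have ar: "adj r * ?h = e"
    using h(2) by (simp only: adj_mult psd_adj adj_e)
  have "adj r = adj r * (?h * r)" using adj_in[OF r] by (simp add: hr)
  also have "\<dots> = r" using r by (simp only: ar flip: mult.assoc) simp
  finally have sa: "adj r = r" .
  then have rh: "r * ?h = e" using ar by simp
  have "psd (adj r * ?h * r)" using h(2) by (rule psd_congr)
  then have "psd r" using sa ar r by simp
  with r hr rh that show ?thesis by blast
qed

text \<open>The inverse of the root is the root times the inverse of its square; self-adjointness
  and positivity then follow as in \<open>regular_inverse\<close>.\<close>

lemma regular_sqrt:
  assumes p: "p \<in> D" "psd p" and \<epsilon>: "0 < \<epsilon>"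
  obtains \<alpha> \<alpha>' where "\<alpha> \<in> D" "psd \<alpha>" "\<alpha> * \<alpha> = p + \<epsilon> *\<^sub>R e" "\<alpha>' \<in> D" "psd \<alpha>'" "\<alpha> * \<alpha>' = e" "\<alpha>' * \<alpha> = e"
proof -
  let ?h = "p + \<epsilon> *\<^sub>R e"
  have h: "?h \<in> D" "psd ?h"
    using p \<epsilon> psd_e by (auto intro!: psd_add psd_scaleR)
  obtain \<alpha> where \<alpha>: "\<alpha> \<in> D" "psd \<alpha>" "\<alpha> * \<alpha> = ?h"
    using sqrt_ex[OF h] by blast
  obtain r where r: "r \<in> D" "?h * r = e" "r * ?h = e"
    using regular_inverse[OF p \<epsilon>] by blast
  define \<alpha>' where "\<alpha>' = \<alpha> * r"
  have in': "\<alpha>' \<in> D" using \<alpha> r by (auto simp: \<alpha>'_def)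
  have r1: "\<alpha> * \<alpha>' = e" using r \<alpha>(3) by (simp add: \<alpha>'_def flip: mult.assoc)
  have "adj (\<alpha> * \<alpha>') = adj e" by (simp only: r1)
  then have ar: "adj \<alpha>' * \<alpha> = e"
    using \<alpha>(2) by (simp only: adj_mult psd_adj adj_e)
  have "adj \<alpha>' = adj \<alpha>' * (\<alpha> * \<alpha>')" using adj_in[OF in'] by (simp add: r1)
  also have "\<dots> = \<alpha>'" using in' by (simp only: ar flip: mult.assoc) simp
  finally have sa: "adj \<alpha>' = \<alpha>'" .
  have "psd (adj \<alpha>' * \<alpha> * \<alpha>')" using \<alpha>(2) by (rule psd_congr)
  then have "psd \<alpha>'" using ar in' by simp
  with \<alpha> in' r1 ar sa that show ?thesis by simp
qed

text \<open>This is \<open>0 \<le> trc (\<alpha> * (adj w * w))\<close> for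
  \<open>w = C X \<alpha>' - y\<close>, divided by \<open>2 C\<close>. The weight and its inverse
  fall on different terms, so that for \<open>\<alpha>\<close> near the root of the Gram sum of
  \<open>X\<close> both terms become multiples of its trace; \<open>C\<close> balances them.\<close>

lemma am_gm:
  assumes \<alpha>: "\<alpha> \<in> D" "psd \<alpha>" "\<alpha>' \<in> D" "psd \<alpha>'" "\<alpha> * \<alpha>' = e" "\<alpha>' * \<alpha> = e"
    and X: "X \<in> D" and y: "y \<in> D" and C: "0 < C"
  shows "trc (X * adj y) \<le> C / 2 * trc (\<alpha>' * (adj X * X)) + trc (\<alpha> * (adj y * y)) / (2 * C)"
proof -
  have sa: "adj \<alpha> = \<alpha>" "adj \<alpha>' = \<alpha>'" using \<alpha> by (auto simp: psd_adj)
  have aa: "\<alpha>' * (\<alpha> * b) = e * b" "\<alpha> * (\<alpha>' * b) = e * b" for b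
    using \<alpha>(5,6) by (simp_all flip: mult.assoc)
  let ?w = "C *\<^sub>R (X * \<alpha>') - y"
  have "0 \<le> trc (\<alpha> * (adj ?w * ?w))"
    using \<alpha> by (intro trc_psd_mult_nonneg psd_square)
  also have "\<alpha> * (adj ?w * ?w) = (C * C) *\<^sub>R (adj X * X * \<alpha>') - C *\<^sub>R (adj X * y)
      - C *\<^sub>R (\<alpha> * adj y * X * \<alpha>') + \<alpha> * (adj y * y)"
    using X y \<alpha> by (simp add: adj_simps sa algebra_simps aa adj_in)
  also have "trc \<dots> = C * C * trc (\<alpha>' * (adj X * X)) - 2 * C * trc (X * adj y) + trc (\<alpha> * (adj y * y))"
  proof -
    have 1: "trc (adj X * y) = trc (X * adj y)"
      using trc_adj[of "adj X * y"] by (simp add: adj_mult trc_comm)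
    have "trc (\<alpha> * adj y * X * \<alpha>') = trc (\<alpha>' * (\<alpha> * adj y * X))"
      by (rule trc_comm)
    also have "\<dots> = trc (adj y * X)" using y by (simp add: mult.assoc aa adj_in)
    finally have 2: "trc (\<alpha> * adj y * X * \<alpha>') = trc (X * adj y)" by (simp add: trc_comm)
    show ?thesis using trc_comm[of "adj X * X" \<alpha>'] by (simp add: trc_simps 1 2)
  qed
  finally show ?thesis using C by (simp add: field_simps)
qed

text \<open>The easy half of the duality between the trace of a column square root and the column
  operator norm: \<open>am_gm\<close> is summed with the root \<open>g\<close> as weight. Since
  \<open>g\<close> may be singular, the weight is \<open>g + \<delta> e\<close>, and its extra cost
  disappears with \<open>\<delta>\<close>.\<close>

lemma trace_duality:
  assumes g: "g \<in> D" "psd g" "g * g = (\<Sum>k\<in>K. adj (X k) * X k)"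
    and X: "\<And>k. k \<in> K \<Longrightarrow> X k \<in> D" and y: "\<And>k. k \<in> K \<Longrightarrow> y k \<in> D"
    and C: "0 < C" and le: "psd ((C\<^sup>2) *\<^sub>R e - (\<Sum>k\<in>K. adj (y k) * y k))"
  shows "(\<Sum>k\<in>K. trc (X k * adj (y k))) \<le> C * trc g"
proof (rule field_le_epsilon)
  fix \<eta> :: real assume \<eta>: "0 < \<eta>"
  have e0: "0 \<le> trc e" using trc_psd_nonneg psd_e by auto
  \<comment> \<open>The regularisation costs \<open>C * \<delta> * trc e / 2\<close>. The summand 1
    covers the zero corner, where \<open>trc e = 0\<close>.\<close>
  define \<delta> where "\<delta> = \<eta> / (C * (trc e + 1))"
  have \<delta>: "0 < \<delta>" "C * \<delta> * trc e \<le> \<eta>"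
  proof -
    have "0 < C * (trc e + 1)" using C e0 by simp
    then show "0 < \<delta>" using \<eta> by (simp add: \<delta>_def)
    have "C * \<delta> * trc e = \<eta> * (trc e / (trc e + 1))"
      using C by (simp add: \<delta>_def)
    also have "\<dots> \<le> \<eta> * 1" using \<eta> e0 by (intro mult_left_mono) auto
    finally show "C * \<delta> * trc e \<le> \<eta>" by simp
  qed
  define \<alpha> where "\<alpha> = g + \<delta> *\<^sub>R e"
  obtain \<alpha>' where \<alpha>': "\<alpha>' \<in> D" "psd \<alpha>'" "\<alpha> * \<alpha>' = e" "\<alpha>' * \<alpha> = e"
    using regular_inverse[OF g(1,2) \<delta>(1)] unfolding \<alpha>_def by blast
  have \<alpha>: "\<alpha> \<in> D" "psd \<alpha>"
    using g \<delta> psd_e by (auto simp: \<alpha>_def intro!: psd_add psd_scaleR)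
  have "\<alpha>' * (g * g) = g - \<delta> *\<^sub>R (\<alpha>' * g)"
  proof -
    have "g * g = \<alpha> * g - \<delta> *\<^sub>R g" using g by (simp add: \<alpha>_def algebra_simps)
    then have "\<alpha>' * (g * g) = (\<alpha>' * \<alpha>) * g - \<delta> *\<^sub>R (\<alpha>' * g)"
      by (simp only: right_diff_distrib mult.assoc mult_scaleR_right)
    then show ?thesis using \<alpha>'(4) g by simp
  qed
  moreover have "0 \<le> trc (\<alpha>' * g)" using \<alpha>' g by (intro trc_psd_mult_nonneg)
  ultimately have 1: "trc (\<alpha>' * (g * g)) \<le> trc g"
    using \<delta> by (simp add: trc_diff trc_scaleR)
  have "trc (\<alpha> * (\<Sum>k\<in>K. adj (y k) * y k)) \<le> trc (\<alpha> * ((C\<^sup>2) *\<^sub>R e))"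
    by (rule trc_psd_mult_mono[OF \<alpha> le])
  then have 2: "(\<Sum>k\<in>K. trc (\<alpha> * (adj (y k) * y k))) \<le> C\<^sup>2 * trc \<alpha>"
    using \<alpha> by (simp add: sum_distrib_left trc_sum trc_scaleR)
  have "(\<Sum>k\<in>K. trc (X k * adj (y k))) \<le>
    (\<Sum>k\<in>K. C / 2 * trc (\<alpha>' * (adj (X k) * X k)) + trc (\<alpha> * (adj (y k) * y k)) / (2 * C))"
    using \<alpha> \<alpha>' X y C by (intro sum_mono am_gm)
  also have "\<dots> = C / 2 * trc (\<alpha>' * (g * g)) + (\<Sum>k\<in>K. trc (\<alpha> * (adj (y k) * y k))) / (2 * C)"
    unfolding g(3) by (simp add: sum.distrib sum_distrib_left trc_sum sum_divide_distrib)
  also have "\<dots> \<le> C / 2 * trc g + C\<^sup>2 * trc \<alpha> / (2 * C)"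
    using 1 2 C by (intro add_mono divide_right_mono mult_left_mono) auto
  also have "\<dots> = C * trc g + C * \<delta> * trc e / 2"
    using C by (simp add: \<alpha>_def trc_simps power2_eq_square field_simps)
  also have "\<dots> \<le> C * trc g + \<eta>" using \<delta>(2) \<eta> by simp
  finally show "(\<Sum>k\<in>K. trc (X k * adj (y k))) \<le> C * trc g + \<eta>" .
qed

text \<open>The operator norm is at most the Hilbert-Schmidt norm. Submultiplicativity of the
  latter, assumed in the class as \<open>trc_square_mult_le\<close>, is tested against
  \<open>e * q\<close>, where the factor \<open>e\<close> produces
  \<open>trc (adj q * e * q)\<close> on the right.\<close>

lemma square_adj_le_trc:
  assumes "g \<in> D"
  shows "psd (trc (adj g * g) *\<^sub>R e - g * adj g)"
  unfolding psd_def
proof (intro conjI allI)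
  show "adj (trc (adj g * g) *\<^sub>R e - g * adj g) = trc (adj g * g) *\<^sub>R e - g * adj g"
    by (simp add: adj_simps)
  fix q
  have "trc (adj (adj g * (e * q)) * (adj g * (e * q))) \<le> trc (adj (adj g) * adj g) * trc (adj (e * q) * (e * q))"
    by (rule trc_square_mult_le)
  moreover have "adj g * (e * q) = adj g * q" using assms by (simp add: adj_in)
  ultimately show "0 \<le> trc (adj q * (trc (adj g * g) *\<^sub>R e - g * adj g) * q)"
    using e_in trc_comm[of g "adj g"] by (simp add: adj_simps algebra_simps trc_simps)
qed

lemma trc_adj_swap: "trc (adj a * b) = trc (a * adj b)"
  using trc_adj[of "adj a * b"] by (simp add: adj_mult trc_comm)

section \<open>Regularised square roots and near-optimal decompositions\<close>

definition reg_root :: "real \<Rightarrow> 'a \<Rightarrow> 'a \<Rightarrow> 'a \<Rightarrow> bool" where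
  "reg_root \<epsilon> p \<alpha> \<alpha>' \<longleftrightarrow> \<alpha> \<in> D \<and> psd \<alpha> \<and> \<alpha> * \<alpha> = p + \<epsilon> *\<^sub>R e \<and>
     \<alpha>' \<in> D \<and> psd \<alpha>' \<and> \<alpha> * \<alpha>' = e \<and> \<alpha>' * \<alpha> = e"

lemma reg_root_ex:
  assumes "p \<in> D" "psd p" "0 < \<epsilon>"
  shows "\<exists>\<alpha> \<alpha>'. reg_root \<epsilon> p \<alpha> \<alpha>'"
  using regular_sqrt[OF assms] unfolding reg_root_def by metis

text \<open>If \<open>p\<close> is the column Gram sum of \<open>X\<close>, the left side is that of
  \<open>X * \<alpha>'\<close>; the identity exhibits the normalised family as a column contraction.
  For row sums the factor stands on the other side.\<close>

lemma reg_root_sandwich: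
  assumes "reg_root \<epsilon> p \<alpha> \<alpha>'"
  shows "\<alpha>' * p * \<alpha>' = e - \<epsilon> *\<^sub>R (\<alpha>' * \<alpha>')"
proof -
  note r = assms[unfolded reg_root_def]
  have "p = \<alpha> * \<alpha> - \<epsilon> *\<^sub>R e" using r by simp
  then have "\<alpha>' * p * \<alpha>' = (\<alpha>' * \<alpha>) * (\<alpha> * \<alpha>') - \<epsilon> *\<^sub>R (\<alpha>' * e * \<alpha>')"
    by (simp only: right_diff_distrib left_diff_distrib mult.assoc mult_scaleR_right mult_scaleR_left)
  then show ?thesis using r by auto
qed

lemma reg_root_trc:
  assumes "reg_root \<epsilon> p \<alpha> \<alpha>'"
  shows "trc (\<alpha>' * p) = trc \<alpha> - \<epsilon> * trc \<alpha>'"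
proof -
  note r = assms[unfolded reg_root_def]
  have "p = \<alpha> * \<alpha> - \<epsilon> *\<^sub>R e" using r by simp
  then have "\<alpha>' * p = (\<alpha>' * \<alpha>) * \<alpha> - \<epsilon> *\<^sub>R (\<alpha>' * e)"
    by (simp only: right_diff_distrib mult.assoc mult_scaleR_right)
  then show ?thesis using r by (auto simp: trc_simps)
qed

text \<open>Completing the square: \<open>2 (e - sqrt \<epsilon> \<alpha>') = (sqrt \<epsilon>
  \<alpha>' - e)^2 + (e - \<epsilon> \<alpha>'^2)\<close>, and the last term is positive by
  \<open>reg_root_sandwich\<close>.\<close>

lemma reg_root_inverse_le:
  assumes r: "reg_root \<epsilon> p \<alpha> \<alpha>'" and p: "psd p" and \<epsilon>: "0 < \<epsilon>"
  shows "psd ((1 / sqrt \<epsilon>) *\<^sub>R e - \<alpha>')"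
proof -
  note r' = r[unfolded reg_root_def]
  have sa: "adj \<alpha>' = \<alpha>'" using r' by (simp add: psd_adj)
  let ?v = "sqrt \<epsilon> *\<^sub>R \<alpha>' - e"
  have "psd (adj \<alpha>' * p * \<alpha>')" using p by (rule psd_congr)
  then have "psd (e - \<epsilon> *\<^sub>R (\<alpha>' * \<alpha>'))" using reg_root_sandwich[OF r] sa by simp
  then have psd: "psd ((1 / (2 * sqrt \<epsilon>)) *\<^sub>R (adj ?v * ?v + (e - \<epsilon> *\<^sub>R (\<alpha>' * \<alpha>'))))"
    using \<epsilon> by (intro psd_scaleR psd_add psd_square) auto
  have two: "(r * 2) *\<^sub>R x = r *\<^sub>R x + r *\<^sub>R x" for r and x :: 'a
    by (metis mult_2_right scaleR_left_distrib)
  note psd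
  also have "adj ?v * ?v + (e - \<epsilon> *\<^sub>R (\<alpha>' * \<alpha>')) = 2 *\<^sub>R (e - sqrt \<epsilon> *\<^sub>R \<alpha>')"
    using r' e_in \<epsilon> by (simp add: adj_simps sa algebra_simps scaleR_2 two)
  also have "(1 / (2 * sqrt \<epsilon>)) *\<^sub>R 2 *\<^sub>R (e - sqrt \<epsilon> *\<^sub>R \<alpha>') = (1 / sqrt \<epsilon>) *\<^sub>R e - \<alpha>'"
    using \<epsilon> by (simp add: algebra_simps)
  finally show ?thesis .
qed

text \<open>The trace of the square root is concave and lies below its tangent at
  \<open>p + \<epsilon> e\<close>. This yields both the quadratic majorant of the decomposition
  problem and the comparison of true roots with regularised ones.\<close>

lemma reg_root_trc_le:
  assumes r: "reg_root \<epsilon> p \<alpha> \<alpha>'" and s: "\<sigma> \<in> D" "psd \<sigma>"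
  shows "2 * trc \<sigma> \<le> trc (\<alpha>' * (\<sigma> * \<sigma>)) + trc \<alpha>"
  using am_gm[of \<alpha> \<alpha>' \<sigma> e 1] r s e_in unfolding reg_root_def by (simp add: psd_adj)

text \<open>A minimiser of \<open>tr (\<Sum>X\<^sup>*X + \<epsilon>)\<^sup>1\<^sup>/\<^sup>2 + tr (\<Sum>YY\<^sup>* + \<epsilon>)\<^sup>1\<^sup>/\<^sup>2\<close> over all
  decompositions \<open>c = X + Y\<close> satisfies \<open>X \<alpha>\<^sup>-\<^sup>1 = \<beta>\<^sup>-\<^sup>1 Y\<close>. A near-minimiser does so up to a small error,
  because \<open>\<epsilon>\<close> bounds the curvature of the quadratic majorant supplied by \<open>am_gm\<close>.\<close>

lemma near_optimal_decomposition:
  fixes c :: "'k \<Rightarrow> 'a"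
  assumes c: "\<And>k. k \<in> K \<Longrightarrow> c k \<in> D" and \<epsilon>: "0 < \<epsilon>" and \<kappa>: "0 < \<kappa>"
  obtains X Y \<alpha> \<alpha>' \<beta> \<beta>' where
    "\<And>k. k \<in> K \<Longrightarrow> X k \<in> D" "\<And>k. k \<in> K \<Longrightarrow> Y k \<in> D" "\<And>k. c k = X k + Y k"
    "reg_root \<epsilon> (\<Sum>k\<in>K. adj (X k) * X k) \<alpha> \<alpha>'"
    "reg_root \<epsilon> (\<Sum>k\<in>K. Y k * adj (Y k)) \<beta> \<beta>'"
    "(\<Sum>k\<in>K. trc (adj (X k * \<alpha>' - \<beta>' * Y k) * (X k * \<alpha>' - \<beta>' * Y k))) \<le> \<kappa>"
proof -
  let ?P = "\<lambda>X. \<Sum>k\<in>K. adj (X k) * X k"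
  let ?Q = "\<lambda>X. \<Sum>k\<in>K. X k * adj (X k)"
  define V where "V = {trc \<alpha> + trc \<beta> | X \<alpha> \<alpha>' \<beta> \<beta>'. (\<forall>k\<in>K. X k \<in> D) \<and>
    reg_root \<epsilon> (?P X) \<alpha> \<alpha>' \<and> reg_root \<epsilon> (?Q (\<lambda>k. c k - X k)) \<beta> \<beta>'}"
  have bdd: "bdd_below V"
    unfolding V_def by (intro bdd_belowI[of _ 0]) (auto simp: reg_root_def intro!: add_nonneg_nonneg trc_psd_nonneg)
  have exP: "\<exists>\<alpha> \<alpha>'. reg_root \<epsilon> (?P X) \<alpha> \<alpha>'" if "\<forall>k\<in>K. X k \<in> D" for X
    using that \<epsilon> by (intro reg_root_ex psd_sum psd_square) auto
  have exQ: "\<exists>\<alpha> \<alpha>'. reg_root \<epsilon> (?Q X) \<alpha> \<alpha>'" if "\<forall>k\<in>K. X k \<in> D" for X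
    using that \<epsilon> by (intro reg_root_ex psd_sum psd_square') auto
  have "V \<noteq> {}"
    using exP[of c] exQ[of "\<lambda>k. c k - c k"] c by (fastforce simp: V_def)
  \<comment> \<open>Calibrated so that the final estimate
    \<open>t * \<Gamma> \<le> 2 * \<eta>\<close> with \<open>t = sqrt \<epsilon> / 2\<close> reads
    \<open>\<Gamma> \<le> \<kappa>\<close>.\<close>
  define \<eta> where "\<eta> = \<kappa> * sqrt \<epsilon> / 4"
  have "\<eta> > 0" using \<epsilon> \<kappa> by (simp add: \<eta>_def)
  then obtain v where v: "v \<in> V" "v < Inf V + \<eta>"
    using cInf_lessD[OF \<open>V \<noteq> {}\<close>, of "Inf V + \<eta>"] by auto
  then obtain X \<alpha> \<alpha>' \<beta> \<beta>' where X: "\<And>k. k \<in> K \<Longrightarrow> X k \<in> D"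
    and R: "reg_root \<epsilon> (?P X) \<alpha> \<alpha>'" "reg_root \<epsilon> (?Q (\<lambda>k. c k - X k)) \<beta> \<beta>'"
    and v': "v = trc \<alpha> + trc \<beta>"
    unfolding V_def by blast
  define Y where "Y = (\<lambda>k. c k - X k)"
  have Y: "Y k \<in> D" if "k \<in> K" for k using X c that by (auto simp: Y_def)
  \<comment> \<open>The descent direction: when \<open>X\<close> moves to \<open>X - t g\<close> and
    \<open>Y\<close> to \<open>Y + t g\<close>, the derivative of the objective at
    \<open>t = 0\<close> is minus the square sum \<open>\<Gamma>\<close> of
    \<open>g\<close>.\<close>
  define g where "g = (\<lambda>k. X k * \<alpha>' - \<beta>' * Y k)"
  have RD: "\<alpha>' \<in> D" "\<beta>' \<in> D" "psd \<alpha>'" "psd \<beta>'" using R by (auto simp: reg_root_def)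
  have g: "g k \<in> D" if "k \<in> K" for k using X[OF that] Y[OF that] RD by (auto simp: g_def)
  define \<Gamma> where "\<Gamma> = (\<Sum>k\<in>K. trc (adj (g k) * g k))"
  \<comment> \<open>This step length minimises the change
    \<open>- 2 t \<Gamma> + 2 t^2 \<Gamma> / sqrt \<epsilon>\<close> of the majorant and leaves
    \<open>- t \<Gamma>\<close>.\<close>
  define t where "t = sqrt \<epsilon> / 2"
  define X1 where "X1 = (\<lambda>k. X k - t *\<^sub>R g k)"
  define Y1 where "Y1 = (\<lambda>k. Y k + t *\<^sub>R g k)"
  have X1: "\<forall>k\<in>K. X1 k \<in> D" "\<forall>k\<in>K. Y1 k \<in> D"
    unfolding X1_def Y1_def by (intro ballI diff_in add_in scaleR_in X Y g; assumption)+
  have Y1c: "Y1 = (\<lambda>k. c k - X1 k)" by (auto simp: Y1_def X1_def Y_def)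
  obtain \<alpha>1 \<alpha>1' where R1: "reg_root \<epsilon> (?P X1) \<alpha>1 \<alpha>1'" using exP X1 by blast
  obtain \<beta>1 \<beta>1' where R2: "reg_root \<epsilon> (?Q Y1) \<beta>1 \<beta>1'" using exQ X1 by blast
  have "trc \<alpha>1 + trc \<beta>1 \<in> V" using R1 R2 X1 unfolding V_def Y1c by blast
  then have "Inf V \<le> trc \<alpha>1 + trc \<beta>1" using bdd by (rule cInf_lower)
  \<comment> \<open>The tangent at the old root bounds the new root by an expression quadratic in
    \<open>X1\<close>, so the square root itself is never expanded.\<close>
  have 1: "2 * trc \<alpha>1 \<le> trc (\<alpha>' * ?P X1) + \<epsilon> * trc \<alpha>' + trc \<alpha>"
    using reg_root_trc_le[OF R(1), of \<alpha>1] R1 RD by (simp add: reg_root_def ring_distribs trc_simps)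
  have 2: "2 * trc \<beta>1 \<le> trc (\<beta>' * ?Q Y1) + \<epsilon> * trc \<beta>' + trc \<beta>"
    using reg_root_trc_le[OF R(2), of \<beta>1] R2 RD by (simp add: reg_root_def ring_distribs trc_simps)
  have sa: "adj \<alpha>' = \<alpha>'" "adj \<beta>' = \<beta>'" using RD by (auto simp: psd_adj)
  have 3: "trc (\<alpha>' * ?P X1) = trc (\<alpha>' * ?P X) - 2 * t * (\<Sum>k\<in>K. trc (\<alpha>' * adj (X k) * g k))
      + t\<^sup>2 * (\<Sum>k\<in>K. trc (\<alpha>' * (adj (g k) * g k)))"
  proof -
    have "trc (\<alpha>' * (adj (X1 k) * X1 k)) = trc (\<alpha>' * (adj (X k) * X k)) - 2 * t * trc (\<alpha>' * adj (X k) * g k)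
      + t\<^sup>2 * trc (\<alpha>' * (adj (g k) * g k))" for k
    proof -
      have "trc (\<alpha>' * (adj (g k) * X k)) = trc (\<alpha>' * (adj (X k) * g k))"
        using trc_adj[of "\<alpha>' * (adj (g k) * X k)"] by (simp add: adj_mult sa trc_comm)
      then show ?thesis
        by (simp add: X1_def adj_simps algebra_simps trc_simps power2_eq_square)
    qed
    then show ?thesis
      by (simp add: sum_distrib_left trc_sum sum.distrib sum_subtractf mult.assoc)
  qed
  have 4: "trc (\<beta>' * ?Q Y1) = trc (\<beta>' * ?Q Y) + 2 * t * (\<Sum>k\<in>K. trc (\<beta>' * g k * adj (Y k)))
      + t\<^sup>2 * (\<Sum>k\<in>K. trc (\<beta>' * (g k * adj (g k))))"
  proof -
    have "trc (\<beta>' * (Y1 k * adj (Y1 k))) = trc (\<beta>' * (Y k * adj (Y k))) + 2 * t * trc (\<beta>' * g k * adj (Y k))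
      + t\<^sup>2 * trc (\<beta>' * (g k * adj (g k)))" for k
    proof -
      have "trc (\<beta>' * (Y k * adj (g k))) = trc (\<beta>' * (g k * adj (Y k)))"
        using trc_adj[of "\<beta>' * (Y k * adj (g k))"] by (simp add: adj_mult sa trc_comm)
      then show ?thesis
        by (simp add: Y1_def adj_simps algebra_simps trc_simps power2_eq_square)
    qed
    then show ?thesis
      by (simp add: sum_distrib_left trc_sum sum.distrib mult.assoc)
  qed
  have 5: "(\<Sum>k\<in>K. trc (\<alpha>' * adj (X k) * g k)) - (\<Sum>k\<in>K. trc (\<beta>' * g k * adj (Y k))) = \<Gamma>"
  proof -
    have "trc (adj (g k) * g k) = trc (\<alpha>' * adj (X k) * g k) - trc (\<beta>' * g k * adj (Y k))" for k
    proof -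
      have "adj (g k) * g k = \<alpha>' * adj (X k) * g k - adj (Y k) * (\<beta>' * g k)"
        by (subst g_def) (simp add: adj_simps sa algebra_simps)
      then show ?thesis using trc_comm[of "adj (Y k)" "\<beta>' * g k"] by (simp add: trc_diff)
    qed
    then show ?thesis by (simp add: \<Gamma>_def sum_subtractf)
  qed
  have 6: "(\<Sum>k\<in>K. trc (\<alpha>' * (adj (g k) * g k))) \<le> \<Gamma> / sqrt \<epsilon>"
  proof -
    have "psd ((1 / sqrt \<epsilon>) *\<^sub>R e - \<alpha>')"
      using R(1) \<epsilon> by (rule reg_root_inverse_le[OF _ psd_sum[OF psd_square]])
    then have "0 \<le> trc (((1 / sqrt \<epsilon>) *\<^sub>R e - \<alpha>') * (adj (g k) * g k))" for k
      using RD by (intro trc_psd_mult_nonneg psd_square) auto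
    note h = this
    have "trc (\<alpha>' * (adj (g k) * g k)) \<le> trc (adj (g k) * g k) / sqrt \<epsilon>" if "k \<in> K" for k
      using h[of k] g[OF that] adj_in[OF g[OF that]] by (simp add: left_diff_distrib trc_simps)
    then show ?thesis unfolding \<Gamma>_def sum_divide_distrib by (rule sum_mono)
  qed
  have 7: "(\<Sum>k\<in>K. trc (\<beta>' * (g k * adj (g k)))) \<le> \<Gamma> / sqrt \<epsilon>"
  proof -
    have "psd ((1 / sqrt \<epsilon>) *\<^sub>R e - \<beta>')"
      using R(2) \<epsilon> by (rule reg_root_inverse_le[OF _ psd_sum[OF psd_square']])
    then have "0 \<le> trc (((1 / sqrt \<epsilon>) *\<^sub>R e - \<beta>') * (g k * adj (g k)))" for k
      using RD by (intro trc_psd_mult_nonneg psd_square') auto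
    note h = this
    have "trc (\<beta>' * (g k * adj (g k))) \<le> trc (adj (g k) * g k) / sqrt \<epsilon>" if "k \<in> K" for k
      using h[of k] g[OF that] trc_comm[of "g k" "adj (g k)"] by (simp add: left_diff_distrib trc_simps)
    then show ?thesis unfolding \<Gamma>_def sum_divide_distrib by (rule sum_mono)
  qed
  have 8: "trc (\<alpha>' * ?P X) = trc \<alpha> - \<epsilon> * trc \<alpha>'" "trc (\<beta>' * ?Q Y) = trc \<beta> - \<epsilon> * trc \<beta>'"
    using reg_root_trc[OF R(1)] reg_root_trc[OF R(2)] by (simp_all add: Y_def)
  let ?G1 = "\<Sum>k\<in>K. trc (\<alpha>' * adj (X k) * g k)" and ?G2 = "\<Sum>k\<in>K. trc (\<beta>' * g k * adj (Y k))"
  let ?H1 = "\<Sum>k\<in>K. trc (\<alpha>' * (adj (g k) * g k))" and ?H2 = "\<Sum>k\<in>K. trc (\<beta>' * (g k * adj (g k)))"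
  have "2 * Inf V \<le> 2 * (trc \<alpha> + trc \<beta>) - 2 * t * (?G1 - ?G2) + t\<^sup>2 * (?H1 + ?H2)"
    using \<open>Inf V \<le> trc \<alpha>1 + trc \<beta>1\<close> 1 2 3 4 8 by (simp add: algebra_simps)
  also have "\<dots> \<le> 2 * (trc \<alpha> + trc \<beta>) - 2 * t * \<Gamma> + t\<^sup>2 * (2 * (\<Gamma> / sqrt \<epsilon>))"
    unfolding 5 using add_mono[OF 6 7] by (intro add_mono order.refl mult_left_mono) auto
  also have "t\<^sup>2 * (2 * (\<Gamma> / sqrt \<epsilon>)) = t * \<Gamma>"
    using \<epsilon> real_sqrt_mult_self[of \<epsilon>] by (simp add: t_def power2_eq_square field_simps)
  finally have "t * \<Gamma> \<le> 2 * \<eta>"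
    using v(2) v' by argo
  then have "sqrt \<epsilon> * \<Gamma> \<le> sqrt \<epsilon> * \<kappa>"
    unfolding t_def \<eta>_def by argo
  then have "\<Gamma> \<le> \<kappa>" using \<epsilon> by simp
  then have \<Gamma>: "(\<Sum>k\<in>K. trc (adj (X k * \<alpha>' - \<beta>' * Y k) * (X k * \<alpha>' - \<beta>' * Y k))) \<le> \<kappa>"
    by (simp only: \<Gamma>_def g_def)
  have cXY: "c k = X k + Y k" for k by (simp add: Y_def)
  have R2Y: "reg_root \<epsilon> (?Q Y) \<beta> \<beta>'" using R(2) by (simp add: Y_def)
  from that[OF X Y cXY R(1) R2Y \<Gamma>] show thesis .
qed

text \<open>The smooth truncation \<open>t \<mapsto> t / (1 + t\<^sup>2 / 3)\<close>: it is bounded by \<open>\<surd>3 / 2\<close> and differs from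
  \<open>t\<close> by at most \<open>t\<^sup>2 / \<surd>12\<close>.\<close>

lemma truncation:
  assumes X: "X \<in> D"
  obtains Z where "Z \<in> D"
    "psd ((3/4) *\<^sub>R e - adj Z * Z)"
    "psd ((1/12) *\<^sub>R (adj X * X * adj X * X) - adj (X - Z) * (X - Z))"
    "psd ((1/12) *\<^sub>R (X * adj X * X * adj X) - (X - Z) * adj (X - Z))"
proof -
  define T where "T = (1/3) *\<^sub>R (adj X * X)"
  have T: "T \<in> D" "psd T" using X by (auto simp: T_def intro!: psd_scaleR psd_square)
  obtain R where R: "R \<in> D" "psd R" "(T + 1 *\<^sub>R e) * R = e" "R * (T + 1 *\<^sub>R e) = e"
    using regular_inverse[OF T, of 1] by auto
  have sa: "adj T = T" "adj R = R" using T R by (auto simp: psd_adj)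
  have TR: "T * R = e - R" "R * T = e - R"
    using R by (simp_all add: algebra_simps)
  have TRa: "T * (R * b) = e * b - R * b" "R * (T * b) = e * b - R * b" for b
    using TR by (simp_all add: left_diff_distrib flip: mult.assoc)
  have XX: "adj X * X = 3 *\<^sub>R T" by (simp add: T_def)
  have XXa: "adj X * (X * b) = 3 *\<^sub>R (T * b)" for b using XX by (simp flip: mult.assoc)
  define Z where "Z = X * R"
  \<comment> \<open>By \<open>1 - 4 T / (1 + T)^2 = ((1 - T) / (1 + T))^2\<close> both column slacks
    are \<open>3/4\<close> times a square; the second carries the extra factor
    \<open>T^2\<close>.\<close>
  let ?v = "(e - T) * R" and ?w = "(e - T) * (T * R)"
  have W: "X - Z = X * (T * R)" using X by (simp add: Z_def TR algebra_simps)
  have 1: "adj ?v * ?v = e - (T*R*R + T*R*R + T*R*R + T*R*R)"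
    using T R by (simp add: adj_simps sa algebra_simps TR TRa)
  have 2: "adj ?w * ?w = T * T - (T*T*T*R*R + T*T*T*R*R + T*T*T*R*R + T*T*T*R*R)"
    using T R by (simp add: adj_simps sa algebra_simps TR TRa)
  have 3: "adj ?v * T * ?v = T - (T*T*R*R + T*T*R*R + T*T*R*R + T*T*R*R)"
    using T R by (simp add: adj_simps sa algebra_simps TR TRa)
  have four: "x + x + x + x = 4 *\<^sub>R x" for x :: 'a
    using scaleR_left_distrib[of 2 2 x] by (simp add: scaleR_2)
  have "psd ((3/4) *\<^sub>R (adj ?v * ?v))" by (intro psd_scaleR psd_square) auto
  also have "(3/4) *\<^sub>R (adj ?v * ?v) = (3/4) *\<^sub>R e - adj Z * Z"
    using T R unfolding 1 four Z_def by (simp add: adj_simps sa algebra_simps XXa TR TRa)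
  finally have I: "psd ((3/4) *\<^sub>R e - adj Z * Z)" .
  have "psd ((3/4) *\<^sub>R (adj ?w * ?w))" by (intro psd_scaleR psd_square) auto
  also have "(3/4) *\<^sub>R (adj ?w * ?w) = (1/12) *\<^sub>R (adj X * X * adj X * X) - adj (X - Z) * (X - Z)"
    using T R unfolding 2 four W by (simp add: adj_simps sa algebra_simps XX XXa TR TRa)
  finally have II: "psd ((1/12) *\<^sub>R (adj X * X * adj X * X) - adj (X - Z) * (X - Z))" .
  \<comment> \<open>The row version is a conjugate by \<open>X\<close> of
    \<open>(1/4) T (1 - 4 T R^2)\<close>, so only the resolvent \<open>R\<close> of the column
    square is involved.\<close>
  have "psd (X * ((1/4) *\<^sub>R (adj ?v * T * ?v)) * adj X)"
    using T by (intro psd_scaleR psd_congr psd_congr') auto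
  also have "X * ((1/4) *\<^sub>R (adj ?v * T * ?v)) * adj X
      = (1/12) *\<^sub>R (X * adj X * X * adj X) - (X - Z) * adj (X - Z)"
    using T R unfolding 3 four W by (simp add: adj_simps sa algebra_simps XX XXa TR TRa)
  finally have III: "psd ((1/12) *\<^sub>R (X * adj X * X * adj X) - (X - Z) * adj (X - Z))" .
  have "Z \<in> D" using X R by (auto simp: Z_def)
  from that[OF this I II III] show thesis .
qed

end

section \<open>Commuting and anticommuting systems\<close>

definition paired :: "'k \<Rightarrow> 'k \<Rightarrow> 'k \<Rightarrow> 'k \<Rightarrow> bool" where
  "paired a b c d \<longleftrightarrow> a = b \<and> c = d \<or> a = d \<and> b = c \<or> a = c \<and> b = d"

text \<open>Self-adjoint unitaries \<open>E k\<close> of an ambient corner \<open>B\<close> which commute with \<open>D\<close> and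
  pairwise commute or anticommute; by \<open>separated\<close>, every unpaired word of length four anticommutes
  with some generator and so has vanishing trace.\<close>

locale commutation_system = D: trace_corner D e + B: trace_corner B e
  for D B :: "'a :: star_trace set" and e +
  fixes K :: "'k set" and s :: "'k \<Rightarrow> 'k \<Rightarrow> real" and E :: "'k \<Rightarrow> 'a"
  assumes sub: "D \<subseteq> B" and fin: "finite K"
    and E_in: "k \<in> K \<Longrightarrow> E k \<in> B"
    and E_adj: "k \<in> K \<Longrightarrow> adj (E k) = E k"
    and E_sq: "k \<in> K \<Longrightarrow> E k * E k = e"
    and E_comm: "k \<in> K \<Longrightarrow> x \<in> D \<Longrightarrow> E k * x = x * E k"
    and E_swap: "a \<in> K \<Longrightarrow> b \<in> K \<Longrightarrow> E a * E b = s a b *\<^sub>R (E b * E a)"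
    and s_sym: "s a b = s b a"
    and s_cases: "s a b = 1 \<or> s a b = -1"
    and separated: "\<lbrakk>a \<in> K; b \<in> K; c \<in> K; d \<in> K; \<not> paired a b c d\<rbrakk> \<Longrightarrow>
      \<exists>u\<in>K. s u a * s u b * s u c * s u d = -1"
begin

lemma in_B [simp]: "a \<in> D \<Longrightarrow> a \<in> B"
  using sub by auto

lemma E_sq_left: "k \<in> K \<Longrightarrow> E k * (E k * b) = e * b"
  using E_sq by (simp flip: mult.assoc)

text \<open>The three pairings of four positions behave differently: adjacent and nested pairs
  cancel to \<open>e\<close>, while a crossing pair costs the sign \<open>s a b\<close> of one swap.
  For an unpaired word, cyclicity carries \<open>E u\<close> around \<open>x\<close> and the word,
  and the odd sign makes the trace its own negative. The order of the conditionals counts a word of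
  four equal letters once.\<close>

lemma trc_word:
  assumes K: "a \<in> K" "b \<in> K" "c \<in> K" "d \<in> K" and x: "x \<in> D"
  shows "trc (x * (E a * E b * E c * E d)) =
    (if a = b \<and> c = d then trc x else if a = d \<and> b = c then trc x
     else if a = c \<and> b = d then s a b * trc x else 0)"
proof -
  have EB: "E a \<in> B" "E b \<in> B" "E c \<in> B" "E d \<in> B" using K E_in by auto
  consider "a = b" "c = d" | "\<not> (a = b \<and> c = d)" "a = d" "b = c"
    | "\<not> (a = b \<and> c = d)" "\<not> (a = d \<and> b = c)" "a = c" "b = d" | "\<not> paired a b c d"
    by (auto simp: paired_def)
  then show ?thesis
  proof cases
    case 1
    then show ?thesis using K x by (simp add: mult.assoc E_sq E_sq_left)
  next
    case 2
    have "E a * E b * E c * E d = E a * (E b * (E b * E a))" using 2 by (simp add: mult.assoc)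
    also have "\<dots> = e" using K EB by (simp add: E_sq_left E_sq)
    finally show ?thesis using 2 x by simp
  next
    case 3
    have "E a * E b * E c * E d = E a * E b * (E a * E b)" using 3 by (simp add: mult.assoc)
    also have "\<dots> = E a * E b * (s a b *\<^sub>R (E b * E a))" using E_swap[OF K(1,2)] by simp
    also have "\<dots> = s a b *\<^sub>R (E a * (E b * (E b * E a)))" by (simp add: mult.assoc)
    also have "\<dots> = s a b *\<^sub>R e" using K EB by (simp add: E_sq_left E_sq)
    finally show ?thesis using 3 x by (simp add: trc_scaleR)
  next
    case 4
    obtain u where u: "u \<in> K" "s u a * s u b * s u c * s u d = -1"
      using separated[OF K 4] by blast
    define w where "w = E a * E b * E c * E d"
    have wB: "w \<in> B" unfolding w_def using EB by auto
    have sw: "E u * (E k * b) = s u k *\<^sub>R (E k * (E u * b))" if "k \<in> K" for k b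
    proof -
      have "E u * (E k * b) = (E u * E k) * b" by (simp only: mult.assoc)
      then show ?thesis by (simp only: E_swap[OF u(1) that] mult.assoc mult_scaleR_left)
    qed
    have "E u * w = (s u a * s u b * s u c * s u d) *\<^sub>R (w * E u)"
      unfolding w_def mult.assoc sw[OF K(1)] sw[OF K(2)] sw[OF K(3)] E_swap[OF u(1) K(4)]
      by (simp only: mult_scaleR_right scaleR_scaleR mult.assoc)
    then have anti: "E u * w = - (w * E u)" by (simp only: u(2) scaleR_minus_left scaleR_one)
    have "trc (x * w) = trc ((x * w) * (E u * E u))"
      using u wB x by (simp add: E_sq mult.assoc)
    also have "\<dots> = trc (E u * ((x * w) * E u))"
      using trc_comm[of "(x * w) * E u" "E u"] by (simp only: mult.assoc)
    also have "E u * ((x * w) * E u) = (E u * x) * w * E u" by (simp only: mult.assoc)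
    also have "\<dots> = x * (E u * w) * E u" by (simp only: E_comm[OF u(1) x] mult.assoc)
    also have "\<dots> = - (x * w * (E u * E u))"
      by (simp only: anti mult.assoc mult_minus_left mult_minus_right)
    also have "trc \<dots> = - trc (x * w)"
      using u wB x by (simp add: E_sq mult.assoc trc_minus)
    finally have 0: "trc (x * (E a * E b * E c * E d)) = 0" by (simp add: w_def)
    from 4 have "\<not> (a = b \<and> c = d)" "\<not> (a = d \<and> b = c)" "\<not> (a = c \<and> b = d)"
      unfolding paired_def by blast+
    then show ?thesis by (simp only: 0 if_False)
  qed
qed

section \<open>Second and fourth moments of embedded sums\<close>

definition embed :: "('k \<Rightarrow> 'a) \<Rightarrow> 'a" where
  "embed x = (\<Sum>k\<in>K. x k * E k)"

lemma embed_in: "(\<And>k. k \<in> K \<Longrightarrow> x k \<in> D) \<Longrightarrow> embed x \<in> B"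
  unfolding embed_def by (intro B.sum_in B.mult_in E_in in_B)

lemma adj_embed:
  assumes "\<And>k. k \<in> K \<Longrightarrow> x k \<in> D"
  shows "adj (embed x) = embed (\<lambda>k. adj (x k))"
  unfolding embed_def adj_sum
  by (intro sum.cong refl) (simp add: adj_mult E_adj E_comm D.adj_in assms)

lemma embed_mult:
  assumes "\<And>k. k \<in> K \<Longrightarrow> y k \<in> D"
  shows "embed x * embed y = (\<Sum>a\<in>K. \<Sum>b\<in>K. x a * y b * (E a * E b))"
  unfolding embed_def sum_product
proof (intro sum.cong refl)
  fix a b assume ab: "a \<in> K" "b \<in> K"
  have "x a * E a * (y b * E b) = x a * (E a * y b) * E b" by (simp add: mult.assoc)
  then show "x a * E a * (y b * E b) = x a * y b * (E a * E b)"
    using E_comm[OF ab(1) assms[OF ab(2)]] by (simp add: mult.assoc)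
qed

lemma trc_embed2:
  assumes x: "\<And>k. k \<in> K \<Longrightarrow> x k \<in> D" and y: "\<And>k. k \<in> K \<Longrightarrow> y k \<in> D" and a: "a \<in> D"
  shows "trc (a * (embed x * embed y)) = (\<Sum>k\<in>K. trc (a * (x k * y k)))"
proof -
  have 1: "trc (z * (E k * E l)) = (if k = l then trc z else 0)" if "k \<in> K" "l \<in> K" "z \<in> D" for k l z
  proof (cases "k = l")
    case True
    then show ?thesis using that by (simp add: E_sq)
  next
    case False
    \<comment> \<open>Padding with \<open>E k * E k = e\<close> gives the four-letter word
      \<open>k l k k\<close>, which is unpaired when \<open>k \<noteq> l\<close>.\<close>
    have "E k * E l * E k * E k = E k * E l"
      using E_in[OF that(1)] E_in[OF that(2)] E_sq[OF that(1)] by (simp add: mult.assoc)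
    then show ?thesis using trc_word[OF that(1,2,1,1,3)] False by simp
  qed
  have "trc (a * (embed x * embed y)) = (\<Sum>k\<in>K. \<Sum>l\<in>K. trc ((a * (x k * y l)) * (E k * E l)))"
    using embed_mult[where x=x and y=y, OF y] by (simp add: sum_distrib_left trc_sum mult.assoc)
  also have "\<dots> = (\<Sum>k\<in>K. \<Sum>l\<in>K. if k = l then trc (a * (x k * y l)) else 0)"
    using x y a by (intro sum.cong refl 1) auto
  also have "\<dots> = (\<Sum>k\<in>K. trc (a * (x k * y k)))"
    using fin by (intro sum.cong refl) (simp add: sum.delta)
  finally show ?thesis .
qed

text \<open>One sum for each surviving pairing of positions: adjacent, nested, crossing. Words of
  four equal letters fit all three pairings and are kept in the first sum only.\<close>

lemma trc_embed4:
  assumes x: "\<And>k. k \<in> K \<Longrightarrow> x k \<in> D" and y: "\<And>k. k \<in> K \<Longrightarrow> y k \<in> D"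
    and z: "\<And>k. k \<in> K \<Longrightarrow> z k \<in> D" and w: "\<And>k. k \<in> K \<Longrightarrow> w k \<in> D" and \<alpha>: "\<alpha> \<in> D"
  shows "trc (\<alpha> * (embed x * embed y * (embed z * embed w))) =
    (\<Sum>a\<in>K. \<Sum>c\<in>K. trc (\<alpha> * (x a * y a * (z c * w c))))
    + (\<Sum>a\<in>K. \<Sum>b\<in>K. if a = b then 0 else trc (\<alpha> * (x a * y b * (z b * w a))))
    + (\<Sum>a\<in>K. \<Sum>b\<in>K. if a = b then 0 else s a b * trc (\<alpha> * (x a * y b * (z a * w b))))"
proof -
  let ?t = "\<lambda>a b c d. trc (\<alpha> * (x a * y b * (z c * w d)))"
  \<comment> \<open>The exclusive cases become a sum of nested Kronecker deltas, which can be
    collapsed one summation at a time.\<close>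
  have split: "(if a = b \<and> c = d then t else if a = d \<and> b = c then t else if a = c \<and> b = d then r else 0) =
      (if c = d then (if a = b then t else 0) else 0)
      + (if d = a then (if c = b then (if a = b then 0 else t) else 0) else 0)
      + (if d = b then (if c = a then (if a = b then 0 else r) else 0) else 0)"
    for a b c d :: 'k and t r :: real
    by (smt (verit))
  have "trc (\<alpha> * (embed x * embed y * (embed z * embed w))) =
     (\<Sum>a\<in>K. \<Sum>b\<in>K. \<Sum>c\<in>K. \<Sum>d\<in>K. trc (\<alpha> * ((x a * y b * (E a * E b)) * (z c * w d * (E c * E d)))))"
    by (simp only: embed_mult[where x=x and y=y, OF y] embed_mult[where x=z and y=w, OF w] sum_distrib_right)
      (simp only: sum_distrib_left trc_sum)
  also have "\<dots> = (\<Sum>a\<in>K. \<Sum>b\<in>K. \<Sum>c\<in>K. \<Sum>d\<in>K.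
      (if c = d then (if a = b then ?t a b c d else 0) else 0)
      + (if d = a then (if c = b then (if a = b then 0 else ?t a b c d) else 0) else 0)
      + (if d = b then (if c = a then (if a = b then 0 else s a b * ?t a b c d) else 0) else 0))"
  proof (intro sum.cong refl)
    fix a b c d assume K: "a \<in> K" "b \<in> K" "c \<in> K" "d \<in> K"
    let ?v = "z c * w d"
    have v: "?v \<in> D" using z w K by auto
    have "E a * E b * ?v = E a * (?v * E b)" by (simp only: mult.assoc E_comm[OF K(2) v])
    also have "\<dots> = (E a * ?v) * E b" by (simp only: mult.assoc)
    also have "\<dots> = ?v * (E a * E b)" by (simp only: mult.assoc E_comm[OF K(1) v])
    finally have comm: "E a * E b * ?v = ?v * (E a * E b)" .
    have "\<alpha> * ((x a * y b * (E a * E b)) * (?v * (E c * E d)))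
      = \<alpha> * (x a * y b * ((E a * E b * ?v) * (E c * E d)))"
      by (simp only: mult.assoc)
    also have "\<dots> = (\<alpha> * (x a * y b * ?v)) * (E a * E b * E c * E d)"
      unfolding comm by (simp only: mult.assoc)
    finally have "\<alpha> * ((x a * y b * (E a * E b)) * (?v * (E c * E d)))
      = (\<alpha> * (x a * y b * ?v)) * (E a * E b * E c * E d)" .
    moreover have "\<alpha> * (x a * y b * ?v) \<in> D" using \<alpha> x[OF K(1)] y[OF K(2)] v by blast
    ultimately have word: "trc (\<alpha> * ((x a * y b * (E a * E b)) * (?v * (E c * E d)))) =
      (if a = b \<and> c = d then ?t a b c d else if a = d \<and> b = c then ?t a b c d
       else if a = c \<and> b = d then s a b * ?t a b c d else 0)"
      by (simp only: trc_word[OF K])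
    show "trc (\<alpha> * ((x a * y b * (E a * E b)) * (?v * (E c * E d)))) =
      (if c = d then (if a = b then ?t a b c d else 0) else 0)
      + (if d = a then (if c = b then (if a = b then 0 else ?t a b c d) else 0) else 0)
      + (if d = b then (if c = a then (if a = b then 0 else s a b * ?t a b c d) else 0) else 0)"
      unfolding word by (rule split)
  qed
  also have "\<dots> = (\<Sum>a\<in>K. \<Sum>b\<in>K. \<Sum>c\<in>K. if a = b then ?t a b c c else 0)
    + (\<Sum>a\<in>K. \<Sum>b\<in>K. if a = b then 0 else ?t a b b a)
    + (\<Sum>a\<in>K. \<Sum>b\<in>K. if a = b then 0 else s a b * ?t a b a b)"
    using fin by (simp add: sum.distrib sum.delta' sum.delta)
  also have "(\<Sum>a\<in>K. \<Sum>b\<in>K. \<Sum>c\<in>K. if a = b then ?t a b c c else 0) = (\<Sum>a\<in>K. \<Sum>c\<in>K. ?t a a c c)"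
  proof (rule sum.cong[OF refl])
    fix a assume "a \<in> K"
    have "(\<Sum>b\<in>K. \<Sum>c\<in>K. if a = b then ?t a b c c else 0) = (\<Sum>b\<in>K. if a = b then \<Sum>c\<in>K. ?t a b c c else 0)"
      by (intro sum.cong) auto
    then show "(\<Sum>b\<in>K. \<Sum>c\<in>K. if a = b then ?t a b c c else 0) = (\<Sum>c\<in>K. ?t a a c c)"
      using fin \<open>a \<in> K\<close> by (simp add: sum.delta)
  qed
  finally show ?thesis .
qed

text \<open>Each pairing contributes at most \<open>\<mu>\<^sup>2 * trc \<alpha>\<close>, which is
  the origin of the factor 3. Adjacent pairs form \<open>p * p\<close>, bounded by the column
  condition. Nested pairs form \<open>\<Sum>adj (x a) * q * x a\<close>, bounded by the row
  condition and then the column condition. Crossing pairs are dominated by nested ones, whatever the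
  signs \<open>s a b\<close>.\<close>

lemma fourth_moment_le:
  assumes x: "\<And>k. k \<in> K \<Longrightarrow> x k \<in> D" and \<alpha>: "\<alpha> \<in> D" "psd \<alpha>" and \<mu>: "0 < \<mu>"
    and col: "psd (\<mu> *\<^sub>R e - (\<Sum>k\<in>K. adj (x k) * x k))"
    and row: "psd (\<mu> *\<^sub>R e - (\<Sum>k\<in>K. x k * adj (x k)))"
  shows "trc (\<alpha> * (adj (embed x) * embed x * (adj (embed x) * embed x))) \<le> 3 * \<mu>\<^sup>2 * trc \<alpha>"
proof -
  define p where "p = (\<Sum>k\<in>K. adj (x k) * x k)"
  define q where "q = (\<Sum>k\<in>K. x k * adj (x k))"
  have D: "p \<in> D" "q \<in> D" using x by (auto simp: p_def q_def)
  have ps: "psd p" "psd q" unfolding p_def q_def by (auto intro!: psd_sum psd_square psd_square')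
  have sp: "adj p = p" using ps by (simp add: psd_adj)
  have ax: "adj (x k) \<in> D" if "k \<in> K" for k using x that by auto
  note [simp] = p_def[symmetric] q_def[symmetric]
  have pa: "trc (\<alpha> * p) \<le> \<mu> * trc \<alpha>"
    using D.trc_psd_mult_mono[OF \<alpha> col] \<alpha> by (simp add: trc_scaleR)
  have first: "trc (\<alpha> * (p * p)) \<le> \<mu>\<^sup>2 * trc \<alpha>"
  proof -
    let ?r = "\<mu> *\<^sub>R e - p"
    \<comment> \<open>As \<open>r = \<mu> e - p\<close> commutes with \<open>p\<close>,
      \<open>p r p + r p r = p r (p + r) = \<mu> p r\<close>. Congruences alone thus give
      \<open>p * p \<le> \<mu> p\<close>.\<close>
    have "psd ((1/\<mu>) *\<^sub>R (adj p * ?r * p + adj ?r * p * ?r))"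
      using \<mu> col ps by (intro psd_scaleR psd_add psd_congr) auto
    also have "(1/\<mu>) *\<^sub>R (adj p * ?r * p + adj ?r * p * ?r) = \<mu> *\<^sub>R p - p * p"
      using \<mu> D by (simp add: adj_simps sp algebra_simps)
    finally have "trc (\<alpha> * (p * p)) \<le> \<mu> * trc (\<alpha> * p)"
      using D.trc_psd_mult_mono[OF \<alpha>] by (fastforce simp: trc_scaleR)
    also have "\<dots> \<le> \<mu> * (\<mu> * trc \<alpha>)" using pa \<mu> by (intro mult_left_mono) auto
    finally show ?thesis by (simp add: power2_eq_square mult.assoc)
  qed
  let ?m = "\<lambda>a b. trc (\<alpha> * (adj (x a) * x b * (adj (x b) * x a)))"
  let ?n = "\<lambda>a b. trc (\<alpha> * (adj (x a) * x b * (adj (x a) * x b)))"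
  have m0: "0 \<le> ?m a b" for a b
  proof -
    have "adj (x a) * x b * (adj (x b) * x a) = (adj (x a) * x b) * adj (adj (x a) * x b)"
      by (simp add: adj_mult)
    then show ?thesis using D.trc_psd_mult_nonneg[OF \<alpha> psd_square'] by simp
  qed
  have second: "(\<Sum>a\<in>K. \<Sum>b\<in>K. ?m a b) \<le> \<mu>\<^sup>2 * trc \<alpha>"
  proof -
    have "(\<Sum>a\<in>K. \<Sum>b\<in>K. ?m a b) = (\<Sum>a\<in>K. trc (\<alpha> * (adj (x a) * q * x a)))"
      by (simp add: q_def sum_distrib_left sum_distrib_right trc_sum mult.assoc del: q_def[symmetric])
    also have "\<dots> \<le> (\<Sum>a\<in>K. trc (\<alpha> * (\<mu> *\<^sub>R (adj (x a) * x a))))"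
    proof (intro sum_mono D.trc_psd_mult_mono \<alpha>)
      fix a assume a: "a \<in> K"
      have "psd (adj (x a) * (\<mu> *\<^sub>R e - q) * x a)" using row by (intro psd_congr) simp
      then show "psd (\<mu> *\<^sub>R (adj (x a) * x a) - adj (x a) * q * x a)"
        using x[OF a] ax[OF a] by (simp add: algebra_simps)
    qed
    also have "\<dots> = \<mu> * trc (\<alpha> * p)"
      by (simp add: p_def sum_distrib_left trc_sum trc_scaleR del: p_def[symmetric])
    also have "\<dots> \<le> \<mu> * (\<mu> * trc \<alpha>)" using pa \<mu> by (intro mult_left_mono) auto
    finally show ?thesis by (simp add: power2_eq_square mult.assoc)
  qed
  have third: "s a b * ?n a b + s b a * ?n b a \<le> ?m a b + ?m b a" if "a \<in> K" "b \<in> K" for a b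
  proof -
    \<comment> \<open>The nested term is the trace of \<open>u * adj u\<close> and the crossing term
      that of \<open>u * u\<close>, both against \<open>\<alpha>\<close>. The square of
      \<open>u - \<sigma> adj u\<close> compares them once the terms with \<open>a\<close> and
      \<open>b\<close> exchanged are added.\<close>
    let ?u = "adj (x a) * x b"
    define \<sigma> where "\<sigma> = s a b"
    have \<sigma>: "\<sigma> = 1 \<or> \<sigma> = -1" using s_cases by (simp add: \<sigma>_def)
    let ?v = "?u - \<sigma> *\<^sub>R adj ?u"
    have "0 \<le> trc (\<alpha> * (adj ?v * ?v))"
      by (intro D.trc_psd_mult_nonneg \<alpha> psd_square)
    also have "trc (\<alpha> * (adj ?v * ?v)) = ?m a b + ?m b a - \<sigma> * ?n a b - \<sigma> * ?n b a"
      using \<sigma> by (auto simp: adj_simps algebra_simps trc_simps)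
    finally show ?thesis using s_sym[of b a] by (simp add: \<sigma>_def)
  qed
  have third': "(\<Sum>a\<in>K. \<Sum>b\<in>K. if a = b then 0 else s a b * ?n a b) \<le> (\<Sum>a\<in>K. \<Sum>b\<in>K. ?m a b)"
  proof -
    let ?f = "\<lambda>a b. if a = b then 0 else s a b * ?n a b"
    have "2 * (\<Sum>a\<in>K. \<Sum>b\<in>K. ?f a b) = (\<Sum>a\<in>K. \<Sum>b\<in>K. ?f a b) + (\<Sum>a\<in>K. \<Sum>b\<in>K. ?f b a)"
      using sum.swap[of ?f K K] by simp
    also have "\<dots> = (\<Sum>a\<in>K. \<Sum>b\<in>K. ?f a b + ?f b a)"
      by (simp add: sum.distrib)
    also have "\<dots> \<le> (\<Sum>a\<in>K. \<Sum>b\<in>K. ?m a b + ?m b a)"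
      using third m0 by (intro sum_mono) auto
    also have "\<dots> = (\<Sum>a\<in>K. \<Sum>b\<in>K. ?m a b) + (\<Sum>a\<in>K. \<Sum>b\<in>K. ?m b a)"
      by (simp add: sum.distrib)
    also have "\<dots> = 2 * (\<Sum>a\<in>K. \<Sum>b\<in>K. ?m a b)"
      using sum.swap[of ?m K K] by simp
    finally show ?thesis by simp
  qed
  have second': "(\<Sum>a\<in>K. \<Sum>b\<in>K. if a = b then 0 else ?m a b) \<le> (\<Sum>a\<in>K. \<Sum>b\<in>K. ?m a b)"
    using m0 by (intro sum_mono) auto
  have "trc (\<alpha> * (adj (embed x) * embed x * (adj (embed x) * embed x))) =
    (\<Sum>a\<in>K. \<Sum>c\<in>K. trc (\<alpha> * (adj (x a) * x a * (adj (x c) * x c))))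
    + (\<Sum>a\<in>K. \<Sum>b\<in>K. if a = b then 0 else ?m a b)
    + (\<Sum>a\<in>K. \<Sum>b\<in>K. if a = b then 0 else s a b * ?n a b)"
    by (subst (1 2) adj_embed[where x=x, OF x], assumption)
      (rule trc_embed4[where x="\<lambda>k. adj (x k)" and y=x and z="\<lambda>k. adj (x k)" and w=x, OF ax x ax x \<alpha>(1)])
  also have "(\<Sum>a\<in>K. \<Sum>c\<in>K. trc (\<alpha> * (adj (x a) * x a * (adj (x c) * x c)))) = trc (\<alpha> * (p * p))"
    unfolding p_def sum_product by (simp only: sum_distrib_left trc_sum)
  finally show ?thesis using first second second' third' by linarith
qed

text \<open>The pairing of \<open>c\<close> with \<open>x k = X k * \<alpha>'\<close> is computed in
  \<open>D\<close> and estimated in \<open>B\<close>. With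
  \<open>F = trc \<alpha> + trc \<beta>\<close> it is at least
  \<open>(1 - t) * F - 2 * t * trc e\<close> and at most
  \<open>sqrt 3 / 2 * trc \<sigma> + (1 + (1 + t)^4) / 4 * F\<close>. At \<open>t = 0\<close> the
  coefficients of \<open>F\<close> differ by \<open>1/2\<close>.\<close>

lemma decomposition_estimate:
  assumes c: "\<And>k. k \<in> K \<Longrightarrow> c k \<in> D"
    and \<sigma>: "\<sigma> \<in> B" "psd \<sigma>" "\<sigma> * \<sigma> = adj (embed c) * embed c"
    and t: "0 < t" and \<omega>: "0 \<le> 1 - t - (1 + (1 + t)^4) / 4"
  obtains X Y g h where
    "\<And>k. k \<in> K \<Longrightarrow> X k \<in> D" "\<And>k. k \<in> K \<Longrightarrow> Y k \<in> D" "\<And>k. c k = X k + Y k"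
    "g \<in> D" "psd g" "g * g = (\<Sum>k\<in>K. adj (X k) * X k)"
    "h \<in> D" "psd h" "h * h = (\<Sum>k\<in>K. Y k * adj (Y k))"
    "(1 - t - (1 + (1 + t)^4) / 4) * (trc g + trc h) \<le> sqrt 3 / 2 * trc \<sigma> + 2 * t * trc e"
proof -
  \<comment> \<open>One parameter governs all errors: \<open>sqrt \<epsilon> = t\<close>, and the
    optimality defect is also \<open>t\<^sup>2\<close>.\<close>
  define \<epsilon> where "\<epsilon> = t\<^sup>2"
  have \<epsilon>: "0 < \<epsilon>" "sqrt \<epsilon> = t" using t by (auto simp: \<epsilon>_def)
  obtain X Y \<alpha> \<alpha>' \<beta> \<beta>' where X: "\<And>k. k \<in> K \<Longrightarrow> X k \<in> D" and Y: "\<And>k. k \<in> K \<Longrightarrow> Y k \<in> D"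
    and cXY: "\<And>k. c k = X k + Y k"
    and R1: "D.reg_root \<epsilon> (\<Sum>k\<in>K. adj (X k) * X k) \<alpha> \<alpha>'"
    and R2: "D.reg_root \<epsilon> (\<Sum>k\<in>K. Y k * adj (Y k)) \<beta> \<beta>'"
    and err: "(\<Sum>k\<in>K. trc (adj (X k * \<alpha>' - \<beta>' * Y k) * (X k * \<alpha>' - \<beta>' * Y k))) \<le> t\<^sup>2"
    by (rule D.near_optimal_decomposition[where c = c and K = K, OF c \<epsilon>(1) zero_less_power[OF t, of 2]], assumption, rule that)
  define p where "p = (\<Sum>k\<in>K. adj (X k) * X k)"
  define q where "q = (\<Sum>k\<in>K. Y k * adj (Y k))"
  have p: "p \<in> D" "psd p" using X by (auto simp: p_def intro!: psd_sum psd_square)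
  have q: "q \<in> D" "psd q" using Y by (auto simp: q_def intro!: psd_sum psd_square')
  note R1 = R1[folded p_def] and R2 = R2[folded q_def]
  have \<alpha>: "\<alpha> \<in> D" "psd \<alpha>" "\<alpha>' \<in> D" "psd \<alpha>'" "\<alpha> * \<alpha>' = e" "\<alpha>' * \<alpha> = e"
    using R1 by (auto simp: D.reg_root_def)
  have \<beta>: "\<beta> \<in> D" "psd \<beta>" "\<beta>' \<in> D" "psd \<beta>'" "\<beta> * \<beta>' = e" "\<beta>' * \<beta> = e"
    using R2 by (auto simp: D.reg_root_def)
  have sa: "adj \<alpha>' = \<alpha>'" "adj \<beta>' = \<beta>'" using \<alpha> \<beta> by (auto simp: psd_adj)
  \<comment> \<open>At an exact minimiser \<open>x\<close> and \<open>u\<close> would coincide and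
    be the dual optimiser. Here \<open>x\<close> is a column contraction, \<open>u\<close> is a row
    contraction, and \<open>r\<close> measures how far they are from being one family.\<close>
  define x where "x = (\<lambda>k. X k * \<alpha>')"
  define u where "u = (\<lambda>k. \<beta>' * Y k)"
  define r where "r = (\<lambda>k. x k - u k)"
  have xD: "x k \<in> D" and uD: "u k \<in> D" and rD: "r k \<in> D" and axD: "adj (x k) \<in> D" if "k \<in> K" for k
    using X[OF that] Y[OF that] \<alpha> \<beta> by (auto simp: x_def u_def r_def)
  have err: "(\<Sum>k\<in>K. trc (adj (r k) * r k)) \<le> t\<^sup>2"
    using err by (simp add: r_def x_def u_def)
  \<comment> \<open>The row bound for a contraction perturbed by an error of norm
    \<open>t\<close>.\<close>
  define \<mu> where "\<mu> = (1 + t)\<^sup>2"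
  have \<mu>: "0 < \<mu>" "1 \<le> \<mu>" using t by (auto simp: \<mu>_def one_le_power)
  have sq: "psd (\<alpha>' * \<alpha>')" "psd (\<beta>' * \<beta>')"
    using psd_square[of \<alpha>'] psd_square[of \<beta>'] sa by auto
  have colx: "(\<Sum>k\<in>K. adj (x k) * x k) = e - \<epsilon> *\<^sub>R (\<alpha>' * \<alpha>')"
    using D.reg_root_sandwich[OF R1]
    by (simp add: x_def p_def adj_mult sa sum_distrib_left sum_distrib_right mult.assoc)
  have rowu: "(\<Sum>k\<in>K. u k * adj (u k)) = e - \<epsilon> *\<^sub>R (\<beta>' * \<beta>')"
    using D.reg_root_sandwich[OF R2]
    by (simp add: u_def q_def adj_mult sa sum_distrib_left sum_distrib_right mult.assoc)
  have col: "psd (\<mu> *\<^sub>R e - (\<Sum>k\<in>K. adj (x k) * x k))"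
  proof -
    have "psd ((\<mu> - 1) *\<^sub>R e + \<epsilon> *\<^sub>R (\<alpha>' * \<alpha>'))"
      using \<mu> \<epsilon> sq D.psd_e by (intro psd_add psd_scaleR) auto
    then show ?thesis by (simp add: colx algebra_simps)
  qed
  have small: "psd (t\<^sup>2 *\<^sub>R e - (\<Sum>k\<in>K. r k * adj (r k)))"
  proof -
    have "psd ((t\<^sup>2 - (\<Sum>k\<in>K. trc (adj (r k) * r k))) *\<^sub>R e
        + (\<Sum>k\<in>K. trc (adj (r k) * r k) *\<^sub>R e - r k * adj (r k)))"
      using err by (intro psd_add psd_scaleR psd_sum D.psd_e D.square_adj_le_trc rD) auto
    then show ?thesis by (simp add: sum_subtractf scaleR_left_diff_distrib scaleR_sum_left algebra_simps)
  qed
  have row: "psd (\<mu> *\<^sub>R e - (\<Sum>k\<in>K. x k * adj (x k)))"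
  proof -
    \<comment> \<open>Positivity of \<open>w * adj w\<close> absorbs the cross terms of
      \<open>x = u + r\<close>, giving weights \<open>1 + t\<close> on \<open>u\<close> and
      \<open>1 + 1/t\<close> on \<open>r\<close>. They add up to
      \<open>(1 + t) + (1 + 1/t) t^2 = (1 + t)^2\<close>.\<close>
    let ?w = "\<lambda>k. sqrt t *\<^sub>R u k - (1 / sqrt t) *\<^sub>R r k"
    have tt: "sqrt t * sqrt t = t" "(1 / sqrt t) * (1 / sqrt t) = 1 / t" "sqrt t * (1 / sqrt t) = 1"
      using t by (auto simp: field_simps)
    have w: "?w k * adj (?w k) = t *\<^sub>R (u k * adj (u k)) + (1 / t) *\<^sub>R (r k * adj (r k))
        - u k * adj (r k) - r k * adj (u k)" for k
      using tt by (simp add: adj_simps algebra_simps)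
    have xx: "x k * adj (x k) = u k * adj (u k) + r k * adj (r k) + u k * adj (r k) + r k * adj (u k)" for k
    proof -
      have "x k = u k + r k" by (simp add: r_def)
      then show ?thesis by (simp add: adj_add ring_distribs)
    qed
    have "x k * adj (x k) + ?w k * adj (?w k) = (1 + t) *\<^sub>R (u k * adj (u k)) + (1 + 1/t) *\<^sub>R (r k * adj (r k))" for k
      unfolding w xx by (simp add: scaleR_left_distrib)
    then have sum: "(\<Sum>k\<in>K. x k * adj (x k)) + (\<Sum>k\<in>K. ?w k * adj (?w k))
      = (1 + t) *\<^sub>R (\<Sum>k\<in>K. u k * adj (u k)) + (1 + 1/t) *\<^sub>R (\<Sum>k\<in>K. r k * adj (r k))"
      by (simp add: scaleR_sum_right flip: sum.distrib)
    have "psd ((\<Sum>k\<in>K. ?w k * adj (?w k)) + ((1 + t) * \<epsilon>) *\<^sub>R (\<beta>' * \<beta>')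
        + (1 + 1/t) *\<^sub>R (t\<^sup>2 *\<^sub>R e - (\<Sum>k\<in>K. r k * adj (r k))))"
      using t \<epsilon> sq small by (intro psd_add psd_scaleR psd_sum psd_square') auto
    also have "(\<Sum>k\<in>K. ?w k * adj (?w k)) + ((1 + t) * \<epsilon>) *\<^sub>R (\<beta>' * \<beta>')
        + (1 + 1/t) *\<^sub>R (t\<^sup>2 *\<^sub>R e - (\<Sum>k\<in>K. r k * adj (r k)))
      = (1 + t) *\<^sub>R e + ((1 + 1/t) * t\<^sup>2) *\<^sub>R e - (\<Sum>k\<in>K. x k * adj (x k))"
    proof -
      have "(\<Sum>k\<in>K. ?w k * adj (?w k)) = (1 + t) *\<^sub>R (e - \<epsilon> *\<^sub>R (\<beta>' * \<beta>'))
          + (1 + 1/t) *\<^sub>R (\<Sum>k\<in>K. r k * adj (r k)) - (\<Sum>k\<in>K. x k * adj (x k))"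
        using sum unfolding rowu by (simp only: eq_diff_eq add.commute)
      then show ?thesis by (simp only: scaleR_right_diff_distrib scaleR_scaleR) simp
    qed
    also have "(1 + t) *\<^sub>R e + ((1 + 1/t) * t\<^sup>2) *\<^sub>R e = \<mu> *\<^sub>R e"
    proof -
      have "(1 + t) + (1 + 1/t) * t\<^sup>2 = \<mu>" using t by (simp add: \<mu>_def power2_eq_square field_simps)
      then show ?thesis by (metis scaleR_left_distrib)
    qed
    finally show ?thesis .
  qed
  define xb where "xb = embed x"
  have xb: "xb \<in> B" "adj xb = embed (\<lambda>k. adj (x k))"
    using embed_in[of x] adj_embed[of x] xD by (auto simp: xb_def)
  obtain Z where Z: "Z \<in> B" "psd ((3/4) *\<^sub>R e - adj Z * Z)"
    "psd ((1/12) *\<^sub>R (adj xb * xb * adj xb * xb) - adj (xb - Z) * (xb - Z))"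
    "psd ((1/12) *\<^sub>R (xb * adj xb * xb * adj xb) - (xb - Z) * adj (xb - Z))"
    using B.truncation[OF xb(1)] by blast
  define W where "W = xb - Z"
  have WB: "W \<in> B" "adj W \<in> B" using xb Z by (auto simp: W_def)
  \<comment> \<open>The fourth moment bound \<open>3 * \<mu>\<^sup>2\<close> meets the factor
    \<open>1/12\<close> of the truncation.\<close>
  have F1: "trc (\<alpha> * (adj W * W)) \<le> \<mu>\<^sup>2 / 4 * trc \<alpha>"
  proof -
    have "trc (\<alpha> * (adj W * W)) \<le> trc (\<alpha> * ((1/12) *\<^sub>R (adj xb * xb * adj xb * xb)))"
      unfolding W_def using \<alpha> Z by (intro B.trc_psd_mult_mono) auto
    also have "\<dots> \<le> \<mu>\<^sup>2 / 4 * trc \<alpha>"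
      using fourth_moment_le[where x = x, OF xD \<alpha>(1,2) \<mu>(1) col row]
      by (simp add: trc_scaleR mult.assoc xb_def)
    finally show ?thesis .
  qed
  \<comment> \<open>For the row weight the fourth moment is taken of the adjoint family, for which
    the column and row conditions change places.\<close>
  have F2: "trc (\<beta> * (W * adj W)) \<le> \<mu>\<^sup>2 / 4 * trc \<beta>"
  proof -
    have "trc (\<beta> * (W * adj W)) \<le> trc (\<beta> * ((1/12) *\<^sub>R (xb * adj xb * xb * adj xb)))"
      unfolding W_def using \<beta> Z by (intro B.trc_psd_mult_mono) auto
    also have "\<dots> \<le> \<mu>\<^sup>2 / 4 * trc \<beta>"
      using fourth_moment_le[where x = "\<lambda>k. adj (x k)", OF axD \<beta>(1,2) \<mu>(1)] col row
      by (simp add: trc_scaleR mult.assoc flip: xb(2))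
    finally show ?thesis .
  qed
  have pair: "(\<Sum>k\<in>K. trc (c k * adj (x k))) = trc (embed c * adj xb)"
  proof -
    have "trc (e * (embed c * adj xb)) = (\<Sum>k\<in>K. trc (e * (c k * adj (x k))))"
      unfolding xb(2) by (rule trc_embed2) (auto simp: c axD)
    also have "\<dots> = (\<Sum>k\<in>K. trc (c k * adj (x k)))"
      using c by (intro sum.cong refl) (simp add: D.e_left_assoc)
    finally show ?thesis using embed_in[of c] c by (simp add: B.e_left_assoc)
  qed
  have cB: "embed c \<in> B" "embed X \<in> B" "embed Y \<in> B" using c X Y by (auto intro: embed_in)
  have split: "embed c = embed X + embed Y"
    by (simp add: embed_def cXY ring_distribs sum.distrib)
  \<comment> \<open>Trace duality in \<open>B\<close> for a family with one member;
    \<open>\<sigma>\<close> is the absolute value of \<open>embed c\<close>.\<close>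
  have G1: "trc (embed c * adj Z) \<le> sqrt 3 / 2 * trc \<sigma>"
    using B.trace_duality[where g = \<sigma> and K = "{()}" and X = "\<lambda>_. embed c" and y = "\<lambda>_. Z" and C = "sqrt 3 / 2"] \<sigma> cB Z
    by (simp add: power_divide)
  have trP: "trc (\<alpha>' * p) \<le> trc \<alpha>" "trc (\<beta>' * q) \<le> trc \<beta>"
    using D.reg_root_trc[OF R1] D.reg_root_trc[OF R2] \<epsilon> D.trc_psd_nonneg[OF \<alpha>(3,4)]
      D.trc_psd_nonneg[OF \<beta>(3,4)] by auto
  \<comment> \<open>The remainder is paired with \<open>X\<close> under the weight
    \<open>\<alpha>\<close> and with \<open>Y\<close> under \<open>\<beta>\<close>. The choice
    \<open>C = 1/2\<close> in \<open>am_gm\<close> makes the two resulting coefficients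
    \<open>1/4\<close> and \<open>\<mu>\<^sup>2 / 4\<close>, which are equal in the limit.\<close>
  have G2: "trc (embed X * adj W) \<le> (1 + \<mu>\<^sup>2) / 4 * trc \<alpha>"
  proof -
    have "trc (embed X * adj W) \<le> 1/4 * trc (\<alpha>' * (adj (embed X) * embed X)) + trc (\<alpha> * (adj W * W))"
      using B.am_gm[of \<alpha> \<alpha>' "embed X" W "1/2"] \<alpha> WB cB by simp
    also have "trc (\<alpha>' * (adj (embed X) * embed X)) = trc (\<alpha>' * p)"
      by (subst adj_embed, erule X, subst trc_embed2) (auto simp: X \<alpha> p_def sum_distrib_left trc_sum D.adj_in)
    also have "1/4 * trc (\<alpha>' * p) + trc (\<alpha> * (adj W * W)) \<le> 1/4 * trc \<alpha> + \<mu>\<^sup>2 / 4 * trc \<alpha>"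
      using trP F1 by (intro add_mono mult_left_mono) auto
    finally show ?thesis by (simp add: algebra_simps add_divide_distrib)
  qed
  have G3: "trc (embed Y * adj W) \<le> (1 + \<mu>\<^sup>2) / 4 * trc \<beta>"
  proof -
    have "trc (adj (embed Y) * W) \<le> 1/4 * trc (\<beta>' * (embed Y * adj (embed Y))) + trc (\<beta> * (W * adj W))"
      using B.am_gm[of \<beta> \<beta>' "adj (embed Y)" "adj W" "1/2"] \<beta> WB cB by (simp add: B.adj_in)
    also have "trc (\<beta>' * (embed Y * adj (embed Y))) = trc (\<beta>' * q)"
      by (subst adj_embed, erule Y, subst trc_embed2) (auto simp: Y \<beta> q_def sum_distrib_left trc_sum D.adj_in)
    also have "1/4 * trc (\<beta>' * q) + trc (\<beta> * (W * adj W)) \<le> 1/4 * trc \<beta> + \<mu>\<^sup>2 / 4 * trc \<beta>"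
      using trP F2 by (intro add_mono mult_left_mono) auto
    finally show ?thesis by (simp add: D.trc_adj_swap algebra_simps add_divide_distrib)
  qed
  have upper: "(\<Sum>k\<in>K. trc (c k * adj (x k))) \<le> sqrt 3 / 2 * trc \<sigma> + (1 + \<mu>\<^sup>2) / 4 * (trc \<alpha> + trc \<beta>)"
  proof -
    have "adj xb = adj Z + adj W" by (simp add: W_def adj_diff)
    then have "trc (embed c * adj xb) = trc (embed c * adj Z) + trc (embed c * adj W)"
      by (simp add: ring_distribs trc_add)
    also have "trc (embed c * adj W) = trc (embed X * adj W) + trc (embed Y * adj W)"
      by (simp add: split ring_distribs trc_add)
    finally show ?thesis using G1 G2 G3 pair by (simp only: distrib_left)
  qed
  have L1: "(\<Sum>k\<in>K. trc (X k * adj (x k))) = trc (\<alpha>' * p)"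
  proof -
    have "trc (X k * adj (x k)) = trc (\<alpha>' * (adj (X k) * X k))" for k
      using trc_comm[of "X k" "\<alpha>' * adj (X k)"] by (simp add: x_def adj_mult sa mult.assoc)
    then show ?thesis by (simp add: p_def sum_distrib_left trc_sum)
  qed
  have L2: "(\<Sum>k\<in>K. trc (Y k * adj (u k))) = trc (\<beta>' * q)"
  proof -
    have "trc (Y k * adj (u k)) = trc (\<beta>' * (Y k * adj (Y k)))" for k
      using trc_comm[of "Y k * adj (Y k)" \<beta>'] by (simp add: u_def adj_mult sa mult.assoc)
    then show ?thesis by (simp add: q_def sum_distrib_left trc_sum)
  qed
  \<comment> \<open>With \<open>C = t\<close> in \<open>am_gm\<close>, the bound
    \<open>t\<^sup>2\<close> on the row sum of \<open>r\<close> turns both terms into at most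
    \<open>t / 2 * trc \<beta>\<close>.\<close>
  have L3: "- (\<Sum>k\<in>K. trc (Y k * adj (r k))) \<le> t * trc \<beta>"
  proof -
    have "- trc (Y k * adj (r k)) \<le> t / 2 * trc (\<beta>' * (Y k * adj (Y k))) + trc (\<beta> * (r k * adj (r k))) / (2 * t)"
      if "k \<in> K" for k
    proof -
      have "- trc (Y k * adj (r k)) = trc (adj (Y k) * adj (- adj (r k)))"
        by (simp add: adj_minus trc_minus D.trc_adj_swap)
      also have "\<dots> \<le> t / 2 * trc (\<beta>' * (adj (adj (Y k)) * adj (Y k)))
          + trc (\<beta> * (adj (- adj (r k)) * (- adj (r k)))) / (2 * t)"
        using \<beta> Y[OF that] rD[OF that] t by (intro D.am_gm) auto
      finally show ?thesis by (simp add: adj_minus)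
    qed
    then have "- (\<Sum>k\<in>K. trc (Y k * adj (r k))) \<le>
      (\<Sum>k\<in>K. t / 2 * trc (\<beta>' * (Y k * adj (Y k))) + trc (\<beta> * (r k * adj (r k))) / (2 * t))"
      unfolding sum_negf[symmetric] by (rule sum_mono)
    also have "\<dots> = t / 2 * trc (\<beta>' * q) + trc (\<beta> * (\<Sum>k\<in>K. r k * adj (r k))) / (2 * t)"
      by (simp add: q_def sum.distrib sum_distrib_left trc_sum sum_divide_distrib)
    also have "\<dots> \<le> t / 2 * trc \<beta> + trc (\<beta> * (t\<^sup>2 *\<^sub>R e)) / (2 * t)"
      using t trP \<beta> small by (intro add_mono mult_left_mono divide_right_mono D.trc_psd_mult_mono) auto
    also have "\<dots> = t * trc \<beta>"
      using t \<beta> by (simp add: trc_scaleR power2_eq_square)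
    finally show ?thesis .
  qed
  have L4: "\<epsilon> * trc \<alpha>' \<le> t * trc e" "\<epsilon> * trc \<beta>' \<le> t * trc e"
  proof -
    have "0 \<le> trc ((1/t) *\<^sub>R e - \<alpha>')" "0 \<le> trc ((1/t) *\<^sub>R e - \<beta>')"
      using D.reg_root_inverse_le[OF R1 p(2) \<epsilon>(1)] D.reg_root_inverse_le[OF R2 q(2) \<epsilon>(1)] \<epsilon>(2) \<alpha> \<beta>
      by (auto intro!: D.trc_psd_nonneg)
    then show "\<epsilon> * trc \<alpha>' \<le> t * trc e" "\<epsilon> * trc \<beta>' \<le> t * trc e"
      using t by (simp_all add: trc_simps \<epsilon>_def power2_eq_square field_simps)
  qed
  have lower: "(1 - t) * (trc \<alpha> + trc \<beta>) - 2 * t * trc e \<le> (\<Sum>k\<in>K. trc (c k * adj (x k)))"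
  proof -
    have "trc (c k * adj (x k)) = trc (X k * adj (x k)) + trc (Y k * adj (u k)) + trc (Y k * adj (r k))" for k
      by (simp add: cXY r_def adj_simps ring_distribs trc_simps right_diff_distrib)
    then have "(\<Sum>k\<in>K. trc (c k * adj (x k))) = trc (\<alpha>' * p) + trc (\<beta>' * q) + (\<Sum>k\<in>K. trc (Y k * adj (r k)))"
      by (simp add: sum.distrib L1 L2)
    moreover have "0 \<le> t * trc \<alpha>" using t D.trc_psd_nonneg[OF \<alpha>(1,2)] by simp
    ultimately show ?thesis
      using L3 L4 D.reg_root_trc[OF R1] D.reg_root_trc[OF R2] by (simp add: algebra_simps)
  qed
  have key: "(1 - t - (1 + (1 + t)^4) / 4) * (trc \<alpha> + trc \<beta>) \<le> sqrt 3 / 2 * trc \<sigma> + 2 * t * trc e"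
  proof -
    have "\<mu>\<^sup>2 = (1 + t)^4" by (simp add: \<mu>_def flip: power_mult)
    then show ?thesis using upper lower by (simp only: left_diff_distrib)
  qed
  obtain g where g: "g \<in> D" "psd g" "g * g = p" using D.sqrt_ex[OF p] by blast
  obtain h where h: "h \<in> D" "psd h" "h * h = q" using D.sqrt_ex[OF q] by blast
  \<comment> \<open>By the tangent bound the true roots have no larger trace than the regularised
    ones.\<close>
  have "trc g + trc h \<le> trc \<alpha> + trc \<beta>"
    using D.reg_root_trc_le[OF R1 g(1,2)] D.reg_root_trc_le[OF R2 h(1,2)] trP g h by simp
  then have "(1 - t - (1 + (1 + t)^4) / 4) * (trc g + trc h) \<le> sqrt 3 / 2 * trc \<sigma> + 2 * t * trc e"
    using key \<omega> mult_left_mono order.trans by blast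
  from that[OF X Y cXY g[unfolded p_def] h[unfolded q_def] this] show thesis .
qed

text \<open>As \<open>t\<close> tends to 0 the factor on the left of
  \<open>decomposition_estimate\<close> tends to \<open>1/2\<close>, so after division the right
  side tends to \<open>sqrt 3 * trc \<sigma>\<close>; a small \<open>t\<close> brings it within
  \<open>\<zeta>\<close>.\<close>

lemma khintchine_upper:
  assumes c: "\<And>k. k \<in> K \<Longrightarrow> c k \<in> D"
    and \<sigma>: "\<sigma> \<in> B" "psd \<sigma>" "\<sigma> * \<sigma> = adj (embed c) * embed c"
    and \<zeta>: "0 < \<zeta>"
  obtains X Y g h where
    "\<And>k. k \<in> K \<Longrightarrow> X k \<in> D" "\<And>k. k \<in> K \<Longrightarrow> Y k \<in> D" "\<And>k. c k = X k + Y k"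
    "g \<in> D" "psd g" "g * g = (\<Sum>k\<in>K. adj (X k) * X k)"
    "h \<in> D" "psd h" "h * h = (\<Sum>k\<in>K. Y k * adj (Y k))"
    "trc g + trc h \<le> sqrt 3 * trc \<sigma> + \<zeta>"
proof -
  let ?\<omega> = "\<lambda>t. 1 - t - (1 + (1 + t)^4) / 4 :: real"
  let ?f = "\<lambda>t. (sqrt 3 / 2 * trc \<sigma> + 2 * t * trc e) / ?\<omega> t"
  have w: "(?\<omega> \<longlongrightarrow> ?\<omega> 0) (at_right 0)"
    by (rule tendsto_eq_intros refl | simp)+
  have f: "(?f \<longlongrightarrow> ?f 0) (at_right 0)"
  proof (rule tendsto_divide[OF _ w])
    show "((\<lambda>t. sqrt 3 / 2 * trc \<sigma> + 2 * t * trc e) \<longlongrightarrow> sqrt 3 / 2 * trc \<sigma> + 2 * 0 * trc e) (at_right 0)"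
      by (intro tendsto_intros)
  qed simp
  have "eventually (\<lambda>t. 0 < ?\<omega> t) (at_right 0)"
    using order_tendstoD(1)[OF w, of 0] by simp
  moreover have "eventually (\<lambda>t. ?f t < sqrt 3 * trc \<sigma> + \<zeta>) (at_right 0)"
    using order_tendstoD(2)[OF f] \<zeta> by simp
  ultimately have "eventually (\<lambda>t. 0 < t \<and> 0 < ?\<omega> t \<and> ?f t < sqrt 3 * trc \<sigma> + \<zeta>) (at_right 0)"
    using eventually_at_right_less[of "0::real"] by eventually_elim auto
  then obtain t where t: "0 < t" "0 < ?\<omega> t" "?f t < sqrt 3 * trc \<sigma> + \<zeta>"
    using eventually_happens'[OF trivial_limit_at_right_real] by blast
  obtain X Y g h where *:
    "\<And>k. k \<in> K \<Longrightarrow> X k \<in> D" "\<And>k. k \<in> K \<Longrightarrow> Y k \<in> D" "\<And>k. c k = X k + Y k"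
    "g \<in> D" "psd g" "g * g = (\<Sum>k\<in>K. adj (X k) * X k)"
    "h \<in> D" "psd h" "h * h = (\<Sum>k\<in>K. Y k * adj (Y k))"
    "?\<omega> t * (trc g + trc h) \<le> sqrt 3 / 2 * trc \<sigma> + 2 * t * trc e"
    using decomposition_estimate[where c = c, OF c \<sigma> t(1) less_imp_le[OF t(2)]] by blast
  have "trc g + trc h \<le> ?f t"
    using *(10) t(2) by (simp add: pos_le_divide_eq mult.commute)
  then have "trc g + trc h \<le> sqrt 3 * trc \<sigma> + \<zeta>" using t(3) by simp
  from that[OF *(1-9) this] show thesis .
qed

end

section \<open>Spectral theorem for Hermitian matrices\<close>

lemma dim_mat_adjoint [simp]:
  fixes A :: "complex mat"
  shows "dim_row (mat_adjoint A) = dim_col A" "dim_col (mat_adjoint A) = dim_row A"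
  by (simp_all add: mat_adjoint_def)

lemma mat_adjoint_carrier:
  fixes A :: "complex mat"
  assumes "A \<in> carrier_mat n m"
  shows "mat_adjoint A \<in> carrier_mat m n"
  using assms by (intro carrier_matI) auto

lemma index_mat_adjoint [simp]:
  fixes A :: "complex mat"
  assumes "i < dim_col A" "j < dim_row A"
  shows "mat_adjoint A $$ (i, j) = cnj (A $$ (j, i))"
proof -
  have "mat_adjoint A $$ (i, j) = map conjugate (cols A) ! i $ j"
    unfolding mat_adjoint_def by (rule mat_of_rows_index) (use assms in simp_all)
  then show ?thesis using assms by simp
qed

lemma mat_adjoint_adjoint [simp]:
  fixes A :: "complex mat"
  shows "mat_adjoint (mat_adjoint A) = A"
  by (rule eq_matI) auto

lemma mat_adjoint_mult:
  fixes A B :: "complex mat"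
  assumes "A \<in> carrier_mat n m" "B \<in> carrier_mat m k"
  shows "mat_adjoint (A * B) = mat_adjoint B * mat_adjoint A"
proof (rule eq_matI)
  fix i j assume ij: "i < dim_row (mat_adjoint B * mat_adjoint A)" "j < dim_col (mat_adjoint B * mat_adjoint A)"
  then have "mat_adjoint (A * B) $$ (i, j) = (\<Sum>l<m. cnj (A $$ (j, l)) * cnj (B $$ (l, i)))"
    using assms by (simp add: scalar_prod_def atLeast0LessThan)
  also have "\<dots> = (mat_adjoint B * mat_adjoint A) $$ (i, j)"
    using ij assms by (simp add: scalar_prod_def atLeast0LessThan mult.commute)
  finally show "mat_adjoint (A * B) $$ (i, j) = (mat_adjoint B * mat_adjoint A) $$ (i, j)" .
qed (use assms in auto)

lemma mat_adjoint_four_block: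
  fixes A B C D :: "complex mat"
  assumes "A \<in> carrier_mat n1 m1" "B \<in> carrier_mat n1 m2" "C \<in> carrier_mat n2 m1" "D \<in> carrier_mat n2 m2"
  shows "mat_adjoint (four_block_mat A B C D) =
    four_block_mat (mat_adjoint A) (mat_adjoint C) (mat_adjoint B) (mat_adjoint D)"
  using assms by (intro eq_matI) auto

text \<open>An eigenvector is completed to a basis. \<open>gram_schmidt\<close> keeps the head of
  the list but does not normalise, so the columns are divided by their lengths \<open>r j\<close>;
  the first one remains an eigenvector.\<close>

lemma unitary_with_eigencolumn:
  fixes A :: "complex mat"
  assumes A: "A \<in> carrier_mat n n" and n: "n \<noteq> 0"
  obtains V e where "V \<in> carrier_mat n n" "mat_adjoint V * V = 1\<^sub>m n"
    "\<And>i. i < n \<Longrightarrow> (A * V) $$ (i, 0) = e * V $$ (i, 0)"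
proof -
  obtain e where e: "eigenvalue A e"
  proof -
    have "degree (char_poly A) = n" using degree_monic_char_poly[OF A] by simp
    then obtain e where "poly (char_poly A) e = 0"
      using fundamental_theorem_of_algebra[of "char_poly A"] n by (auto simp: constant_degree)
    then show ?thesis using that eigenvalue_root_char_poly[OF A] by blast
  qed
  define v where "v = find_eigenvector A e"
  have ev: "eigenvector A v e" unfolding v_def by (rule find_eigenvector[OF A e])
  then have v: "v \<in> carrier_vec n" and v0: "v \<noteq> 0\<^sub>v n" and Av: "A *\<^sub>v v = e \<cdot>\<^sub>v v"
    using A by (auto simp: eigenvector_def)
  interpret cof_vec_space n "TYPE(complex)" .
  define b where "b = basis_completion v"
  define ws where "ws = gram_schmidt n b"
  from basis_completion[OF v v0, folded b_def]
  have dist_b: "distinct b" and indep: "\<not> lin_dep (set b)" and b: "set b \<subseteq> carrier_vec n"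
    and hdb: "hd b = v" and len_b: "length b = n" by auto
  from hdb len_b n obtain vs where bv: "b = v # vs" by (cases b) auto
  from gram_schmidt_result[OF b dist_b indep refl, folded ws_def]
  have ws: "set ws \<subseteq> carrier_vec n" "corthogonal ws" "length ws = n"
    by (auto simp: len_b)
  from gram_schmidt_hd[OF v, of vs, folded bv] have hdws: "hd ws = v" unfolding ws_def .
  define r where "r = (\<lambda>j. sqrt (Re ((ws ! j) \<bullet>c (ws ! j))))"
  define V where "V = mat n n (\<lambda>(i, j). (ws ! j) $ i / complex_of_real (r j))"
  have V: "V \<in> carrier_mat n n" by (simp add: V_def)
  have wsc: "ws ! j \<in> carrier_vec n" if "j < n" for j using ws that by auto
  have rr: "complex_of_real (r j) * complex_of_real (r j) = (ws ! j) \<bullet>c (ws ! j)" and r0: "r j \<noteq> 0"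
    if j: "j < n" for j
  proof -
    have ge: "(ws ! j) \<bullet>c (ws ! j) \<ge> 0" by (rule conjugate_square_ge_0_vec)
    moreover have "(ws ! j) \<bullet>c (ws ! j) \<noteq> 0" using ws j by (auto simp: corthogonal_def)
    ultimately have "Re ((ws ! j) \<bullet>c (ws ! j)) > 0" and im: "Im ((ws ! j) \<bullet>c (ws ! j)) = 0"
      by (auto simp: less_eq_complex_def complex_eq_iff)
    then show "r j \<noteq> 0" "complex_of_real (r j) * complex_of_real (r j) = (ws ! j) \<bullet>c (ws ! j)"
      by (auto simp: r_def complex_eq_iff simp flip: of_real_mult)
  qed
  have "mat_adjoint V * V = 1\<^sub>m n"
  proof (rule eq_matI)
    fix i j assume ij: "i < dim_row (1\<^sub>m n :: complex mat)" "j < dim_col (1\<^sub>m n :: complex mat)"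
    have "(mat_adjoint V * V) $$ (i, j) = (\<Sum>k<n. cnj (V $$ (k, i)) * V $$ (k, j))"
      using ij V by (auto simp: scalar_prod_def atLeast0LessThan intro!: sum.cong)
    also have "\<dots> = (\<Sum>k<n. (ws ! j) $ k * cnj ((ws ! i) $ k)) / (complex_of_real (r i) * complex_of_real (r j))"
      using ij by (simp add: V_def sum_divide_distrib mult.commute)
    also have "(\<Sum>k<n. (ws ! j) $ k * cnj ((ws ! i) $ k)) = (ws ! j) \<bullet>c (ws ! i)"
      using wsc[of i] ij by (simp add: scalar_prod_def atLeast0LessThan)
    also have "\<dots> / (complex_of_real (r i) * complex_of_real (r j)) = (1\<^sub>m n) $$ (i, j)"
    proof (cases "i = j")
      case True
      then show ?thesis using rr[of j] r0[of j] ij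
        by (metis divide_self index_one_mat(1,2) mult_eq_0_iff of_real_eq_0_iff)
    next
      case False
      then have "(ws ! j) \<bullet>c (ws ! i) = 0" using ws ij by (auto simp: corthogonal_def)
      then show ?thesis using False ij by simp
    qed
    finally show "(mat_adjoint V * V) $$ (i, j) = (1\<^sub>m n) $$ (i, j)" .
  qed (use V in auto)
  moreover have "(A * V) $$ (i, 0) = e * V $$ (i, 0)" if i: "i < n" for i
  proof -
    have ws0: "ws ! 0 = v" using hdws ws n by (cases ws) auto
    have "(A * V) $$ (i, 0) = (\<Sum>k<n. A $$ (i, k) * V $$ (k, 0))"
      using i n A V by (auto simp: scalar_prod_def atLeast0LessThan intro!: sum.cong)
    also have "\<dots> = (\<Sum>k<n. A $$ (i, k) * v $ k) / complex_of_real (r 0)"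
      using n by (simp add: V_def ws0 sum_divide_distrib)
    also have "(\<Sum>k<n. A $$ (i, k) * v $ k) = (A *\<^sub>v v) $ i"
      using i A v by (auto simp: scalar_prod_def atLeast0LessThan intro!: sum.cong)
    also have "\<dots> = e * v $ i" unfolding Av using i v by simp
    finally show ?thesis using i n by (simp add: V_def ws0)
  qed
  ultimately show thesis using that[OF V] by blast
qed

definition real_diag :: "nat \<Rightarrow> (nat \<Rightarrow> real) \<Rightarrow> complex mat" where
  "real_diag n l = mat n n (\<lambda>(i, j). if i = j then complex_of_real (l i) else 0)"

lemma real_diag_carrier: "real_diag n l \<in> carrier_mat n n"
  by (simp add: real_diag_def)

lemma mat_adjoint_real_diag [simp]: "mat_adjoint (real_diag n l) = real_diag n l"
  by (rule eq_matI) (auto simp: real_diag_def)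

lemma real_diag_mult: "real_diag n l * real_diag n m = real_diag n (\<lambda>i. l i * m i)"
proof (rule eq_matI)
  fix i j assume ij: "i < dim_row (real_diag n (\<lambda>i. l i * m i))" "j < dim_col (real_diag n (\<lambda>i. l i * m i))"
  then have "i < n" "j < n" by (auto simp: real_diag_def)
  then show "(real_diag n l * real_diag n m) $$ (i, j) = real_diag n (\<lambda>i. l i * m i) $$ (i, j)"
    by (simp add: real_diag_def scalar_prod_def if_distrib[of "\<lambda>x. x * _"] if_distrib[of "\<lambda>x. _ * x"] cong: if_cong)
qed (auto simp: real_diag_def)

lemma unitary_comm:
  fixes U :: "complex mat"
  assumes "U \<in> carrier_mat n n" "mat_adjoint U * U = 1\<^sub>m n"
  shows "U * mat_adjoint U = 1\<^sub>m n"
  using mat_mult_left_right_inverse[OF mat_adjoint_carrier[OF assms(1)] assms(1,2)] .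

text \<open>Deflation: in the basis of \<open>V\<close> the first column of the matrix vanishes
  below the diagonal, hermiticity clears the first row as well, and the induction hypothesis
  diagonalises the remaining block.\<close>

theorem hermitian_spectral:
  fixes A :: "complex mat"
  assumes "A \<in> carrier_mat n n" "mat_adjoint A = A"
  shows "\<exists>U l. U \<in> carrier_mat n n \<and> mat_adjoint U * U = 1\<^sub>m n \<and> A = U * real_diag n l * mat_adjoint U"
  using assms
proof (induction n arbitrary: A)
  case 0
  show ?case
    by (intro exI[of _ "1\<^sub>m 0"] exI[of _ "\<lambda>_. 0"]) (use 0 in \<open>auto intro!: eq_matI\<close>)
next
  case (Suc n)
  note A = Suc.prems
  obtain V e where V: "V \<in> carrier_mat (Suc n) (Suc n)" "mat_adjoint V * V = 1\<^sub>m (Suc n)"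
    and ev: "\<And>i. i < Suc n \<Longrightarrow> (A * V) $$ (i, 0) = e * V $$ (i, 0)"
    using unitary_with_eigencolumn[OF A(1)] by blast
  note V' = mat_adjoint_carrier[OF V(1)]
  note VV = unitary_comm[OF V]
  define B where "B = mat_adjoint V * A * V"
  have B: "B \<in> carrier_mat (Suc n) (Suc n)" using A V V' by (auto simp: B_def)
  have Bh: "mat_adjoint B = B"
    using A V V' by (simp add: B_def mat_adjoint_mult[of _ "Suc n" "Suc n" _ "Suc n"]
        assoc_mult_mat[of _ "Suc n" "Suc n" _ "Suc n" _ "Suc n"])
  have B0: "B $$ (i, 0) = (if i = 0 then e else 0)" if i: "i < Suc n" for i
  proof -
    have "B $$ (i, 0) = (mat_adjoint V * (A * V)) $$ (i, 0)"
      using A V V' by (simp add: B_def assoc_mult_mat[of _ "Suc n" "Suc n" _ "Suc n" _ "Suc n"])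
    also have "\<dots> = (\<Sum>k<Suc n. mat_adjoint V $$ (i, k) * (A * V) $$ (k, 0))"
      using i A V(1) V' by (simp add: scalar_prod_def atLeast0LessThan)
    also have "\<dots> = e * (\<Sum>k<Suc n. mat_adjoint V $$ (i, k) * V $$ (k, 0))"
      unfolding sum_distrib_left by (intro sum.cong refl) (simp add: ev)
    also have "(\<Sum>k<Suc n. mat_adjoint V $$ (i, k) * V $$ (k, 0)) = (mat_adjoint V * V) $$ (i, 0)"
      using i V(1) V' by (simp add: scalar_prod_def atLeast0LessThan)
    finally show ?thesis using i by (simp only: V(2)) simp
  qed
  have herm: "B $$ (i, j) = cnj (B $$ (j, i))" if "i < Suc n" "j < Suc n" for i j
    using that B arg_cong[OF Bh, of "\<lambda>M. M $$ (i, j)"] by simp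
  \<comment> \<open>The eigenvalue is a diagonal entry of the Hermitian matrix \<open>B\<close>,
    hence real.\<close>
  have e: "complex_of_real (Re e) = e"
    using herm[of 0 0] B0[of 0] by (simp add: complex_eq_iff)
  define C where "C = mat n n (\<lambda>(i, j). B $$ (Suc i, Suc j))"
  have C1: "C \<in> carrier_mat n n" by (simp add: C_def)
  have C2: "mat_adjoint C = C"
  proof (rule eq_matI)
    fix i j assume "i < dim_row C" "j < dim_col C"
    then have ij: "i < n" "j < n" by (auto simp: C_def)
    then show "mat_adjoint C $$ (i, j) = C $$ (i, j)"
      using herm[of "Suc i" "Suc j"] by (simp add: C_def)
  qed (use C1 in auto)
  note C = C1 C2
  obtain U l where U: "U \<in> carrier_mat n n" "mat_adjoint U * U = 1\<^sub>m n"
    and CU: "C = U * real_diag n l * mat_adjoint U"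
    using Suc.IH[OF C] by blast
  note U' = mat_adjoint_carrier[OF U(1)]
  define P where "P = four_block_mat (1\<^sub>m 1) (0\<^sub>m 1 n) (0\<^sub>m n 1) U"
  define l' where "l' = (\<lambda>i. case i of 0 \<Rightarrow> Re e | Suc j \<Rightarrow> l j)"
  have P: "P \<in> carrier_mat (Suc n) (Suc n)"
    using U four_block_carrier_mat[of "1\<^sub>m 1" 1 1 U n n] by (simp add: P_def)
  have "mat_adjoint (1\<^sub>m 1 :: complex mat) = 1\<^sub>m 1" by (rule eq_matI) auto
  moreover have "mat_adjoint (0\<^sub>m i j :: complex mat) = 0\<^sub>m j i" for i j by (rule eq_matI) auto
  ultimately have Pa: "mat_adjoint P = four_block_mat (1\<^sub>m 1) (0\<^sub>m 1 n) (0\<^sub>m n 1) (mat_adjoint U)"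
    using mat_adjoint_four_block[of "1\<^sub>m 1" 1 1 "0\<^sub>m 1 n" n "0\<^sub>m n 1" n U] U by (simp add: P_def)
  have dl: "real_diag (Suc n) l' = four_block_mat (mat 1 1 (\<lambda>_. e)) (0\<^sub>m 1 n) (0\<^sub>m n 1) (real_diag n l)"
  proof (rule eq_matI)
    fix i j
    assume "i < dim_row (four_block_mat (mat 1 1 (\<lambda>_. e)) (0\<^sub>m 1 n) (0\<^sub>m n 1) (real_diag n l))"
      "j < dim_col (four_block_mat (mat 1 1 (\<lambda>_. e)) (0\<^sub>m 1 n) (0\<^sub>m n 1) (real_diag n l))"
    then show "real_diag (Suc n) l' $$ (i, j) = four_block_mat (mat 1 1 (\<lambda>_. e)) (0\<^sub>m 1 n) (0\<^sub>m n 1) (real_diag n l) $$ (i, j)"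
      using e by (auto simp: real_diag_def l'_def split: nat.split)
  qed (auto simp: real_diag_def)
  have Bb: "B = four_block_mat (mat 1 1 (\<lambda>_. e)) (0\<^sub>m 1 n) (0\<^sub>m n 1) C"
  proof (rule eq_matI)
    fix i j
    assume "i < dim_row (four_block_mat (mat 1 1 (\<lambda>_. e)) (0\<^sub>m 1 n) (0\<^sub>m n 1) C)"
      "j < dim_col (four_block_mat (mat 1 1 (\<lambda>_. e)) (0\<^sub>m 1 n) (0\<^sub>m n 1) C)"
    then have ij: "i < Suc n" "j < Suc n" by (auto simp: C_def)
    show "B $$ (i, j) = four_block_mat (mat 1 1 (\<lambda>_. e)) (0\<^sub>m 1 n) (0\<^sub>m n 1) C $$ (i, j)"
    proof (cases "j = 0")
      case True
      then show ?thesis using ij B0[OF ij(1)] by (auto simp: C_def)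
    next
      case False
      have "B $$ (0, j) = 0" using herm[of 0 j] B0[OF ij(2)] ij False by simp
      then show ?thesis using False ij by (cases "i = 0") (auto simp: C_def)
    qed
  qed (use B in \<open>auto simp: C_def\<close>)
  have blk: "four_block_mat a (0\<^sub>m 1 n) (0\<^sub>m n 1) M * four_block_mat b (0\<^sub>m 1 n) (0\<^sub>m n 1) N
      = four_block_mat (a * b) (0\<^sub>m 1 n) (0\<^sub>m n 1) (M * N)"
    if "a \<in> carrier_mat 1 1" "b \<in> carrier_mat 1 1" "M \<in> carrier_mat n n" "N \<in> carrier_mat n n"
    for a b M N :: "complex mat"
    using that by (subst mult_four_block_mat[of _ 1 1 _ n _ n _ _ 1 _ n]) auto
  let ?e = "mat 1 1 (\<lambda>_. e)"
  have "mat_adjoint P * P = four_block_mat (1\<^sub>m 1) (0\<^sub>m 1 n) (0\<^sub>m n 1) (mat_adjoint U * U)"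
    unfolding Pa unfolding P_def using U(1) U' by (subst blk) auto
  also have "\<dots> = 1\<^sub>m (Suc n)" unfolding U(2) by (rule eq_matI) auto
  finally have PP: "mat_adjoint P * P = 1\<^sub>m (Suc n)" .
  have "P * real_diag (Suc n) l' = four_block_mat (1\<^sub>m 1 * ?e) (0\<^sub>m 1 n) (0\<^sub>m n 1) (U * real_diag n l)"
    unfolding dl P_def using U(1) real_diag_carrier[of n l] by (intro blk) auto
  then have "P * real_diag (Suc n) l' * mat_adjoint P
      = four_block_mat (1\<^sub>m 1 * ?e) (0\<^sub>m 1 n) (0\<^sub>m n 1) (U * real_diag n l)
        * four_block_mat (1\<^sub>m 1) (0\<^sub>m 1 n) (0\<^sub>m n 1) (mat_adjoint U)"
    unfolding Pa by simp
  also have "\<dots> = four_block_mat (1\<^sub>m 1 * ?e * 1\<^sub>m 1) (0\<^sub>m 1 n) (0\<^sub>m n 1) C"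
    unfolding CU using U(1) U' real_diag_carrier[of n l] by (intro blk) auto
  also have "1\<^sub>m 1 * ?e * 1\<^sub>m 1 = ?e"
    using left_mult_one_mat[of ?e 1 1] right_mult_one_mat[of ?e 1 1] by simp
  finally have BP: "B = P * real_diag (Suc n) l' * mat_adjoint P" unfolding Bb by simp
  note assoc = assoc_mult_mat[of _ "Suc n" "Suc n" _ "Suc n" _ "Suc n"]
  note L = real_diag_carrier[of "Suc n" l']
  note P' = mat_adjoint_carrier[OF P]
  have VP: "V * P \<in> carrier_mat (Suc n) (Suc n)" using V P by auto
  have adj: "mat_adjoint (V * P) = mat_adjoint P * mat_adjoint V" by (rule mat_adjoint_mult[OF V(1) P])
  have "mat_adjoint (V * P) * (V * P) = mat_adjoint P * ((mat_adjoint V * V) * P)"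
    unfolding adj using V(1) V' P P' by (simp add: assoc)
  also have "\<dots> = 1\<^sub>m (Suc n)" using V(2) PP P by simp
  finally have 1: "mat_adjoint (V * P) * (V * P) = 1\<^sub>m (Suc n)" .
  have "A = (V * mat_adjoint V) * A * (V * mat_adjoint V)" using VV A by simp
  also have "\<dots> = V * B * mat_adjoint V"
    unfolding B_def using V(1) V' A(1) by (simp add: assoc)
  also have "\<dots> = V * P * real_diag (Suc n) l' * mat_adjoint (V * P)"
    unfolding adj BP using V(1) V' P P' L by (simp add: assoc)
  finally show ?case using VP 1 by blast
qed

section \<open>Functional calculus through unitary conjugation\<close>

lemma real_diag_cong: "(\<And>i. i < n \<Longrightarrow> l i = m i) \<Longrightarrow> real_diag n l = real_diag n m"
  by (auto simp: real_diag_def intro!: cong_mat)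

lemma unitary_conj_mult:
  fixes U :: "complex mat"
  assumes U: "U \<in> carrier_mat n n" "mat_adjoint U * U = 1\<^sub>m n"
    and M: "M \<in> carrier_mat n n" "N \<in> carrier_mat n n"
  shows "(U * M * mat_adjoint U) * (U * N * mat_adjoint U) = U * (M * N) * mat_adjoint U"
proof -
  note assoc = assoc_mult_mat[of _ n n _ n _ n]
  note U' = mat_adjoint_carrier[OF U(1)]
  have "(U * M * mat_adjoint U) * (U * N * mat_adjoint U) = U * (M * ((mat_adjoint U * U) * (N * mat_adjoint U)))"
    using U(1) U' M by (simp add: assoc)
  also have "\<dots> = U * (M * N) * mat_adjoint U"
    unfolding U(2) using U(1) U' M by (simp add: assoc)
  finally show ?thesis .
qed

lemma unitary_conj_adjoint:
  fixes U :: "complex mat"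
  assumes U: "U \<in> carrier_mat n n"
  shows "mat_adjoint (U * real_diag n l * mat_adjoint U) = U * real_diag n l * mat_adjoint U"
  using U mat_adjoint_carrier[OF U] real_diag_carrier[of n l]
  by (simp add: mat_adjoint_mult[of _ n n _ n] assoc_mult_mat[of _ n n _ n _ n])

text \<open>Positivity is assumed in the trace form of \<open>psd\<close>. Testing with
  \<open>U\<close> times the diagonal unit at \<open>i\<close> isolates the eigenvalue
  \<open>l i\<close>.\<close>

lemma nonneg_spectral:
  fixes A :: "complex mat"
  assumes A: "A \<in> carrier_mat n n" "mat_adjoint A = A"
    and pos: "\<And>Q. Q \<in> carrier_mat n n \<Longrightarrow> 0 \<le> Re (mat_trace (mat_adjoint Q * A * Q))"
  obtains U l where "U \<in> carrier_mat n n" "mat_adjoint U * U = 1\<^sub>m n"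
    "A = U * real_diag n l * mat_adjoint U" "\<And>i. i < n \<Longrightarrow> 0 \<le> l i"
proof -
  note assoc = assoc_mult_mat[of _ n n _ n _ n]
  obtain U l where U: "U \<in> carrier_mat n n" "mat_adjoint U * U = 1\<^sub>m n"
    and AU: "A = U * real_diag n l * mat_adjoint U"
    using hermitian_spectral[OF A] by blast
  note U' = mat_adjoint_carrier[OF U(1)]
  have "0 \<le> l i" if i: "i < n" for i
  proof -
    define d where "d = real_diag n (\<lambda>j. if j = i then 1 else 0)"
    have d: "d \<in> carrier_mat n n" "mat_adjoint d = d" unfolding d_def by (auto simp: real_diag_carrier)
    have D: "real_diag n l \<in> carrier_mat n n" by (rule real_diag_carrier)
    have "mat_adjoint (U * d) * A * (U * d) = d * ((mat_adjoint U * U) * (real_diag n l * ((mat_adjoint U * U) * d)))"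
      unfolding AU mat_adjoint_mult[OF U(1) d(1)] d(2) using U(1) U' d(1) D by (simp add: assoc)
    also have "\<dots> = real_diag n (\<lambda>j. if j = i then l i else 0)"
      unfolding U(2) using d(1) D unfolding d_def by (simp add: real_diag_mult left_mult_one_mat[OF real_diag_carrier]) (intro real_diag_cong, simp)
    finally have "mat_trace (mat_adjoint (U * d) * A * (U * d)) = complex_of_real (l i)"
      using i by (simp add: mat_trace_def real_diag_def if_distrib[of complex_of_real] cong: if_cong)
    then show ?thesis using pos[of "U * d"] U(1) d(1) by simp
  qed
  then show thesis using that U AU by blast
qed

text \<open>A fourth root is taken so that the square root appears as \<open>R * R\<close> with
  \<open>R\<close> self-adjoint; its positivity is then an instance of
  \<open>psd_square\<close>.\<close>

lemma nonneg_fourth_root: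
  fixes A :: "complex mat"
  assumes A: "A \<in> carrier_mat n n" "mat_adjoint A = A"
    and pos: "\<And>Q. Q \<in> carrier_mat n n \<Longrightarrow> 0 \<le> Re (mat_trace (mat_adjoint Q * A * Q))"
  obtains R where "R \<in> carrier_mat n n" "mat_adjoint R = R" "(R * R) * (R * R) = A"
proof -
  obtain U l where U: "U \<in> carrier_mat n n" "mat_adjoint U * U = 1\<^sub>m n"
    and AU: "A = U * real_diag n l * mat_adjoint U" and l: "\<And>i. i < n \<Longrightarrow> 0 \<le> l i"
    using nonneg_spectral[OF assms] by blast
  define R where "R = U * real_diag n (\<lambda>i. sqrt (sqrt (l i))) * mat_adjoint U"
  have R: "R \<in> carrier_mat n n" unfolding R_def by (rule mult_carrier_mat[OF mult_carrier_mat[OF U(1) real_diag_carrier] mat_adjoint_carrier[OF U(1)]])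
  moreover have "mat_adjoint R = R" unfolding R_def by (rule unitary_conj_adjoint[OF U(1)])
  moreover have "R * R = U * real_diag n (\<lambda>i. sqrt (sqrt (l i)) * sqrt (sqrt (l i))) * mat_adjoint U"
    unfolding R_def by (simp add: unitary_conj_mult[OF U] real_diag_mult real_diag_carrier)
  moreover have "\<dots> = U * real_diag n (\<lambda>i. sqrt (l i)) * mat_adjoint U"
    using l by (intro arg_cong2[of _ _ _ _ "(*)"] refl real_diag_cong) simp
  moreover have "(U * real_diag n (\<lambda>i. sqrt (l i)) * mat_adjoint U) * (U * real_diag n (\<lambda>i. sqrt (l i)) * mat_adjoint U)
      = U * real_diag n (\<lambda>i. sqrt (l i) * sqrt (l i)) * mat_adjoint U"
    by (simp add: unitary_conj_mult[OF U] real_diag_mult real_diag_carrier)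
  moreover have "\<dots> = A"
    unfolding AU using l by (intro arg_cong2[of _ _ _ _ "(*)"] refl real_diag_cong) simp
  ultimately show thesis using that by metis
qed

lemma nonneg_inverse:
  fixes A :: "complex mat"
  assumes A: "A \<in> carrier_mat n n" "mat_adjoint A = A"
    and pos: "\<And>Q. Q \<in> carrier_mat n n \<Longrightarrow> 0 \<le> Re (mat_trace (mat_adjoint Q * A * Q))"
  obtains R where "R \<in> carrier_mat n n" "(1\<^sub>m n + A) * R = 1\<^sub>m n"
proof -
  obtain U l where U: "U \<in> carrier_mat n n" "mat_adjoint U * U = 1\<^sub>m n"
    and AU: "A = U * real_diag n l * mat_adjoint U" and l: "\<And>i. i < n \<Longrightarrow> 0 \<le> l i"
    using nonneg_spectral[OF assms] by blast
  note U' = mat_adjoint_carrier[OF U(1)]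
  have one: "real_diag n (\<lambda>_. 1) = 1\<^sub>m n" by (rule eq_matI) (auto simp: real_diag_def)
  have conj1: "U * real_diag n (\<lambda>_. 1) * mat_adjoint U = 1\<^sub>m n"
    unfolding one using U(1) unitary_comm[OF U] by simp
  define R where "R = U * real_diag n (\<lambda>i. 1 / (1 + l i)) * mat_adjoint U"
  have R: "R \<in> carrier_mat n n" unfolding R_def by (rule mult_carrier_mat[OF mult_carrier_mat[OF U(1) real_diag_carrier] mat_adjoint_carrier[OF U(1)]])
  have "1\<^sub>m n + A = U * real_diag n (\<lambda>_. 1) * mat_adjoint U + U * real_diag n l * mat_adjoint U"
    by (simp only: conj1 AU)
  also have "\<dots> = U * (real_diag n (\<lambda>_. 1) + real_diag n l) * mat_adjoint U"
    using U(1) U' real_diag_carrier[of n "\<lambda>_. 1"] real_diag_carrier[of n l]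
    by (simp add: mult_add_distrib_mat[of _ n n _ n] add_mult_distrib_mat[of _ n n _ _ n])
  also have "real_diag n (\<lambda>_. 1) + real_diag n l = real_diag n (\<lambda>i. 1 + l i)"
    by (rule eq_matI) (auto simp: real_diag_def)
  finally have "(1\<^sub>m n + A) * R = U * real_diag n (\<lambda>i. (1 + l i) * (1 / (1 + l i))) * mat_adjoint U"
    by (simp add: R_def unitary_conj_mult[OF U] real_diag_mult real_diag_carrier)
  also have "real_diag n (\<lambda>i. (1 + l i) * (1 / (1 + l i))) = real_diag n (\<lambda>_. 1)"
  proof (rule real_diag_cong)
    fix i assume "i < n"
    then show "(1 + l i) * (1 / (1 + l i)) = 1" using l[of i] by simp
  qed
  finally show thesis using that[OF R] conj1 by simp
qed

section \<open>Kronecker products and Pauli matrices\<close>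

text \<open>Indices of a Kronecker product are read through \<open>div\<close> and
  \<open>mod\<close>; this separates a sum over the combined index into a double sum.\<close>

lemma sum_div_mod:
  fixes f :: "nat \<Rightarrow> nat \<Rightarrow> 'a :: comm_monoid_add"
  shows "(\<Sum>k<b * e. f (k div e) (k mod e)) = (\<Sum>x<b. \<Sum>y<e. f x y)"
proof -
  have "(\<Sum>k<b * e. f (k div e) (k mod e)) = (\<Sum>x<b. \<Sum>k\<in>{x * e..<x * e + e}. f (k div e) (k mod e))"
    by (rule sum.nat_group[symmetric])
  also have "\<dots> = (\<Sum>x<b. \<Sum>y<e. f x y)"
  proof (rule sum.cong[OF refl])
    fix x
    have "(\<Sum>k\<in>{x * e..<x * e + e}. f (k div e) (k mod e)) = (\<Sum>y\<in>{0..<e}. f ((y + x * e) div e) ((y + x * e) mod e))"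
      using sum.shift_bounds_nat_ivl[of "\<lambda>k. f (k div e) (k mod e)" 0 "x * e" e] by (simp add: add.commute)
    also have "\<dots> = (\<Sum>y<e. f x y)"
      by (rule sum.cong) auto
    finally show "(\<Sum>k\<in>{x * e..<x * e + e}. f (k div e) (k mod e)) = (\<Sum>y<e. f x y)" .
  qed
  finally show ?thesis .
qed

lemma div_mod_less:
  fixes i :: nat
  assumes "i < a * b"
  shows "i div b < a" "i mod b < b" "0 < b"
proof -
  show "0 < b" using assms by (cases b) auto
  then show "i mod b < b" by simp
  show "i div b < a" using assms by (simp add: less_mult_imp_div_less)
qed

lemma dim_kron [simp]:
  "dim_row (kron A B) = dim_row A * dim_row B" "dim_col (kron A B) = dim_col A * dim_col B"
  by (simp_all add: kron_def)

lemma index_kron: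
  "i < dim_row A * dim_row B \<Longrightarrow> j < dim_col A * dim_col B \<Longrightarrow>
    kron A B $$ (i, j) = A $$ (i div dim_row B, j div dim_col B) * B $$ (i mod dim_row B, j mod dim_col B)"
  by (simp add: kron_def)

lemma kron_carrier: "A \<in> carrier_mat a b \<Longrightarrow> B \<in> carrier_mat c d \<Longrightarrow> kron A B \<in> carrier_mat (a * c) (b * d)"
  by (auto intro!: carrier_matI)

lemma index_mult_mat_sum:
  fixes A B :: "complex mat"
  assumes "A \<in> carrier_mat n m" "B \<in> carrier_mat m k" "i < n" "j < k"
  shows "(A * B) $$ (i, j) = (\<Sum>l<m. A $$ (i, l) * B $$ (l, j))"
  using assms by (simp add: scalar_prod_def atLeast0LessThan)

lemma kron_mult:
  assumes A: "A \<in> carrier_mat a b" and B: "B \<in> carrier_mat d e"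
    and C: "C \<in> carrier_mat b c" and D: "D \<in> carrier_mat e f"
  shows "kron A B * kron C D = kron (A * C) (B * D)"
proof (rule eq_matI)
  fix i j assume "i < dim_row (kron (A * C) (B * D))" "j < dim_col (kron (A * C) (B * D))"
  then have ij: "i < a * d" "j < c * f" using assms by auto
  note ib = div_mod_less[OF ij(1)] and jb = div_mod_less[OF ij(2)]
  have dims: "dim_row A = a" "dim_col A = b" "dim_row B = d" "dim_col B = e"
    "dim_row C = b" "dim_col C = c" "dim_row D = e" "dim_col D = f" using assms by auto
  have "(kron A B * kron C D) $$ (i, j) = (\<Sum>k<b * e. kron A B $$ (i, k) * kron C D $$ (k, j))"
    by (rule index_mult_mat_sum[OF kron_carrier[OF A B] kron_carrier[OF C D] ij])
  also have "\<dots> = (\<Sum>k<b * e. (A $$ (i div d, k div e) * C $$ (k div e, j div f)) *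
      (B $$ (i mod d, k mod e) * D $$ (k mod e, j mod f)))"
    using ij by (intro sum.cong refl) (simp add: index_kron dims)
  also have "\<dots> = (\<Sum>x<b. \<Sum>y<e. (A $$ (i div d, x) * C $$ (x, j div f)) * (B $$ (i mod d, y) * D $$ (y, j mod f)))"
    by (rule sum_div_mod[where f = "\<lambda>x y. (A $$ (i div d, x) * C $$ (x, j div f)) * (B $$ (i mod d, y) * D $$ (y, j mod f))"])
  also have "\<dots> = (\<Sum>x<b. A $$ (i div d, x) * C $$ (x, j div f)) * (\<Sum>y<e. B $$ (i mod d, y) * D $$ (y, j mod f))"
    by (simp only: sum_product)
  also have "\<dots> = (A * C) $$ (i div d, j div f) * (B * D) $$ (i mod d, j mod f)"
    using index_mult_mat_sum[OF A C ib(1) jb(1)] index_mult_mat_sum[OF B D ib(2) jb(2)] by simp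
  also have "\<dots> = kron (A * C) (B * D) $$ (i, j)"
    using ij by (simp add: index_kron dims)
  finally show "(kron A B * kron C D) $$ (i, j) = kron (A * C) (B * D) $$ (i, j)" .
qed auto

lemma mat_adjoint_kron: "mat_adjoint (kron A B) = kron (mat_adjoint A) (mat_adjoint B)"
proof (rule eq_matI)
  fix i j assume "i < dim_row (kron (mat_adjoint A) (mat_adjoint B))" "j < dim_col (kron (mat_adjoint A) (mat_adjoint B))"
  then have ij: "i < dim_col A * dim_col B" "j < dim_row A * dim_row B" by auto
  note b = div_mod_less[OF ij(1)] div_mod_less[OF ij(2)]
  show "mat_adjoint (kron A B) $$ (i, j) = kron (mat_adjoint A) (mat_adjoint B) $$ (i, j)"
    using ij b by (simp add: index_kron)
qed auto

lemma kron_add_left: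
  assumes "A \<in> carrier_mat a b" "C \<in> carrier_mat a b"
  shows "kron (A + C) B = kron A B + kron C B"
proof (rule eq_matI)
  fix i j assume "i < dim_row (kron A B + kron C B)" "j < dim_col (kron A B + kron C B)"
  then have ij: "i < a * dim_row B" "j < b * dim_col B" using assms by auto
  note d = div_mod_less[OF ij(1)] div_mod_less[OF ij(2)]
  show "kron (A + C) B $$ (i, j) = (kron A B + kron C B) $$ (i, j)"
    using ij d assms by (simp add: index_kron distrib_right)
qed (use assms in auto)

lemma kron_smult_left: "kron (c \<cdot>\<^sub>m A) B = c \<cdot>\<^sub>m kron A B"
proof (rule eq_matI)
  fix i j assume "i < dim_row (c \<cdot>\<^sub>m kron A B)" "j < dim_col (c \<cdot>\<^sub>m kron A B)"
  then have ij: "i < dim_row A * dim_row B" "j < dim_col A * dim_col B" by auto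
  note d = div_mod_less[OF ij(1)] div_mod_less[OF ij(2)]
  show "kron (c \<cdot>\<^sub>m A) B $$ (i, j) = (c \<cdot>\<^sub>m kron A B) $$ (i, j)"
    using ij d by (simp add: index_kron)
qed auto

lemma kron_smult_right: "kron A (c \<cdot>\<^sub>m B) = c \<cdot>\<^sub>m kron A B"
proof (rule eq_matI)
  fix i j assume "i < dim_row (c \<cdot>\<^sub>m kron A B)" "j < dim_col (c \<cdot>\<^sub>m kron A B)"
  then have ij: "i < dim_row A * dim_row B" "j < dim_col A * dim_col B" by auto
  note d = div_mod_less[OF ij(1)] div_mod_less[OF ij(2)]
  show "kron A (c \<cdot>\<^sub>m B) $$ (i, j) = (c \<cdot>\<^sub>m kron A B) $$ (i, j)"
    using ij d by (simp add: index_kron)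
qed auto

lemma kron_one: "kron (1\<^sub>m a) (1\<^sub>m b) = 1\<^sub>m (a * b)"
proof (rule eq_matI)
  fix i j assume "i < dim_row (1\<^sub>m (a * b) :: complex mat)" "j < dim_col (1\<^sub>m (a * b) :: complex mat)"
  then have ij: "i < a * b" "j < a * b" by auto
  note d = div_mod_less[OF ij(1)] div_mod_less[OF ij(2)]
  have "i = j" if "i div b = j div b" "i mod b = j mod b"
    using that by (metis div_mult_mod_eq)
  then show "kron (1\<^sub>m a) (1\<^sub>m b) $$ (i, j) = 1\<^sub>m (a * b) $$ (i, j)"
    using ij d by (auto simp: index_kron)
qed auto

lemma kron_assoc: "kron (kron A B) C = kron A (kron B C)"
proof (rule eq_matI)
  fix i j assume "i < dim_row (kron A (kron B C))" "j < dim_col (kron A (kron B C))"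
  then have ij: "i < (dim_row A * dim_row B) * dim_row C" "j < (dim_col A * dim_col B) * dim_col C"
    by (auto simp: mult.assoc)
  have ij': "i < dim_row A * (dim_row B * dim_row C)" "j < dim_col A * (dim_col B * dim_col C)"
    using ij by (auto simp: mult.assoc)
  note d = div_mod_less[OF ij(1)] div_mod_less[OF ij(2)]
  note d' = div_mod_less[OF ij'(1)] div_mod_less[OF ij'(2)]
  note m = mod_mult2_eq[of _ "dim_row C" "dim_row B"] mod_mult2_eq[of _ "dim_col C" "dim_col B"]
  have md: "i mod (dim_row B * dim_row C) div dim_row C = i div dim_row C mod dim_row B"
    "i mod (dim_row B * dim_row C) mod dim_row C = i mod dim_row C"
    "i div (dim_row B * dim_row C) = i div dim_row C div dim_row B"
    "j mod (dim_col B * dim_col C) div dim_col C = j div dim_col C mod dim_col B"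
    "j mod (dim_col B * dim_col C) mod dim_col C = j mod dim_col C"
    "j div (dim_col B * dim_col C) = j div dim_col C div dim_col B"
    using m[of i] m[of j] d by (simp_all add: mult.commute[of "dim_row B"] mult.commute[of "dim_col B"] div_mult2_eq)
  show "kron (kron A B) C $$ (i, j) = kron A (kron B C) $$ (i, j)"
    using ij ij' d d' by (simp add: index_kron md mult.assoc)
qed (auto simp: mult.assoc)

lemma mat_trace_kron:
  assumes "A \<in> carrier_mat a a" "B \<in> carrier_mat b b"
  shows "mat_trace (kron A B) = mat_trace A * mat_trace B"
proof -
  have "mat_trace (kron A B) = (\<Sum>k<a * b. A $$ (k div b, k div b) * B $$ (k mod b, k mod b))"
    using assms by (simp add: mat_trace_def index_kron)
  also have "\<dots> = (\<Sum>x<a. \<Sum>y<b. A $$ (x, x) * B $$ (y, y))"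
    by (rule sum_div_mod[where f = "\<lambda>x y. A $$ (x, x) * B $$ (y, y)"])
  finally show ?thesis using assms by (simp add: mat_trace_def sum_product)
qed

lemma kron_pow_one: "kron_pow (1\<^sub>m 2) m = 1\<^sub>m (2 ^ m)"
  by (induction m) (simp_all add: kron_one)

lemma pauli_carrier: "pauli i \<in> carrier_mat 2 2"
  by (simp add: pauli_def mat_of_rows_list_def numeral_2_eq_2)

lemma pauli_mats:
  "pauli 1 = mat 2 2 (\<lambda>(i, j). if i = j then 0 else 1)"
  "pauli 2 = mat 2 2 (\<lambda>(i, j). if i = j then 0 else if i = 0 then - \<i> else \<i>)"
  "pauli 3 = mat 2 2 (\<lambda>(i, j). if i \<noteq> j then 0 else if i = 0 then 1 else - 1)"
  by (auto simp: pauli_def mat_of_rows_list_def less_2_cases_iff intro!: eq_matI)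

lemma eq_mat2I:
  assumes "A \<in> carrier_mat 2 2" "B \<in> carrier_mat 2 2"
    and "A $$ (0, 0) = B $$ (0, 0)" "A $$ (0, 1) = B $$ (0, 1)" "A $$ (1, 0) = B $$ (1, 0)" "A $$ (1, 1) = B $$ (1, 1)"
  shows "A = B"
  using assms by (intro eq_matI) (auto simp: less_2_cases_iff)

lemma sum_less_2: "(\<Sum>i<2. f i) = f 0 + f (1 :: nat)" for f :: "nat \<Rightarrow> complex"
  by (simp add: numeral_2_eq_2)

lemma pauli_adjoint: "i \<in> {1, 2, 3} \<Longrightarrow> mat_adjoint (pauli i) = pauli i"
  by (rule eq_mat2I) (auto simp: pauli_mats simp del: One_nat_def intro: mat_adjoint_carrier)

lemma pauli_square: "i \<in> {1, 2, 3} \<Longrightarrow> pauli i * pauli i = 1\<^sub>m 2"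
  by (rule eq_mat2I) (auto simp: pauli_mats index_mult_mat_sum[of _ 2 2 _ 2] sum_less_2 simp del: index_mult_mat(1) One_nat_def)

lemma pauli_anticomm:
  "i \<in> {1, 2, 3} \<Longrightarrow> j \<in> {1, 2, 3} \<Longrightarrow> i \<noteq> j \<Longrightarrow> pauli i * pauli j = (- 1) \<cdot>\<^sub>m (pauli j * pauli i)"
  by (rule eq_mat2I) (auto simp: pauli_mats index_mult_mat_sum[of _ 2 2 _ 2] sum_less_2 simp del: index_mult_mat(1) One_nat_def)

lemma pauli_1_2: "pauli 1 * pauli 2 = \<i> \<cdot>\<^sub>m pauli 3"
  by (rule eq_mat2I) (auto simp: pauli_mats index_mult_mat_sum[of _ 2 2 _ 2] sum_less_2 simp del: index_mult_mat(1) One_nat_def)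

section \<open>Matrices of all sizes as a star algebra\<close>

text \<open>A single type containing the matrices of every size, since the dimension \<open>d\<close> is quantified
  inside the theorem and cannot be an index type.\<close>

typedef fmat = "{f :: nat \<Rightarrow> nat \<Rightarrow> complex. \<exists>n. \<forall>i j. n \<le> i \<or> n \<le> j \<longrightarrow> f i j = 0}"
  morphisms entry Abs_fmat
  by (intro exI[of _ "\<lambda>_ _. 0"]) auto

setup_lifting type_definition_fmat

definition bound :: "nat \<Rightarrow> fmat \<Rightarrow> bool" where
  "bound n a \<longleftrightarrow> (\<forall>i j. n \<le> i \<or> n \<le> j \<longrightarrow> entry a i j = 0)"

lemma bound_ex: "\<exists>n. bound n a"
  using entry[of a] by (auto simp: bound_def)

lemma bound_mono: "bound n a \<Longrightarrow> n \<le> m \<Longrightarrow> bound m a"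
  by (meson bound_def le_trans)

lemma bound_ex2: obtains n where "bound n a" "bound n b"
  using bound_ex[of a] bound_ex[of b] bound_mono by (metis max.cobounded1 max.cobounded2)

lemma bound_ex3: obtains n where "bound n a" "bound n b" "bound n c"
proof -
  obtain m k where "bound m a" "bound m b" "bound k c" using bound_ex2[of a b] bound_ex[of c] by metis
  then show thesis using that[of "max m k"] bound_mono by (metis max.cobounded1 max.cobounded2)
qed

lemma fmat_eqI: "(\<And>i j. entry a i j = entry b i j) \<Longrightarrow> a = b"
  by (metis entry_inject ext)

definition fmat_of_fun :: "nat \<Rightarrow> (nat \<Rightarrow> nat \<Rightarrow> complex) \<Rightarrow> fmat" where
  "fmat_of_fun n f = Abs_fmat (\<lambda>i j. if i < n \<and> j < n then f i j else 0)"

lemma entry_fmat_of_fun: "entry (fmat_of_fun n f) i j = (if i < n \<and> j < n then f i j else 0)"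
  unfolding fmat_of_fun_def by (subst Abs_fmat_inverse) (auto intro!: exI[of _ n])

instantiation fmat :: real_vector
begin

lift_definition zero_fmat :: fmat is "\<lambda>_ _. 0" by auto
lift_definition plus_fmat :: "fmat \<Rightarrow> fmat \<Rightarrow> fmat" is "\<lambda>f g i j. f i j + g i j"
proof -
  fix f g :: "nat \<Rightarrow> nat \<Rightarrow> complex"
  assume "\<exists>n. \<forall>i j. n \<le> i \<or> n \<le> j \<longrightarrow> f i j = 0" "\<exists>n. \<forall>i j. n \<le> i \<or> n \<le> j \<longrightarrow> g i j = 0"
  then obtain n m where "\<forall>i j. n \<le> i \<or> n \<le> j \<longrightarrow> f i j = 0" "\<forall>i j. m \<le> i \<or> m \<le> j \<longrightarrow> g i j = 0" by blast
  then show "\<exists>n. \<forall>i j. n \<le> i \<or> n \<le> j \<longrightarrow> f i j + g i j = 0"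
    by (intro exI[of _ "max n m"]) auto
qed
lift_definition uminus_fmat :: "fmat \<Rightarrow> fmat" is "\<lambda>f i j. - f i j" by auto
definition minus_fmat :: "fmat \<Rightarrow> fmat \<Rightarrow> fmat" where "minus_fmat a b = a + (- b)"
lift_definition scaleR_fmat :: "real \<Rightarrow> fmat \<Rightarrow> fmat" is "\<lambda>r f i j. r *\<^sub>R f i j" by fastforce

instance
  by standard (auto simp: minus_fmat_def intro!: fmat_eqI; transfer; simp add: algebra_simps)+

end

lemma entry_minus: "entry (a - b) i j = entry a i j - entry b i j"
  unfolding minus_fmat_def by transfer simp

lemmas entry_simps = zero_fmat.rep_eq plus_fmat.rep_eq uminus_fmat.rep_eq scaleR_fmat.rep_eq entry_minus

instantiation fmat :: star_trace
begin

text \<open>Every common size bound gives the same product, as \<open>entry_times\<close> shows, so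
  the choice made by \<open>SOME\<close> is immaterial. The same holds for the adjoint and the trace
  below.\<close>

definition times_fmat :: "fmat \<Rightarrow> fmat \<Rightarrow> fmat" where
  "times_fmat a b = (let n = (SOME n. bound n a \<and> bound n b) in
     fmat_of_fun n (\<lambda>i j. \<Sum>k<n. entry a i k * entry b k j))"

definition adj_fmat :: "fmat \<Rightarrow> fmat" where
  "adj_fmat a = fmat_of_fun (SOME n. bound n a) (\<lambda>i j. cnj (entry a j i))"

definition trc_fmat :: "fmat \<Rightarrow> real" where
  "trc_fmat a = (\<Sum>i<(SOME n. bound n a). Re (entry a i i))"

lemma sum_bound_eq:
  fixes f :: "nat \<Rightarrow> 'b :: comm_monoid_add"
  assumes "\<And>k. n \<le> k \<Longrightarrow> f k = 0" "\<And>k. m \<le> k \<Longrightarrow> f k = 0"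
  shows "(\<Sum>k<n. f k) = (\<Sum>k<m. f k)"
proof (cases "n \<le> m")
  case True
  then show ?thesis using assms(1) by (intro sum.mono_neutral_left) auto
next
  case False
  then show ?thesis using assms(2) by (intro sum.mono_neutral_right) auto
qed

lemma entry_times:
  assumes a: "bound n a"
  shows "entry (a * b) i j = (\<Sum>k<n. entry a i k * entry b k j)"
proof -
  define m where "m = (SOME n. bound n a \<and> bound n b)"
  obtain l where "bound l a" "bound l b" by (rule bound_ex2)
  then have m: "bound m a" "bound m b"
    using someI[of "\<lambda>n. bound n a \<and> bound n b" l] by (simp_all add: m_def)
  have "entry (a * b) i j = (if i < m \<and> j < m then \<Sum>k<m. entry a i k * entry b k j else 0)"
    by (simp only: times_fmat_def Let_def m_def[symmetric] entry_fmat_of_fun)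
  also have "\<dots> = (\<Sum>k<m. entry a i k * entry b k j)"
  proof (cases "i < m \<and> j < m")
    case False
    then have "entry a i k * entry b k j = 0" for k using m by (cases "i < m") (simp_all add: bound_def)
    then have "(\<Sum>k<m. entry a i k * entry b k j) = 0" by (intro sum.neutral) blast
    then show ?thesis using False by simp
  qed simp
  also have "\<dots> = (\<Sum>k<n. entry a i k * entry b k j)"
    using m a by (intro sum_bound_eq) (simp_all add: bound_def)
  finally show ?thesis .
qed

lemma entry_adj: "entry (adj a) i j = cnj (entry a j i)"
proof -
  define m where "m = (SOME n. bound n a)"
  have m: "bound m a" unfolding m_def using bound_ex by (rule someI_ex)
  have "entry (adj a) i j = (if i < m \<and> j < m then cnj (entry a j i) else 0)"
    by (simp only: adj_fmat_def m_def[symmetric] entry_fmat_of_fun)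
  then show ?thesis using m by (cases "i < m") (simp_all add: bound_def)
qed

lemma trc_eq:
  assumes "bound n a"
  shows "trc a = (\<Sum>i<n. Re (entry a i i))"
proof -
  define m where "m = (SOME n. bound n a)"
  have m: "bound m a" unfolding m_def using bound_ex by (rule someI_ex)
  have "trc a = (\<Sum>i<m. Re (entry a i i))" by (simp only: trc_fmat_def m_def)
  also have "\<dots> = (\<Sum>i<n. Re (entry a i i))"
    using assms m by (intro sum_bound_eq) (simp_all add: bound_def)
  finally show ?thesis .
qed

lemma bound_times: "bound n a \<Longrightarrow> bound n b \<Longrightarrow> bound n (a * b)"
  unfolding bound_def[of n "a * b"] by (simp only: entry_times[of n a]) (auto simp: bound_def intro!: sum.neutral)

lemma bound_adj: "bound n a \<Longrightarrow> bound n (adj a)"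
  by (simp add: bound_def entry_adj)

lemma bound_plus: "bound n a \<Longrightarrow> bound n b \<Longrightarrow> bound n (a + b)"
  by (simp add: bound_def entry_simps)

lemma bound_scaleR: "bound n a \<Longrightarrow> bound n (r *\<^sub>R a)"
  by (simp add: bound_def entry_simps)

lemma trc_square:
  assumes "bound n a"
  shows "trc (adj a * a) = (\<Sum>i<n. \<Sum>k<n. (cmod (entry a k i))\<^sup>2)"
proof -
  have "Re (cnj z * z) = (cmod z)\<^sup>2" for z
    unfolding cmod_power2 by (simp add: power2_eq_square)
  then show ?thesis
    by (simp only: trc_eq[OF bound_times[OF bound_adj[OF assms] assms]] entry_times[OF bound_adj[OF assms]]
        entry_adj Re_sum)
qed

lemma cmod_sum_mult_le:
  fixes f g :: "nat \<Rightarrow> complex"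
  shows "(cmod (\<Sum>k<n. f k * g k))\<^sup>2 \<le> (\<Sum>k<n. (cmod (f k))\<^sup>2) * (\<Sum>k<n. (cmod (g k))\<^sup>2)"
proof -
  have "cmod (\<Sum>k<n. f k * g k) \<le> (\<Sum>k<n. \<bar>cmod (f k)\<bar> * \<bar>cmod (g k)\<bar>)"
    by (rule order.trans[OF norm_sum]) (simp add: norm_mult)
  also have "\<dots> \<le> L2_set (\<lambda>k. cmod (f k)) {..<n} * L2_set (\<lambda>k. cmod (g k)) {..<n}"
    by (rule L2_set_mult_ineq)
  finally have "(cmod (\<Sum>k<n. f k * g k))\<^sup>2 \<le> (L2_set (\<lambda>k. cmod (f k)) {..<n} * L2_set (\<lambda>k. cmod (g k)) {..<n})\<^sup>2"
    by (rule power_mono) simp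
  then show ?thesis
    by (simp add: power_mult_distrib L2_set_def sum_nonneg)
qed

instance
proof
  fix a b c :: fmat and r :: real
  show "a * b * c = a * (b * c)"
  proof (rule fmat_eqI)
    fix i j
    obtain n where n: "bound n a" "bound n b" "bound n c" by (rule bound_ex3)
    have "entry (a * b * c) i j = (\<Sum>k<n. \<Sum>l<n. entry a i l * entry b l k * entry c k j)"
      by (simp only: entry_times[OF bound_times[OF n(1,2)]] entry_times[OF n(1)] sum_distrib_right)
    also have "\<dots> = (\<Sum>l<n. \<Sum>k<n. entry a i l * entry b l k * entry c k j)"
      by (rule sum.swap)
    also have "\<dots> = entry (a * (b * c)) i j"
      by (simp only: entry_times[OF n(1)] entry_times[OF n(2)] sum_distrib_left mult.assoc)
    finally show "entry (a * b * c) i j = entry (a * (b * c)) i j" .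
  qed
  show "(a + b) * c = a * c + b * c"
  proof (rule fmat_eqI)
    fix i j
    obtain n where n: "bound n a" "bound n b" "bound n c" by (rule bound_ex3)
    show "entry ((a + b) * c) i j = entry (a * c + b * c) i j"
      by (simp add: entry_times[OF bound_plus[OF n(1,2)]] entry_times[OF n(1)] entry_times[OF n(2)]
          entry_simps distrib_right sum.distrib)
  qed
  show "a * (b + c) = a * b + a * c"
  proof (rule fmat_eqI)
    fix i j
    obtain n where n: "bound n a" "bound n b" "bound n c" by (rule bound_ex3)
    show "entry (a * (b + c)) i j = entry (a * b + a * c) i j"
      by (simp add: entry_times[OF n(1)] entry_simps distrib_left sum.distrib)
  qed
  obtain n where n: "bound n a" "bound n b" by (rule bound_ex2)
  show "r *\<^sub>R a * b = r *\<^sub>R (a * b)"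
    by (rule fmat_eqI) (simp add: entry_times[OF bound_scaleR[OF n(1)]] entry_times[OF n(1)] entry_simps scaleR_sum_right)
  show "a * r *\<^sub>R b = r *\<^sub>R (a * b)"
    by (rule fmat_eqI) (simp add: entry_times[OF n(1)] entry_simps scaleR_sum_right)
  show "adj (a + b) = adj a + adj b"
    by (rule fmat_eqI) (simp add: entry_adj entry_simps)
  show "adj (a * b) = adj b * adj a"
    by (rule fmat_eqI) (simp add: entry_adj entry_times[OF n(1)] entry_times[OF bound_adj[OF n(2)]] mult.commute)
  show "adj (adj a) = a"
    by (rule fmat_eqI) (simp add: entry_adj)
  show "adj (r *\<^sub>R a) = r *\<^sub>R adj a"
    by (rule fmat_eqI) (simp add: entry_adj entry_simps)
  show "trc (a + b) = trc a + trc b"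
    by (simp add: trc_eq[OF n(1)] trc_eq[OF n(2)] trc_eq[OF bound_plus[OF n]] entry_simps sum.distrib)
  show "trc (r *\<^sub>R a) = r * trc a"
    by (simp add: trc_eq[OF n(1)] trc_eq[OF bound_scaleR[OF n(1)]] entry_simps sum_distrib_left)
  show "trc (adj a) = trc a"
    by (simp add: trc_eq[OF n(1)] trc_eq[OF bound_adj[OF n(1)]] entry_adj)
  show "trc (a * b) = trc (b * a)"
  proof -
    have "trc (a * b) = (\<Sum>i<n. \<Sum>k<n. Re (entry a i k * entry b k i))"
      by (simp only: trc_eq[OF bound_times[OF n]] entry_times[OF n(1)] Re_sum)
    also have "\<dots> = (\<Sum>k<n. \<Sum>i<n. Re (entry b k i * entry a i k))"
      by (subst sum.swap) (simp only: mult.commute)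
    also have "\<dots> = trc (b * a)"
      by (simp only: trc_eq[OF bound_times[OF n(2,1)]] entry_times[OF n(2)] Re_sum)
    finally show ?thesis .
  qed
  show "0 \<le> trc (adj a * a)"
    unfolding trc_square[OF n(1)] by (intro sum_nonneg) auto
  show "a = 0" if "trc (adj a * a) = 0"
  proof (rule fmat_eqI)
    fix i j
    have "(\<Sum>k<n. (cmod (entry a k j))\<^sup>2) = 0" if "j < n"
      using \<open>trc (adj a * a) = 0\<close> that unfolding trc_square[OF n(1)]
      by (subst (asm) sum_nonneg_eq_0_iff) (auto intro: sum_nonneg)
    then have "entry a i j = 0" if "i < n" "j < n"
      using that by (subst (asm) sum_nonneg_eq_0_iff) auto
    then show "entry a i j = entry 0 i j"
      using n(1) by (cases "i < n \<and> j < n") (auto simp: bound_def zero_fmat.rep_eq)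
  qed
  \<comment> \<open>Submultiplicativity of the Hilbert-Schmidt norm is Cauchy-Schwarz applied to
    every entry of the product.\<close>
  show "trc (adj (a * b) * (a * b)) \<le> trc (adj a * a) * trc (adj b * b)"
  proof -
    have "trc (adj (a * b) * (a * b)) = (\<Sum>j<n. \<Sum>i<n. (cmod (\<Sum>k<n. entry a i k * entry b k j))\<^sup>2)"
      by (simp only: trc_square[OF bound_times[OF n]] entry_times[OF n(1)])
    also have "\<dots> \<le> (\<Sum>j<n. \<Sum>i<n. (\<Sum>k<n. (cmod (entry a i k))\<^sup>2) * (\<Sum>k<n. (cmod (entry b k j))\<^sup>2))"
      by (intro sum_mono cmod_sum_mult_le)
    also have "\<dots> = (\<Sum>i<n. \<Sum>k<n. (cmod (entry a i k))\<^sup>2) * (\<Sum>j<n. \<Sum>k<n. (cmod (entry b k j))\<^sup>2)"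
      unfolding sum_distrib_right[symmetric] sum_distrib_left[symmetric] ..
    also have "(\<Sum>i<n. \<Sum>k<n. (cmod (entry a i k))\<^sup>2) = (\<Sum>k<n. \<Sum>i<n. (cmod (entry a i k))\<^sup>2)"
      by (rule sum.swap)
    finally show ?thesis by (simp only: trc_square[OF n(1)] trc_square[OF n(2)])
  qed
qed

end

text \<open>Since \<open>g\<close> and \<open>h\<close> are not known to commute, the symmetrised
  product is used: for \<open>\<delta> = g - h\<close>,
  \<open>\<delta> (g + h) + (g + h) \<delta> = 2 (g^2 - h^2) = 0\<close>. Its trace against
  \<open>\<delta>\<close> forces \<open>\<delta> g \<delta>\<close> and
  \<open>\<delta> h \<delta>\<close> to have trace zero, hence
  \<open>g \<delta> = h \<delta> = 0\<close> and \<open>\<delta>^2 = 0\<close>.\<close>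

lemma (in trace_corner) psd_sqrt_unique:
  assumes g: "g \<in> D" "psd g" and h: "h \<in> D" "psd h" and eq: "g * g = h * h"
  shows "g = h"
proof -
  define \<delta> where "\<delta> = g - h"
  have \<delta>: "\<delta> \<in> D" "adj \<delta> = \<delta>" using g h by (auto simp: \<delta>_def adj_diff psd_adj)
  have "\<delta> * (g + h) + (g + h) * \<delta> = 2 *\<^sub>R (g * g - h * h)"
    by (simp add: \<delta>_def algebra_simps scaleR_2)
  then have "trc (\<delta> * (\<delta> * (g + h) + (g + h) * \<delta>)) = 0" by (simp add: eq)
  moreover have "trc (\<delta> * (\<delta> * (g + h))) = trc (\<delta> * ((g + h) * \<delta>))"
    using trc_comm[of \<delta> "\<delta> * (g + h)"] by (simp add: mult.assoc)
  ultimately have "trc (\<delta> * ((g + h) * \<delta>)) = 0" by (simp add: distrib_left trc_add)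
  then have sum0: "trc (adj \<delta> * g * \<delta>) + trc (adj \<delta> * h * \<delta>) = 0"
    by (simp add: \<delta> algebra_simps trc_add)
  have zero: "a * \<delta> = 0" if a: "a \<in> D" "psd a" "trc (adj \<delta> * a * \<delta>) = 0" for a
  proof -
    obtain r where r: "r \<in> D" "psd r" "r * r = a" using sqrt_ex[OF a(1,2)] by blast
    have "adj \<delta> * a * \<delta> = adj (r * \<delta>) * (r * \<delta>)"
      using r by (simp add: adj_mult psd_adj mult.assoc flip: r(3))
    then have "r * \<delta> = 0" using a(3) trc_square_eq_0 by metis
    then show ?thesis using r(3) by (metis mult.assoc mult_zero_right)
  qed
  have "0 \<le> trc (adj \<delta> * g * \<delta>)" "0 \<le> trc (adj \<delta> * h * \<delta>)" using g h by (auto simp: psd_def)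
  then have "g * \<delta> = 0" "h * \<delta> = 0" using zero g h sum0 by auto
  then have "adj \<delta> * \<delta> = 0" unfolding \<delta>(2) by (simp add: \<delta>_def left_diff_distrib)
  then have "\<delta> = 0" using trc_square_eq_0[of \<delta>] by simp
  then show ?thesis by (simp add: \<delta>_def)
qed

section \<open>Transfer from \<open>complex mat\<close> to \<open>fmat\<close>\<close>

text \<open>Only meaningful for square matrices.\<close>

definition fm :: "complex mat \<Rightarrow> fmat" where
  "fm A = fmat_of_fun (dim_row A) (\<lambda>i j. A $$ (i, j))"

lemma entry_fm: "A \<in> carrier_mat n n \<Longrightarrow> entry (fm A) i j = (if i < n \<and> j < n then A $$ (i, j) else 0)"
  by (simp add: fm_def entry_fmat_of_fun)

lemma bound_fm: "A \<in> carrier_mat n n \<Longrightarrow> bound n (fm A)"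
  by (simp add: bound_def entry_fm)

lemma fm_add: "A \<in> carrier_mat n n \<Longrightarrow> B \<in> carrier_mat n n \<Longrightarrow> fm (A + B) = fm A + fm B"
  by (rule fmat_eqI) (simp add: entry_fm[of _ n] entry_simps)

lemma fm_mult:
  assumes "A \<in> carrier_mat n n" "B \<in> carrier_mat n n"
  shows "fm (A * B) = fm A * fm B"
proof (rule fmat_eqI)
  fix i j
  have "entry (fm A * fm B) i j = (\<Sum>k<n. entry (fm A) i k * entry (fm B) k j)"
    by (rule entry_times[OF bound_fm[OF assms(1)]])
  also have "\<dots> = (if i < n \<and> j < n then (A * B) $$ (i, j) else 0)"
    using assms by (auto simp: entry_fm index_mult_mat_sum simp del: index_mult_mat(1) intro!: sum.neutral)
  also have "\<dots> = entry (fm (A * B)) i j"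
    by (simp only: entry_fm[OF mult_carrier_mat[OF assms]])
  finally show "entry (fm (A * B)) i j = entry (fm A * fm B) i j" ..
qed

lemma fm_adj: "A \<in> carrier_mat n n \<Longrightarrow> fm (mat_adjoint A) = adj (fm A)"
  by (rule fmat_eqI) (simp add: entry_fm[of _ n] entry_adj mat_adjoint_carrier)

lemma fm_smult: "A \<in> carrier_mat n n \<Longrightarrow> fm (complex_of_real r \<cdot>\<^sub>m A) = r *\<^sub>R fm A"
  by (rule fmat_eqI) (simp add: entry_fm[of _ n] entry_simps scaleR_conv_of_real)

lemma trc_fm: "A \<in> carrier_mat n n \<Longrightarrow> trc (fm A) = Re (mat_trace A)"
  by (simp add: trc_eq[OF bound_fm] entry_fm mat_trace_def)

lemma fm_inj:
  assumes "A \<in> carrier_mat n n" "B \<in> carrier_mat n n" "fm A = fm B"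
  shows "A = B"
proof (rule eq_matI)
  fix i j assume "i < dim_row B" "j < dim_col B"
  then have ij: "i < n" "j < n" using assms by auto
  have "entry (fm A) i j = entry (fm B) i j" by (simp only: assms(3))
  then show "A $$ (i, j) = B $$ (i, j)"
    using ij by (simp add: entry_fm[OF assms(1)] entry_fm[OF assms(2)])
qed (use assms in auto)

lemma entry_sum: "entry (\<Sum>k\<in>K. f k) i j = (\<Sum>k\<in>K. entry (f k) i j)"
  by (induction K rule: infinite_finite_induct) (simp_all add: entry_simps)

lemma fm_fsum:
  assumes "\<And>k. k \<in> K \<Longrightarrow> F k \<in> carrier_mat n n"
  shows "fm (mat_fsum n F K) = (\<Sum>k\<in>K. fm (F k))"
proof (rule fmat_eqI)
  fix i j
  have F: "mat_fsum n F K \<in> carrier_mat n n" by (simp add: mat_fsum_def)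
  have "entry (\<Sum>k\<in>K. fm (F k)) i j = (\<Sum>k\<in>K. if i < n \<and> j < n then F k $$ (i, j) else 0)"
    unfolding entry_sum by (intro sum.cong refl entry_fm assms)
  also have "\<dots> = entry (fm (mat_fsum n F K)) i j"
    by (cases "i < n \<and> j < n") (simp_all only: entry_fm[OF F] if_True if_False sum.neutral_const, simp add: mat_fsum_def)
  finally show "entry (fm (mat_fsum n F K)) i j = entry (\<Sum>k\<in>K. fm (F k)) i j" ..
qed

text \<open>The amplification that places the coefficients in the ambient algebra. Since
  \<open>amp 1 = fm\<close>, statements about \<open>amp n\<close> also cover the ambient algebra
  itself.\<close>

definition amp :: "nat \<Rightarrow> complex mat \<Rightarrow> fmat" where
  "amp n A = fm (kron A (1\<^sub>m n))"

lemma kron_one_carrier: "A \<in> carrier_mat d d \<Longrightarrow> kron A (1\<^sub>m n) \<in> carrier_mat (d * n) (d * n)"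
  by (rule kron_carrier) auto

lemma amp_1: "amp 1 A = fm A"
proof -
  have "kron A (1\<^sub>m 1) = A" by (rule eq_matI) (auto simp: index_kron)
  then show ?thesis by (simp add: amp_def)
qed

lemma amp_add: "A \<in> carrier_mat d d \<Longrightarrow> B \<in> carrier_mat d d \<Longrightarrow> amp n (A + B) = amp n A + amp n B"
  by (simp add: amp_def kron_add_left[of _ d d] fm_add[OF kron_one_carrier kron_one_carrier])

lemma amp_mult:
  assumes "A \<in> carrier_mat d d" "B \<in> carrier_mat d d"
  shows "amp n (A * B) = amp n A * amp n B"
proof -
  have "kron A (1\<^sub>m n) * kron B (1\<^sub>m n) = kron (A * B) (1\<^sub>m n)"
    using kron_mult[OF assms(1) one_carrier_mat assms(2) one_carrier_mat, of n] by simp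
  then show ?thesis
    using fm_mult[OF kron_one_carrier[OF assms(1)] kron_one_carrier[OF assms(2)], of n] by (simp add: amp_def)
qed

lemma mat_adjoint_one: "mat_adjoint (1\<^sub>m n :: complex mat) = 1\<^sub>m n"
  by (rule eq_matI) auto

lemma amp_adj: "A \<in> carrier_mat d d \<Longrightarrow> amp n (mat_adjoint A) = adj (amp n A)"
  using fm_adj[OF kron_one_carrier, of A d n] by (simp add: amp_def mat_adjoint_kron mat_adjoint_one)

lemma amp_smult: "A \<in> carrier_mat d d \<Longrightarrow> amp n (complex_of_real r \<cdot>\<^sub>m A) = r *\<^sub>R amp n A"
  by (simp add: amp_def kron_smult_left fm_smult[OF kron_one_carrier])

lemma trc_amp: "A \<in> carrier_mat d d \<Longrightarrow> trc (amp n A) = real n * Re (mat_trace A)"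
proof -
  assume A: "A \<in> carrier_mat d d"
  have "mat_trace (1\<^sub>m n) = of_nat n" by (simp add: mat_trace_def)
  then show ?thesis
    using trc_fm[OF kron_one_carrier[OF A]] mat_trace_kron[OF A one_carrier_mat, of n] by (simp add: amp_def)
qed

lemma amp_inj:
  assumes "A \<in> carrier_mat d d" "B \<in> carrier_mat d d" "0 < n" "amp n A = amp n B"
  shows "A = B"
proof (rule eq_matI)
  fix i j assume "i < dim_row B" "j < dim_col B"
  then have ij: "i < d" "j < d" using assms by auto
  have k: "kron A (1\<^sub>m n) = kron B (1\<^sub>m n)"
    using fm_inj[OF kron_one_carrier[OF assms(1)] kron_one_carrier[OF assms(2)]] assms(4) by (simp add: amp_def)
  \<comment> \<open>The entry of the amplified matrix at \<open>(i * n, j * n)\<close> is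
    \<open>A $$ (i, j)\<close>.\<close>
  have "i * n < d * n" "j * n < d * n" using ij assms(3) by auto
  then show "A $$ (i, j) = B $$ (i, j)"
    using arg_cong[OF k, of "\<lambda>M. M $$ (i * n, j * n)"] assms ij by (simp add: index_kron)
qed (use assms in auto)

lemma amp_fsum:
  assumes "\<And>k. k \<in> K \<Longrightarrow> F k \<in> carrier_mat d d"
  shows "amp n (mat_fsum d F K) = (\<Sum>k\<in>K. amp n (F k))"
proof -
  have "kron (mat_fsum d F K) (1\<^sub>m n) = mat_fsum (d * n) (\<lambda>k. kron (F k) (1\<^sub>m n)) K"
  proof (rule eq_matI)
    fix i j assume "i < dim_row (mat_fsum (d * n) (\<lambda>k. kron (F k) (1\<^sub>m n)) K)"
      "j < dim_col (mat_fsum (d * n) (\<lambda>k. kron (F k) (1\<^sub>m n)) K)"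
    then have ij: "i < d * n" "j < d * n" by (auto simp: mat_fsum_def)
    note dm = div_mod_less[OF ij(1)] div_mod_less[OF ij(2)]
    have "kron (F k) (1\<^sub>m n) $$ (i, j) = F k $$ (i div n, j div n) * 1\<^sub>m n $$ (i mod n, j mod n)"
      if "k \<in> K" for k using assms[OF that] ij by (simp add: index_kron)
    then show "kron (mat_fsum d F K) (1\<^sub>m n) $$ (i, j) = mat_fsum (d * n) (\<lambda>k. kron (F k) (1\<^sub>m n)) K $$ (i, j)"
      using ij dm by (simp add: index_kron mat_fsum_def sum_distrib_right)
  qed (simp_all add: mat_fsum_def)
  moreover have "fm (mat_fsum (d * n) (\<lambda>k. kron (F k) (1\<^sub>m n)) K) = (\<Sum>k\<in>K. fm (kron (F k) (1\<^sub>m n)))"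
    by (rule fm_fsum) (rule kron_one_carrier[OF assms])
  ultimately show ?thesis by (simp add: amp_def)
qed

lemma psd_ampD:
  assumes P: "P \<in> carrier_mat d d" "psd (amp n P)" and n: "0 < n"
  shows "mat_adjoint P = P" "\<And>Q. Q \<in> carrier_mat d d \<Longrightarrow> 0 \<le> Re (mat_trace (mat_adjoint Q * P * Q))"
proof -
  show "mat_adjoint P = P"
    using amp_inj[OF mat_adjoint_carrier[OF P(1)] P(1) n] psd_adj[OF P(2)] amp_adj[OF P(1)] by simp
  fix Q :: "complex mat" assume Q: "Q \<in> carrier_mat d d"
  note Q' = mat_adjoint_carrier[OF Q]
  have "adj (amp n Q) * amp n P * amp n Q = amp n (mat_adjoint Q * P * Q)"
    by (simp only: amp_mult[OF mult_carrier_mat[OF Q' P(1)] Q] amp_mult[OF Q' P(1)] amp_adj[OF Q])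
  then have "0 \<le> trc (amp n (mat_adjoint Q * P * Q))" using P(2) unfolding psd_def by metis
  then show "0 \<le> Re (mat_trace (mat_adjoint Q * P * Q))"
    using n trc_amp[OF mult_carrier_mat[OF mult_carrier_mat[OF Q' P(1)] Q], of n] by (simp add: zero_le_mult_iff)
qed

lemma psd_amp_square:
  assumes "R \<in> carrier_mat d d" "mat_adjoint R = R"
  shows "psd (amp n (R * R))"
  using psd_square[of "amp n R"] amp_mult[OF assms(1,1)] amp_adj[OF assms(1)] assms(2) by simp

text \<open>Roots and inverses are formed for the \<open>d\<close>-dimensional matrix and amplified
  afterwards, so they stay in the corner.\<close>

lemma trace_corner_amp:
  assumes n: "0 < n"
  shows "trace_corner (amp n ` carrier_mat d d) (amp n (1\<^sub>m d))"
proof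
  let ?D = "amp n ` carrier_mat d d"
  have D: "\<exists>A\<in>carrier_mat d d. a = amp n A" if "a \<in> ?D" for a
    using that by blast
  have I: "amp n A \<in> ?D" if "A \<in> carrier_mat d d" for A
    using that by blast
  show "a + b \<in> ?D" if "a \<in> ?D" "b \<in> ?D" for a b
    using D[OF that(1)] D[OF that(2)] I amp_add add_carrier_mat by metis
  show "a * b \<in> ?D" if "a \<in> ?D" "b \<in> ?D" for a b
    using D[OF that(1)] D[OF that(2)] I amp_mult mult_carrier_mat by metis
  show "r *\<^sub>R a \<in> ?D" if "a \<in> ?D" for a r
    using D[OF that] I amp_smult smult_carrier_mat by metis
  show "adj a \<in> ?D" if "a \<in> ?D" for a
    using D[OF that] I amp_adj mat_adjoint_carrier by metis
  show "amp n (1\<^sub>m d) \<in> ?D" by (rule I[OF one_carrier_mat])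
  show "amp n (1\<^sub>m d) * a = a" "a * amp n (1\<^sub>m d) = a" if "a \<in> ?D" for a
    using D[OF that] amp_mult one_carrier_mat left_mult_one_mat right_mult_one_mat by metis+
  fix p assume p: "p \<in> ?D" "psd p"
  then obtain P where P: "P \<in> carrier_mat d d" "p = amp n P" by auto
  note pos = psd_ampD[OF P(1) p(2)[unfolded P(2)] n]
  obtain R where R: "R \<in> carrier_mat d d" "mat_adjoint R = R" "(R * R) * (R * R) = P"
    using nonneg_fourth_root[OF P(1) pos] by blast
  show "\<exists>g\<in>?D. psd g \<and> g * g = p"
    using psd_amp_square[OF R(1,2), of n] amp_mult[OF mult_carrier_mat[OF R(1,1)] mult_carrier_mat[OF R(1,1)], of n]
      mult_carrier_mat[OF R(1,1)] R(3) P(2) by auto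
  obtain S where S: "S \<in> carrier_mat d d" "(1\<^sub>m d + P) * S = 1\<^sub>m d"
    using nonneg_inverse[OF P(1) pos] by blast
  have "(amp n (1\<^sub>m d) + p) * amp n S = amp n ((1\<^sub>m d + P) * S)"
    using amp_add[OF one_carrier_mat P(1), of n] amp_mult[OF add_carrier_mat[OF P(1)] S(1)] P(2) by simp
  then show "\<exists>r\<in>?D. (amp n (1\<^sub>m d) + p) * r = amp n (1\<^sub>m d)"
    using S by auto
qed

section \<open>Positivity and square roots of matrices\<close>

lemma trace_congruence_columns:
  assumes "P \<in> carrier_mat d d" "Q \<in> carrier_mat d d"
  shows "mat_trace (mat_adjoint Q * P * Q) = (\<Sum>j<d. (P *\<^sub>v col Q j) \<bullet>c col Q j)"
proof -
  note Q' = mat_adjoint_carrier[OF assms(2)]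
  have "(mat_adjoint Q * P * Q) $$ (j, j) = (P *\<^sub>v col Q j) \<bullet>c col Q j" if j: "j < d" for j
  proof -
    have "(mat_adjoint Q * P * Q) $$ (j, j) = (mat_adjoint Q * (P * Q)) $$ (j, j)"
      by (simp only: assoc_mult_mat[OF Q' assms])
    also have "\<dots> = (\<Sum>i<d. mat_adjoint Q $$ (j, i) * (P * Q) $$ (i, j))"
      by (rule index_mult_mat_sum[OF Q' mult_carrier_mat[OF assms] j j])
    also have "\<dots> = (\<Sum>i<d. (P *\<^sub>v col Q j) $ i * cnj (col Q j $ i))"
      using assms j by (intro sum.cong refl) simp
    also have "\<dots> = (P *\<^sub>v col Q j) \<bullet>c col Q j"
      using assms by (simp add: scalar_prod_def[of _ "conjugate _"] atLeast0LessThan)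
    finally show ?thesis .
  qed
  then show ?thesis using assms by (simp add: mat_trace_def)
qed

text \<open>By \<open>trace_congruence_columns\<close> a trace test with \<open>Q\<close> is the sum
  of the vector tests on its columns. In one direction this produces a self-adjoint root, whose
  square is positive against all of \<open>fmat\<close>; in the other, a vector is tested by a
  \<open>Q\<close> having it as the only possibly nonzero column.\<close>

lemma psd_mat_iff:
  assumes P: "P \<in> carrier_mat d d" and n: "0 < n"
  shows "psd_mat P \<longleftrightarrow> psd (amp n P)"
proof
  assume psd: "psd_mat P"
  have sa: "mat_adjoint P = P" using psd by (simp add: psd_mat_def self_adjoint_mat_def)
  have "0 \<le> Re (mat_trace (mat_adjoint Q * P * Q))" if Q: "Q \<in> carrier_mat d d" for Q
    unfolding trace_congruence_columns[OF P Q] Re_sum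
  proof (rule sum_nonneg)
    fix j
    have "dim_row Q = dim_row P" using P Q by simp
    then have "col Q j \<in> carrier_vec (dim_row P)" using col_dim[of Q j] by (simp only:)
    then show "0 \<le> Re ((P *\<^sub>v col Q j) \<bullet>c col Q j)" using psd unfolding psd_mat_def by blast
  qed
  then obtain R where R: "R \<in> carrier_mat d d" "mat_adjoint R = R" "(R * R) * (R * R) = P"
    using nonneg_fourth_root[OF P sa] by blast
  have "mat_adjoint (R * R) = R * R" using mat_adjoint_mult[OF R(1,1)] R(2) by simp
  from psd_amp_square[OF mult_carrier_mat[OF R(1,1)] this] show "psd (amp n P)" using R(3) by simp
next
  assume "psd (amp n P)"
  note pos = psd_ampD[OF P this n]
  have "0 \<le> Re ((P *\<^sub>v v) \<bullet>c v)" if v: "v \<in> carrier_vec d" for v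
  proof (cases "d = 0")
    case True
    then show ?thesis using P v by (simp add: scalar_prod_def)
  next
    case False
    define Q where "Q = mat d d (\<lambda>(i, j). if j = 0 then v $ i else 0)"
    have Q: "Q \<in> carrier_mat d d" by (simp add: Q_def)
    have c0: "col Q 0 = v" using v False by (intro eq_vecI) (auto simp: Q_def)
    have cj: "col Q j = 0\<^sub>v d" if "j < d" "j \<noteq> 0" for j
      using that by (intro eq_vecI) (auto simp: Q_def)
    have "(\<Sum>j<d. (P *\<^sub>v col Q j) \<bullet>c col Q j) = (\<Sum>j<d. if j = 0 then (P *\<^sub>v v) \<bullet>c v else 0)"
    proof (intro sum.cong refl)
      fix j assume "j \<in> {..<d}"
      then show "(P *\<^sub>v col Q j) \<bullet>c col Q j = (if j = 0 then (P *\<^sub>v v) \<bullet>c v else 0)"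
        using P c0 cj[of j] by (cases "j = 0") (simp_all add: scalar_prod_def)
    qed
    then have "mat_trace (mat_adjoint Q * P * Q) = (P *\<^sub>v v) \<bullet>c v"
      using False by (simp add: trace_congruence_columns[OF P Q])
    then show ?thesis using pos(2)[OF Q] by simp
  qed
  then show "psd_mat P"
    using P pos(1) by (simp add: psd_mat_def self_adjoint_mat_def)
qed

lemma mat_sqrt_eq:
  assumes G: "G \<in> carrier_mat d d" and n: "0 < n" and psd: "psd (amp n G)" and sq: "G * G = P"
  shows "mat_sqrt P = G"
  unfolding mat_sqrt_def
proof (rule the_equality)
  show "psd_mat G \<and> G * G = P" using psd_mat_iff[OF G n] psd sq by simp
  fix B assume B: "psd_mat B \<and> B * B = P"
  then have "dim_row B = dim_col B" by (simp add: psd_mat_def self_adjoint_mat_def)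
  \<comment> \<open>\<open>mat_sqrt\<close> quantifies over matrices of every size; the equation
    \<open>B * B = P\<close> fixes the size of \<open>B\<close>.\<close>
  moreover have "dim_row B = d"
  proof -
    have "dim_row B = dim_row (B * B)" by simp
    also have "\<dots> = dim_row (G * G)" using B sq by (simp only:)
    finally show ?thesis using G by simp
  qed
  ultimately have Bc: "B \<in> carrier_mat d d" by (intro carrier_matI) simp_all
  interpret trace_corner "amp n ` carrier_mat d d" "amp n (1\<^sub>m d)" by (rule trace_corner_amp[OF n])
  have "amp n B * amp n B = amp n G * amp n G"
    using B sq by (simp only: amp_mult[OF Bc Bc, symmetric] amp_mult[OF G G, symmetric])
  moreover have "psd (amp n B)" using B psd_mat_iff[OF Bc n] by simp
  ultimately have "amp n B = amp n G" using psd_sqrt_unique[OF imageI[OF Bc] _ imageI[OF G] psd] by blast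
  then show "B = G" by (rule amp_inj[OF Bc G n])
qed

section \<open>Quantum Rademachers\<close>

definition site_sign :: "nat \<times> nat \<Rightarrow> nat \<times> nat \<Rightarrow> real" where
  "site_sign a b = (if snd a = snd b \<and> fst a \<noteq> fst b then -1 else 1)"

lemma qrad_index_iff: "a \<in> qrad_index N \<longleftrightarrow> fst a \<in> {1, 2, 3} \<and> 1 \<le> snd a \<and> snd a \<le> N"
  by (cases a) (auto simp: qrad_index_def)

text \<open>If the two letters at one of the sites differ, the first of them commutes with itself,
  anticommutes with its partner and commutes with the other site, so it serves as
  \<open>u\<close>.\<close>

lemma separated_sites_pair:
  assumes K: "a \<in> qrad_index N" "b \<in> qrad_index N" "c \<in> qrad_index N" "d \<in> qrad_index N"
    and "snd a = snd b" "snd c = snd d" "snd a \<noteq> snd c" "a \<noteq> b \<or> c \<noteq> d"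
  shows "\<exists>u\<in>qrad_index N. site_sign u a * site_sign u b * site_sign u c * site_sign u d = -1"
proof (cases "a = b")
  case False
  then have "fst a \<noteq> fst b" using assms by (auto simp: prod_eq_iff)
  then show ?thesis using assms by (intro bexI[of _ a]) (simp_all add: site_sign_def)
next
  case True
  then have "fst c \<noteq> fst d" using assms by (auto simp: prod_eq_iff)
  then show ?thesis using assms by (intro bexI[of _ c]) (simp_all add: site_sign_def)
qed

text \<open>A letter alone at its site is detected by a different Pauli matrix at that site, which
  meets no other letter.\<close>

lemma separated_alone:
  assumes a: "a \<in> qrad_index N" and "snd b \<noteq> snd a" "snd c \<noteq> snd a" "snd d \<noteq> snd a"
  shows "\<exists>u\<in>qrad_index N. site_sign u a * site_sign u b * site_sign u c * site_sign u d = -1"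
proof -
  define u where "u = (if fst a = 1 then 2 else 1 :: nat, snd a)"
  have "u \<in> qrad_index N" using a by (simp add: qrad_index_iff u_def)
  moreover have "snd u = snd a" "fst u \<noteq> fst a" by (auto simp: u_def)
  ultimately show ?thesis using assms by (intro bexI[of _ u]) (simp_all add: site_sign_def)
qed

text \<open>Up to a phase, the product of four Pauli matrices that do not pair off is again one of
  the three, and it anticommutes with the other two. The even length matters: \<open>1 2 3\<close>
  has no repeated letter, yet its product is a scalar.\<close>

lemma separated_one_site:
  assumes "i \<in> {1, 2, 3}" "j \<in> {1, 2, 3}" "k \<in> {1, 2, 3}" "l \<in> {1, 2, 3 :: nat}"
    and "\<not> paired i j k l"
  shows "\<exists>t\<in>{1, 2, 3}. (if t \<noteq> i then - 1 else 1) * (if t \<noteq> j then - 1 else 1) *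
    (if t \<noteq> k then - 1 else 1) * (if t \<noteq> l then - 1 else 1 :: real) = - 1"
  using assms unfolding paired_def by (elim insertE emptyE) simp_all

text \<open>The sites of four letters single out some letter, split into two pairs, or all agree.
  Since the condition is symmetric in the letters, three configurations are enough.\<close>

lemma separated_sites:
  assumes K: "a \<in> qrad_index N" "b \<in> qrad_index N" "c \<in> qrad_index N" "d \<in> qrad_index N"
    and np: "\<not> paired a b c d"
  shows "\<exists>u\<in>qrad_index N. site_sign u a * site_sign u b * site_sign u c * site_sign u d = -1"
proof -
  consider "snd b \<noteq> snd a" "snd c \<noteq> snd a" "snd d \<noteq> snd a"
    | "snd a \<noteq> snd b" "snd c \<noteq> snd b" "snd d \<noteq> snd b"
    | "snd a \<noteq> snd c" "snd b \<noteq> snd c" "snd d \<noteq> snd c"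
    | "snd a \<noteq> snd d" "snd b \<noteq> snd d" "snd c \<noteq> snd d"
    | "snd a = snd b" "snd c = snd d" "snd a \<noteq> snd c"
    | "snd a = snd c" "snd b = snd d" "snd a \<noteq> snd b"
    | "snd a = snd d" "snd b = snd c" "snd a \<noteq> snd b"
    | "snd b = snd a" "snd c = snd a" "snd d = snd a"
    by metis
  then show ?thesis
  proof cases
    case 1 show ?thesis using separated_alone[OF K(1) 1] .
  next
    case 2 show ?thesis using separated_alone[OF K(2) 2] by (simp add: mult_ac)
  next
    case 3 show ?thesis using separated_alone[OF K(3) 3] by (simp add: mult_ac)
  next
    case 4 show ?thesis using separated_alone[OF K(4) 4] by (simp add: mult_ac)
  next
    case 5
    have "a \<noteq> b \<or> c \<noteq> d" using np by (auto simp: paired_def)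
    from separated_sites_pair[OF K 5 this] show ?thesis .
  next
    case 6
    have "a \<noteq> c \<or> b \<noteq> d" using np by (auto simp: paired_def)
    from separated_sites_pair[OF K(1,3,2,4) 6 this] show ?thesis by (simp add: mult_ac)
  next
    case 7
    have "a \<noteq> d \<or> b \<noteq> c" using np by (auto simp: paired_def)
    from separated_sites_pair[OF K(1,4,2,3) 7 this] show ?thesis by (simp add: mult_ac)
  next
    case 8
    have "\<not> paired (fst a) (fst b) (fst c) (fst d)"
      using np 8 by (auto simp: paired_def prod_eq_iff)
    then obtain t where t: "t \<in> {1, 2, 3}" "(if t \<noteq> fst a then - 1 else 1) * (if t \<noteq> fst b then - 1 else 1) *
      (if t \<noteq> fst c then - 1 else 1) * (if t \<noteq> fst d then - 1 else 1 :: real) = - 1"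
      using separated_one_site[of "fst a" "fst b" "fst c" "fst d"] K unfolding qrad_index_iff by blast
    have "(t, snd a) \<in> qrad_index N" using t(1) K(1) by (simp add: qrad_index_iff)
    then show ?thesis using t(2) 8 by (intro bexI[of _ "(t, snd a)"]) (simp_all add: site_sign_def)
  qed
qed

section \<open>Commutation relations of the quantum Rademachers\<close>

lemma qrad_eq: "qrad N (i, k) = kron (kron (1\<^sub>m (2 ^ (k - 1))) (pauli i)) (1\<^sub>m (2 ^ (N - k)))"
  by (simp add: qrad_def kron_pow_one)

lemma qrad_dim: "1 \<le> k \<Longrightarrow> k \<le> N \<Longrightarrow> (2 :: nat) ^ (k - 1) * 2 * 2 ^ (N - k) = 2 ^ N"
  by (simp flip: power_Suc2 power_add)

lemma kron3_carrier:
  assumes "1 \<le> k" "k \<le> N" "M \<in> carrier_mat 2 2"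
  shows "kron (kron (1\<^sub>m (2 ^ (k - 1))) M) (1\<^sub>m (2 ^ (N - k))) \<in> carrier_mat (2 ^ N) (2 ^ N)"
  using kron_carrier[OF kron_carrier[OF one_carrier_mat assms(3)] one_carrier_mat, of "2 ^ (k - 1)" "2 ^ (N - k)"]
  by (simp only: qrad_dim[OF assms(1,2)])

lemma qrad_carrier: "1 \<le> k \<Longrightarrow> k \<le> N \<Longrightarrow> qrad N (i, k) \<in> carrier_mat (2 ^ N) (2 ^ N)"
  unfolding qrad_eq by (rule kron3_carrier[OF _ _ pauli_carrier])

lemma qrad_mult_same:
  assumes k: "1 \<le> k" "k \<le> N"
  shows "qrad N (i, k) * qrad N (j, k) = kron (kron (1\<^sub>m (2 ^ (k - 1))) (pauli i * pauli j)) (1\<^sub>m (2 ^ (N - k)))"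
proof -
  let ?a = "2 ^ (k - 1) :: nat" and ?b = "2 ^ (N - k) :: nat"
  have "qrad N (i, k) * qrad N (j, k) = kron (kron (1\<^sub>m ?a) (pauli i) * kron (1\<^sub>m ?a) (pauli j)) (1\<^sub>m ?b * 1\<^sub>m ?b)"
    unfolding qrad_eq
    by (rule kron_mult[OF kron_carrier[OF one_carrier_mat pauli_carrier] one_carrier_mat
          kron_carrier[OF one_carrier_mat pauli_carrier] one_carrier_mat])
  also have "kron (1\<^sub>m ?a) (pauli i) * kron (1\<^sub>m ?a) (pauli j) = kron (1\<^sub>m ?a * 1\<^sub>m ?a) (pauli i * pauli j)"
    by (rule kron_mult[OF one_carrier_mat pauli_carrier one_carrier_mat pauli_carrier])
  finally show ?thesis by simp
qed

lemma kron_one_commute: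
  assumes "P \<in> carrier_mat a a" "Q \<in> carrier_mat b b"
  shows "kron P (1\<^sub>m b) * kron (1\<^sub>m a) Q = kron (1\<^sub>m a) Q * kron P (1\<^sub>m b)"
  using kron_mult[OF assms(1) one_carrier_mat one_carrier_mat assms(2)]
    kron_mult[OF one_carrier_mat assms(2) assms(1) one_carrier_mat] assms by simp

text \<open>Cutting the tensor product just before site \<open>l\<close> leaves site
  \<open>k\<close> on the left and site \<open>l\<close> on the right, so the two matrices act on
  different tensor factors.\<close>

lemma qrad_commute_less:
  assumes k: "1 \<le> k" "k < l" "l \<le> N"
  shows "qrad N (i, k) * qrad N (j, l) = qrad N (j, l) * qrad N (i, k)"
proof -
  define P where "P = kron (kron (1\<^sub>m (2 ^ (k - 1))) (pauli i)) (1\<^sub>m (2 ^ (l - 1 - k)))"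
  define Q where "Q = kron (pauli j) (1\<^sub>m (2 ^ (N - l)))"
  have P: "P \<in> carrier_mat (2 ^ (l - 1)) (2 ^ (l - 1))"
    unfolding P_def using k by (intro kron3_carrier pauli_carrier) auto
  have Q: "Q \<in> carrier_mat (2 * 2 ^ (N - l)) (2 * 2 ^ (N - l))"
    unfolding Q_def by (intro kron_carrier pauli_carrier one_carrier_mat)
  have split: "(2 :: nat) ^ (N - k) = 2 ^ (l - 1 - k) * (2 * 2 ^ (N - l))"
  proof -
    have "N - k = (l - 1 - k) + Suc (N - l)" using k by auto
    then show ?thesis by (simp only: power_add power_Suc)
  qed
  have 1: "qrad N (i, k) = kron P (1\<^sub>m (2 * 2 ^ (N - l)))"
    unfolding qrad_eq P_def split kron_one[symmetric] by (simp only: kron_assoc)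
  have 2: "qrad N (j, l) = kron (1\<^sub>m (2 ^ (l - 1))) Q"
    unfolding qrad_eq Q_def by (simp only: kron_assoc)
  show ?thesis unfolding 1 2 by (rule kron_one_commute[OF P Q])
qed

lemma qrad_commute:
  assumes "1 \<le> k" "k \<le> N" "1 \<le> l" "l \<le> N" "k \<noteq> l"
  shows "qrad N (i, k) * qrad N (j, l) = qrad N (j, l) * qrad N (i, k)"
  using assms qrad_commute_less[of k l N i j] qrad_commute_less[of l k N j i] by (cases k l rule: linorder_cases) auto

lemma qrad_square:
  assumes "1 \<le> k" "k \<le> N" "i \<in> {1, 2, 3}"
  shows "qrad N (i, k) * qrad N (i, k) = 1\<^sub>m (2 ^ N)"
  unfolding qrad_mult_same[OF assms(1,2)] pauli_square[OF assms(3)] kron_one qrad_dim[OF assms(1,2)] ..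

lemma qrad_adjoint:
  assumes "i \<in> {1, 2, 3}"
  shows "mat_adjoint (qrad N (i, k)) = qrad N (i, k)"
  unfolding qrad_eq mat_adjoint_kron mat_adjoint_one pauli_adjoint[OF assms] ..

lemma qrad_swap:
  assumes a: "a \<in> qrad_index N" and b: "b \<in> qrad_index N"
  shows "qrad N a * qrad N b = complex_of_real (site_sign a b) \<cdot>\<^sub>m (qrad N b * qrad N a)"
proof -
  obtain i k j l where ab: "a = (i, k)" "b = (j, l)" by (cases a; cases b) auto
  have i: "i \<in> {1, 2, 3}" "1 \<le> k" "k \<le> N" using a by (auto simp: ab qrad_index_iff)
  have j: "j \<in> {1, 2, 3}" "1 \<le> l" "l \<le> N" using b by (auto simp: ab qrad_index_iff)
  show ?thesis
  proof (cases "k = l \<and> i \<noteq> j")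
    case True
    then have kl: "l = k" and ne: "i \<noteq> j" by auto
    show ?thesis
      unfolding ab kl qrad_mult_same[OF i(2,3)] pauli_anticomm[OF i(1) j(1) ne] kron_smult_left kron_smult_right
      using ne by (simp add: site_sign_def)
  next
    case False
    then have "qrad N a * qrad N b = qrad N b * qrad N a"
      using qrad_commute[OF i(2,3) j(2,3)] ab by auto
    then show ?thesis using False by (auto simp: ab site_sign_def)
  qed
qed

text \<open>Both corners are instances of \<open>trace_corner_amp\<close>, the ambient one with size
  \<open>d * n\<close> and amplification by 1. They share a unit because the Kronecker product of
  identities is an identity.\<close>

lemma qrad_system:
  fixes d N :: nat
  defines "n \<equiv> 2 ^ N"
  shows "commutation_system (amp n ` carrier_mat d d) (fm ` carrier_mat (d * n) (d * n)) (amp n (1\<^sub>m d))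
    (qrad_index N) site_sign (\<lambda>k. fm (kron (1\<^sub>m d) (qrad N k)))"
proof -
  let ?D = "amp n ` carrier_mat d d" and ?B = "fm ` carrier_mat (d * n) (d * n)" and ?e = "amp n (1\<^sub>m d)"
  let ?E = "\<lambda>k. fm (kron (1\<^sub>m d) (qrad N k))"
  have n: "0 < n" by (simp add: n_def)
  have amp1: "amp 1 = fm" by (rule ext) (rule amp_1)
  have e: "?e = fm (1\<^sub>m (d * n))" by (simp add: amp_def kron_one)
  have D: "trace_corner ?D ?e" by (rule trace_corner_amp[OF n])
  have B: "trace_corner ?B ?e"
    using trace_corner_amp[of 1 "d * n"] unfolding amp1 e by simp
  have q: "qrad N k \<in> carrier_mat n n" if "k \<in> qrad_index N" for k
    using qrad_carrier[of "snd k" N "fst k"] that by (simp add: n_def qrad_index_iff)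
  have Ec: "kron (1\<^sub>m d) (qrad N k) \<in> carrier_mat (d * n) (d * n)" if "k \<in> qrad_index N" for k
    by (rule kron_carrier[OF one_carrier_mat q[OF that]])
  have Emult: "?E a * ?E b = fm (kron (1\<^sub>m d) (qrad N a * qrad N b))"
    if "a \<in> qrad_index N" "b \<in> qrad_index N" for a b
    using kron_mult[OF one_carrier_mat q[OF that(1)] one_carrier_mat q[OF that(2)], of d]
    by (simp add: fm_mult[OF Ec[OF that(1)] Ec[OF that(2)], symmetric])
  have "commutation_system_axioms ?D ?B ?e (qrad_index N) site_sign ?E"
  proof
    show "?D \<subseteq> ?B" using kron_one_carrier by (auto simp: amp_def)
    show "finite (qrad_index N)" by (simp add: qrad_index_def)
    show "?E k \<in> ?B" if "k \<in> qrad_index N" for k using Ec[OF that] by blast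
    show "adj (?E k) = ?E k" if "k \<in> qrad_index N" for k
    proof -
      have "mat_adjoint (qrad N k) = qrad N k"
        using qrad_adjoint[of "fst k" N "snd k"] that by (simp add: qrad_index_iff)
      then show ?thesis
        using fm_adj[OF Ec[OF that]] by (simp add: mat_adjoint_kron mat_adjoint_one)
    qed
    show "?E k * ?E k = ?e" if "k \<in> qrad_index N" for k
    proof -
      have "qrad N k * qrad N k = 1\<^sub>m n"
        using qrad_square[of "snd k" N "fst k"] that by (simp add: qrad_index_iff n_def)
      then show ?thesis using Emult[OF that that] by (simp add: amp_def)
    qed
    show "?E k * x = x * ?E k" if "k \<in> qrad_index N" "x \<in> ?D" for k x
    proof -
      note x = that(2)
      from x obtain A where A: "A \<in> carrier_mat d d" "x = amp n A" by blast
      show ?thesis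
        using kron_one_commute[OF A(1) q[OF that(1)]]
        by (simp add: A(2) amp_def fm_mult[OF Ec[OF that(1)] kron_one_carrier[OF A(1)], symmetric]
            fm_mult[OF kron_one_carrier[OF A(1)] Ec[OF that(1)], symmetric])
    qed
    show "?E a * ?E b = site_sign a b *\<^sub>R (?E b * ?E a)" if "a \<in> qrad_index N" "b \<in> qrad_index N" for a b
    proof -
      have "kron (1\<^sub>m d) (qrad N b * qrad N a) \<in> carrier_mat (d * n) (d * n)"
        by (intro kron_carrier one_carrier_mat mult_carrier_mat[OF q[OF that(2)] q[OF that(1)]])
      then show ?thesis
        unfolding Emult[OF that] Emult[OF that(2,1)]
        by (subst qrad_swap[OF that]) (simp only: kron_smult_right fm_smult)
    qed
    show "site_sign a b = site_sign b a" for a b by (auto simp: site_sign_def)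
    show "site_sign a b = 1 \<or> site_sign a b = -1" for a b by (auto simp: site_sign_def)
    show "\<exists>u\<in>qrad_index N. site_sign u a * site_sign u b * site_sign u c * site_sign u d = - 1"
      if "a \<in> qrad_index N" "b \<in> qrad_index N" "c \<in> qrad_index N" "d \<in> qrad_index N" "\<not> paired a b c d" for a b c d
      using separated_sites[OF that] .
  qed
  with D B show ?thesis by (intro commutation_system.intro)
qed

section \<open>The upper bound for matrix coefficients\<close>

lemma amp_times_kron:
  assumes "A \<in> carrier_mat d d" "q \<in> carrier_mat n n"
  shows "amp n A * fm (kron (1\<^sub>m d) q) = fm (kron A q)"
proof -
  have "kron A (1\<^sub>m n) * kron (1\<^sub>m d) q = kron A q"
    using kron_mult[OF assms(1) one_carrier_mat one_carrier_mat assms(2)] assms by simp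
  then show ?thesis
    using fm_mult[OF kron_one_carrier[OF assms(1)] kron_carrier[OF one_carrier_mat assms(2)]] by (simp add: amp_def)
qed

lemma fm_kron_fsum:
  assumes c: "\<And>k. k \<in> qrad_index N \<Longrightarrow> c k \<in> carrier_mat d d"
  shows "fm (mat_fsum (d * 2 ^ N) (\<lambda>k. kron (c k) (qrad N k)) (qrad_index N))
    = (\<Sum>k\<in>qrad_index N. amp (2 ^ N) (c k) * fm (kron (1\<^sub>m d) (qrad N k)))"
proof -
  have q: "qrad N k \<in> carrier_mat (2 ^ N) (2 ^ N)" if "k \<in> qrad_index N" for k
    using qrad_carrier[of "snd k" N "fst k"] that by (simp add: qrad_index_iff)
  have "fm (mat_fsum (d * 2 ^ N) (\<lambda>k. kron (c k) (qrad N k)) (qrad_index N))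
      = (\<Sum>k\<in>qrad_index N. fm (kron (c k) (qrad N k)))"
    by (rule fm_fsum) (rule kron_carrier[OF c q])
  also have "\<dots> = (\<Sum>k\<in>qrad_index N. amp (2 ^ N) (c k) * fm (kron (1\<^sub>m d) (qrad N k)))"
    by (intro sum.cong refl amp_times_kron[symmetric] c q)
  finally show ?thesis .
qed

lemma mat_sqrt_amp:
  assumes P: "P \<in> carrier_mat d d" "psd (amp n P)" and n: "0 < n"
  shows "mat_sqrt P \<in> carrier_mat d d" "psd (amp n (mat_sqrt P))" "mat_sqrt P * mat_sqrt P = P"
    "0 \<le> Re (mat_trace (mat_sqrt P))"
proof -
  interpret trace_corner "amp n ` carrier_mat d d" "amp n (1\<^sub>m d)" by (rule trace_corner_amp[OF n])
  obtain g where "g \<in> amp n ` carrier_mat d d" "psd g" "g * g = amp n P"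
    using sqrt_ex[OF imageI[OF P(1)] P(2)] by blast
  then obtain G where G: "G \<in> carrier_mat d d" "psd (amp n G)" "amp n G * amp n G = amp n P" by blast
  have "amp n (G * G) = amp n P" using G(3) by (simp only: amp_mult[OF G(1,1)])
  then have GG: "G * G = P" by (rule amp_inj[OF mult_carrier_mat[OF G(1,1)] P(1) n])
  have eq: "mat_sqrt P = G" by (rule mat_sqrt_eq[OF G(1) n G(2) GG])
  show "mat_sqrt P \<in> carrier_mat d d" "psd (amp n (mat_sqrt P))" "mat_sqrt P * mat_sqrt P = P"
    using G GG by (simp_all only: eq)
  have "0 \<le> real n * Re (mat_trace G)"
    using trc_psd_nonneg[OF imageI[OF G(1)] G(2)] by (simp only: trc_amp[OF G(1)])
  then show "0 \<le> Re (mat_trace (mat_sqrt P))" using n by (simp add: eq zero_le_mult_iff)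
qed

lemma mat_fsum_carrier: "mat_fsum d F K \<in> carrier_mat d d"
  by (simp add: mat_fsum_def)

lemma amp_gram:
  assumes X: "\<And>k. k \<in> K \<Longrightarrow> X k \<in> carrier_mat d d"
  shows "amp n (mat_fsum d (\<lambda>k. mat_adjoint (X k) * X k) K) = (\<Sum>k\<in>K. adj (amp n (X k)) * amp n (X k))"
    and "amp n (mat_fsum d (\<lambda>k. X k * mat_adjoint (X k)) K) = (\<Sum>k\<in>K. amp n (X k) * adj (amp n (X k)))"
proof -
  have X': "mat_adjoint (X k) \<in> carrier_mat d d" if "k \<in> K" for k by (rule mat_adjoint_carrier[OF X[OF that]])
  have "amp n (mat_fsum d (\<lambda>k. mat_adjoint (X k) * X k) K) = (\<Sum>k\<in>K. amp n (mat_adjoint (X k) * X k))"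
    by (rule amp_fsum) (rule mult_carrier_mat[OF X' X])
  also have "\<dots> = (\<Sum>k\<in>K. adj (amp n (X k)) * amp n (X k))"
    by (intro sum.cong refl) (simp only: amp_mult[OF X' X] amp_adj[OF X])
  finally show "amp n (mat_fsum d (\<lambda>k. mat_adjoint (X k) * X k) K) = (\<Sum>k\<in>K. adj (amp n (X k)) * amp n (X k))" .
  have "amp n (mat_fsum d (\<lambda>k. X k * mat_adjoint (X k)) K) = (\<Sum>k\<in>K. amp n (X k * mat_adjoint (X k)))"
    by (rule amp_fsum) (rule mult_carrier_mat[OF X X'])
  also have "\<dots> = (\<Sum>k\<in>K. amp n (X k) * adj (amp n (X k)))"
    by (intro sum.cong refl) (simp only: amp_mult[OF X X'] amp_adj[OF X])
  finally show "amp n (mat_fsum d (\<lambda>k. X k * mat_adjoint (X k)) K) = (\<Sum>k\<in>K. amp n (X k) * adj (amp n (X k)))" .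
qed

lemma gram_psd:
  assumes X: "\<And>k. k \<in> K \<Longrightarrow> X k \<in> carrier_mat d d"
  shows "psd (amp n (mat_fsum d (\<lambda>k. mat_adjoint (X k) * X k) K))"
    and "psd (amp n (mat_fsum d (\<lambda>k. X k * mat_adjoint (X k)) K))"
proof -
  show "psd (amp n (mat_fsum d (\<lambda>k. mat_adjoint (X k) * X k) K))"
    by (subst amp_gram(1)) (auto intro: psd_sum psd_square X)
  show "psd (amp n (mat_fsum d (\<lambda>k. X k * mat_adjoint (X k)) K))"
    by (subst amp_gram(2)) (auto intro: psd_sum psd_square' X)
qed

lemma mat_abs_fm:
  assumes M: "M \<in> carrier_mat m m"
  shows "mat_abs M \<in> carrier_mat m m" "psd (fm (mat_abs M))"
    "fm (mat_abs M) * fm (mat_abs M) = adj (fm M) * fm M" "0 \<le> Re (mat_trace (mat_abs M))"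
proof -
  note M' = mat_adjoint_carrier[OF M]
  have P: "mat_adjoint M * M \<in> carrier_mat m m" by (rule mult_carrier_mat[OF M' M])
  have fmP: "fm (mat_adjoint M * M) = adj (fm M) * fm M" by (simp only: fm_mult[OF M' M] fm_adj[OF M])
  have psd: "psd (amp 1 (mat_adjoint M * M))" unfolding amp_1 fmP by (rule psd_square)
  have one: "(0 :: nat) < 1" by simp
  note r = mat_sqrt_amp[OF P psd one]
  show "mat_abs M \<in> carrier_mat m m" "psd (fm (mat_abs M))" "0 \<le> Re (mat_trace (mat_abs M))"
    using r by (simp_all only: mat_abs_def amp_1)
  show "fm (mat_abs M) * fm (mat_abs M) = adj (fm M) * fm M"
    unfolding mat_abs_def fm_mult[OF r(1) r(1), symmetric] r(3) fmP ..
qed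

text \<open>A real \<open>Inf\<close> is a lower bound only for sets bounded below; here 0 is a
  bound, because traces of positive roots are nonnegative.\<close>

lemma S1_l2_norm_le:
  fixes c :: "'k \<Rightarrow> complex mat"
  assumes XY: "\<And>k. k \<in> K \<Longrightarrow> X k \<in> carrier_mat d d \<and> Y k \<in> carrier_mat d d \<and> c k = X k + Y k"
  shows "S1_l2_norm d K c \<le> Re (mat_trace (mat_sqrt (mat_fsum d (\<lambda>k. mat_adjoint (X k) * X k) K)))
      + Re (mat_trace (mat_sqrt (mat_fsum d (\<lambda>k. Y k * mat_adjoint (Y k)) K)))"
  unfolding S1_l2_norm_def
proof (rule cInf_lower)
  show "bdd_below {Re (mat_trace (mat_sqrt (mat_fsum d (\<lambda>k. mat_adjoint (X k) * X k) K)))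
      + Re (mat_trace (mat_sqrt (mat_fsum d (\<lambda>k. Y k * mat_adjoint (Y k)) K))) | X Y.
      \<forall>k\<in>K. X k \<in> carrier_mat d d \<and> Y k \<in> carrier_mat d d \<and> c k = X k + Y k}"
  proof (rule bdd_belowI[of _ 0], safe)
    fix X Y assume "\<forall>k\<in>K. X k \<in> carrier_mat d d \<and> Y k \<in> carrier_mat d d \<and> c k = X k + Y k"
    then have X: "\<And>k. k \<in> K \<Longrightarrow> X k \<in> carrier_mat d d" and Y: "\<And>k. k \<in> K \<Longrightarrow> Y k \<in> carrier_mat d d" by auto
    have n: "(0 :: nat) < 1" by simp
    have "psd (amp 1 (mat_fsum d (\<lambda>k. mat_adjoint (X k) * X k) K))" by (rule gram_psd(1)) (rule X)
    note p = mat_sqrt_amp(4)[OF mat_fsum_carrier this n]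
    have "psd (amp 1 (mat_fsum d (\<lambda>k. Y k * mat_adjoint (Y k)) K))" by (rule gram_psd(2)) (rule Y)
    note q = mat_sqrt_amp(4)[OF mat_fsum_carrier this n]
    from p q show "0 \<le> Re (mat_trace (mat_sqrt (mat_fsum d (\<lambda>k. mat_adjoint (X k) * X k) K)))
      + Re (mat_trace (mat_sqrt (mat_fsum d (\<lambda>k. Y k * mat_adjoint (Y k)) K)))"
      by (rule add_nonneg_nonneg)
  qed
qed (use XY in blast)

text \<open>Amplification multiplies traces by \<open>n\<close>, which matches the division by
  \<open>n\<close> in \<open>tr_tau\<close>; the tolerance passed to \<open>khintchine_upper\<close>
  is therefore \<open>n * \<eta>\<close>.\<close>

lemma L1_ineq_sqrt3:
  assumes c: "\<And>k. k \<in> qrad_index N \<Longrightarrow> c k \<in> carrier_mat d d"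
  shows "L1_ineq (2 ^ N) (qrad_index N) (qrad N) (sqrt 3) d c"
proof -
  define n :: nat where "n = 2 ^ N"
  have n: "0 < n" by (simp add: n_def)
  interpret commutation_system "amp n ` carrier_mat d d" "fm ` carrier_mat (d * n) (d * n)" "amp n (1\<^sub>m d)"
    "qrad_index N" site_sign "\<lambda>k. fm (kron (1\<^sub>m d) (qrad N k))"
    unfolding n_def by (rule qrad_system)
  define M where "M = mat_fsum (d * n) (\<lambda>k. kron (c k) (qrad N k)) (qrad_index N)"
  have M: "M \<in> carrier_mat (d * n) (d * n)" by (simp add: M_def mat_fsum_carrier)
  have fmM: "fm M = embed (\<lambda>k. amp n (c k))"
    unfolding M_def embed_def n_def by (rule fm_kron_fsum[OF c])
  note abs = mat_abs_fm[OF M]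
  have tr: "trc (fm (mat_abs M)) = Re (mat_trace (mat_abs M))" by (rule trc_fm[OF abs(1)])
  have "S1_l2_norm d (qrad_index N) c \<le> sqrt 3 * (Re (mat_trace (mat_abs M)) / real n) + \<eta>" if \<eta>: "0 < \<eta>" for \<eta>
  proof -
    have pos: "0 < real n * \<eta>" using n \<eta> by simp
    have cD: "\<And>k. k \<in> qrad_index N \<Longrightarrow> amp n (c k) \<in> amp n ` carrier_mat d d" using c by blast
    obtain X' Y' g h where XD: "\<And>k. k \<in> qrad_index N \<Longrightarrow> X' k \<in> amp n ` carrier_mat d d"
      and YD: "\<And>k. k \<in> qrad_index N \<Longrightarrow> Y' k \<in> amp n ` carrier_mat d d"
      and cXY: "\<And>k. amp n (c k) = X' k + Y' k"
      and g: "g \<in> amp n ` carrier_mat d d" "psd g" "g * g = (\<Sum>k\<in>qrad_index N. adj (X' k) * X' k)"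
      and h: "h \<in> amp n ` carrier_mat d d" "psd h" "h * h = (\<Sum>k\<in>qrad_index N. Y' k * adj (Y' k))"
      and le: "trc g + trc h \<le> sqrt 3 * trc (fm (mat_abs M)) + real n * \<eta>"
      using khintchine_upper[where c = "\<lambda>k. amp n (c k)", OF cD imageI[OF abs(1)] abs(2) abs(3)[unfolded fmM] pos]
      by blast
    obtain X where X: "\<And>k. k \<in> qrad_index N \<Longrightarrow> X k \<in> carrier_mat d d \<and> X' k = amp n (X k)"
    proof -
      have "\<forall>k\<in>qrad_index N. \<exists>A. A \<in> carrier_mat d d \<and> X' k = amp n A" using XD by blast
      from bchoice[OF this] show thesis using that by blast
    qed
    obtain Y where Y: "\<And>k. k \<in> qrad_index N \<Longrightarrow> Y k \<in> carrier_mat d d \<and> Y' k = amp n (Y k)"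
    proof -
      have "\<forall>k\<in>qrad_index N. \<exists>A. A \<in> carrier_mat d d \<and> Y' k = amp n A" using YD by blast
      from bchoice[OF this] show thesis using that by blast
    qed
    have XY: "X k \<in> carrier_mat d d \<and> Y k \<in> carrier_mat d d \<and> c k = X k + Y k" if k: "k \<in> qrad_index N" for k
    proof -
      have "amp n (c k) = amp n (X k + Y k)" using cXY[of k] X[OF k] Y[OF k] amp_add by metis
      then have "c k = X k + Y k" using amp_inj[OF c[OF k] _ n] X[OF k] Y[OF k] add_carrier_mat by blast
      then show ?thesis using X[OF k] Y[OF k] by blast
    qed
    have Xc: "\<And>k. k \<in> qrad_index N \<Longrightarrow> X k \<in> carrier_mat d d" and Yc: "\<And>k. k \<in> qrad_index N \<Longrightarrow> Y k \<in> carrier_mat d d"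
      using X Y by auto
    let ?P = "mat_fsum d (\<lambda>k. mat_adjoint (X k) * X k) (qrad_index N)"
    let ?Q = "mat_fsum d (\<lambda>k. Y k * mat_adjoint (Y k)) (qrad_index N)"
    \<comment> \<open>By uniqueness, a positive root in the corner is the amplification of the
      matrix that \<open>mat_sqrt\<close> denotes.\<close>
    have root: "trc r = real n * Re (mat_trace (mat_sqrt R))"
      if r: "r \<in> amp n ` carrier_mat d d" "psd r" "r * r = amp n R" and R: "R \<in> carrier_mat d d" for r R
    proof -
      obtain G where G: "G \<in> carrier_mat d d" "r = amp n G" using r(1) by blast
      have "amp n (G * G) = amp n R" using r(3) by (simp only: G(2) amp_mult[OF G(1,1)])
      then have "G * G = R" by (rule amp_inj[OF mult_carrier_mat[OF G(1,1)] R n])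
      then have "mat_sqrt R = G" by (rule mat_sqrt_eq[OF G(1) n r(2)[unfolded G(2)]])
      then show ?thesis by (simp add: G(2) trc_amp[OF G(1)])
    qed
    have "amp n ?P = (\<Sum>k\<in>qrad_index N. adj (amp n (X k)) * amp n (X k))"
      by (rule amp_gram(1)) (rule Xc)
    also have "\<dots> = g * g" unfolding g(3) using X by (intro sum.cong refl) simp
    finally have gP: "g * g = amp n ?P" ..
    have "amp n ?Q = (\<Sum>k\<in>qrad_index N. amp n (Y k) * adj (amp n (Y k)))"
      by (rule amp_gram(2)) (rule Yc)
    also have "\<dots> = h * h" unfolding h(3) using Y by (intro sum.cong refl) simp
    finally have hQ: "h * h = amp n ?Q" ..
    have "real n * (Re (mat_trace (mat_sqrt ?P)) + Re (mat_trace (mat_sqrt ?Q)))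
        \<le> sqrt 3 * Re (mat_trace (mat_abs M)) + real n * \<eta>"
      using le unfolding tr root[OF g(1,2) gP mat_fsum_carrier] root[OF h(1,2) hQ mat_fsum_carrier]
      by (simp only: distrib_left)
    then have "Re (mat_trace (mat_sqrt ?P)) + Re (mat_trace (mat_sqrt ?Q))
        \<le> sqrt 3 * (Re (mat_trace (mat_abs M)) / real n) + \<eta>"
      using n by (simp add: field_simps)
    moreover have "S1_l2_norm d (qrad_index N) c \<le> Re (mat_trace (mat_sqrt ?P)) + Re (mat_trace (mat_sqrt ?Q))"
      by (rule S1_l2_norm_le) (rule XY)
    ultimately show ?thesis by linarith
  qed
  then have "S1_l2_norm d (qrad_index N) c \<le> sqrt 3 * (Re (mat_trace (mat_abs M)) / real n)"
    by (rule field_le_epsilon)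
  then show ?thesis
    unfolding L1_ineq_def tr_tau_def M_def n_def by simp
qed

section \<open>The lower bound\<close>

text \<open>Adjoints of \<open>V1 * V2 = - V3\<close> and multiplication by the involutions give all
  other products. The conclusion is the polynomial identity \<open>(A - 1) (A + 3) = 0\<close> for
  the sum \<open>A\<close>.\<close>

lemma singlet_square:
  fixes e :: "'a :: star_trace"
  assumes sq: "V1 * V1 = e" "V2 * V2 = e" "V3 * V3 = e"
    and unit: "e * V1 = V1" "e * V2 = V2" "e * V3 = V3" "V1 * e = V1" "V2 * e = V2" "V3 * e = V3"
    and sa: "adj V1 = V1" "adj V2 = V2" "adj V3 = V3"
    and prod: "V1 * V2 = - V3"
  shows "(V1 + V2 + V3) * (V1 + V2 + V3) = e + e + e - (V1 + V2 + V3) - (V1 + V2 + V3)"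
proof -
  have 21: "V2 * V1 = - V3" using arg_cong[OF prod, of adj] by (simp add: adj_mult adj_minus sa)
  have 13: "V1 * V3 = - V2"
  proof -
    have "V1 * (V1 * V2) = V2" using sq(1) unit(2) by (simp flip: mult.assoc)
    then have "- (V1 * V3) = V2" by (simp add: prod)
    then show ?thesis by (metis minus_minus)
  qed
  have 31: "V3 * V1 = - V2" using arg_cong[OF 13, of adj] by (simp add: adj_mult adj_minus sa)
  have 32: "V3 * V2 = - V1"
  proof -
    have "(V1 * V2) * V2 = V1" using sq(2) unit(4) by (simp add: mult.assoc)
    then have "- (V3 * V2) = V1" by (simp add: prod)
    then show ?thesis by (metis minus_minus)
  qed
  have 23: "V2 * V3 = - V1" using arg_cong[OF 32, of adj] by (simp add: adj_mult adj_minus sa)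
  show ?thesis by (simp add: distrib_left distrib_right sq prod 21 13 31 32 23)
qed

text \<open>With \<open>A = 1 - 4p\<close> and \<open>B = 1 - 4q\<close> for commuting projections \<open>p, q\<close>, the difference
  \<open>A - B\<close> takes the values \<open>0\<close> and \<open>\<plusminus>4\<close>.\<close>

lemma singlet_difference_cube:
  fixes A :: "'a :: star_trace"
  assumes A: "A * A = e + e + e - A - A" and B: "B * B = e + e + e - B - B"
    and comm: "B * A = A * B"
    and unit: "e * A = A" "A * e = A" "e * B = B" "B * e = B"
  shows "(A - B) * (A - B) * (A - B) = 16 *\<^sub>R (A - B)"
proof -
  have BA: "B * (A * x) = A * (B * x)" for x using comm by (simp flip: mult.assoc)
  have AA: "A * (A * x) = e * x + e * x + e * x - A * x - A * x" for x
    using A by (simp add: left_diff_distrib distrib_right flip: mult.assoc)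
  have BB: "B * (B * x) = e * x + e * x + e * x - B * x - B * x" for x
    using B by (simp add: left_diff_distrib distrib_right flip: mult.assoc)
  \<comment> \<open>\<open>algebra_simps\<close> leaves repeated summands uncollected, so the scalar
    16 is unfolded to match.\<close>
  have "x + x + x + x + x + x + x + x + x + x + x + x + x + x + x + x = 16 *\<^sub>R x" for x :: 'a
  proof -
    have "16 *\<^sub>R x = (1 + 1 + 1 + 1 + 1 + 1 + 1 + 1 + 1 + 1 + 1 + 1 + 1 + 1 + 1 + 1 :: real) *\<^sub>R x" by simp
    then show ?thesis by (simp only: scaleR_left_distrib scaleR_one)
  qed
  note sixteen = this[symmetric]
  show ?thesis
    unfolding sixteen
    by (simp add: algebra_simps A B comm BA AA BB unit)
qed

text \<open>The \<open>4 \<times> 4\<close> matrices supply one coefficient qubit for each of the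
  two sites, so the contributions of the sites act on disjoint pairs of qubits and commute. Zero at
  the remaining sites reduces every \<open>N \<ge> 2\<close> to two sites.\<close>

definition singlet_coeff :: "nat \<times> nat \<Rightarrow> complex mat" where
  "singlet_coeff = (\<lambda>(i, k). if k = 1 then kron (pauli i) (1\<^sub>m 2)
     else if k = 2 then complex_of_real (- 1) \<cdot>\<^sub>m kron (1\<^sub>m 2) (pauli i) else 0\<^sub>m 4 4)"

lemma kron_pauli_carrier: "kron (pauli i) (1\<^sub>m 2) \<in> carrier_mat 4 4" "kron (1\<^sub>m 2) (pauli i) \<in> carrier_mat 4 4"
  using kron_carrier[OF pauli_carrier[of i] one_carrier_mat[of 2]] kron_carrier[OF one_carrier_mat[of 2] pauli_carrier[of i]]
  by simp_all

lemma singlet_coeff_carrier: "singlet_coeff k \<in> carrier_mat 4 4"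
  using kron_pauli_carrier by (cases k) (auto simp: singlet_coeff_def)

lemma mat_adjoint_smult: "mat_adjoint (c \<cdot>\<^sub>m A) = cnj c \<cdot>\<^sub>m mat_adjoint A"
  by (rule eq_matI) auto

lemma singlet_coeff_adjoint:
  assumes "k \<in> qrad_index N"
  shows "mat_adjoint (singlet_coeff k) = singlet_coeff k"
proof -
  have p: "mat_adjoint (pauli (fst k)) = pauli (fst k)"
    using assms by (intro pauli_adjoint) (simp add: qrad_index_iff)
  have z: "mat_adjoint (0\<^sub>m 4 4 :: complex mat) = 0\<^sub>m 4 4" by (rule eq_matI) auto
  show ?thesis
    using p by (cases k) (simp add: singlet_coeff_def mat_adjoint_kron mat_adjoint_one mat_adjoint_smult z)
qed

lemma kron_pauli_square:
  assumes "i \<in> {1, 2, 3}"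
  shows "kron (pauli i) (1\<^sub>m 2) * kron (pauli i) (1\<^sub>m 2) = 1\<^sub>m 4"
    and "kron (1\<^sub>m 2) (pauli i) * kron (1\<^sub>m 2) (pauli i) = 1\<^sub>m 4"
  using kron_mult[OF pauli_carrier one_carrier_mat pauli_carrier one_carrier_mat, of i 2 i]
    kron_mult[OF one_carrier_mat pauli_carrier one_carrier_mat pauli_carrier, of 2 i i]
    pauli_square[OF assms] kron_one[of 2 2] by simp_all

lemma amp_zero: "amp n (0\<^sub>m d d) = 0"
proof -
  have "complex_of_real 0 \<cdot>\<^sub>m 0\<^sub>m d d = (0\<^sub>m d d :: complex mat)" by (rule eq_matI) auto
  then show ?thesis using amp_smult[OF zero_carrier_mat, of n 0 d] by simp
qed

lemma sum_qrad_index_two_sites: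
  fixes f :: "nat \<times> nat \<Rightarrow> 'a :: comm_monoid_add"
  assumes "2 \<le> N" "\<And>i k. 3 \<le> k \<Longrightarrow> f (i, k) = 0"
  shows "(\<Sum>k\<in>qrad_index N. f k) = (f (1, 1) + f (2, 1) + f (3, 1)) + (f (1, 2) + f (2, 2) + f (3, 2))"
proof -
  have "(\<Sum>k\<in>qrad_index N. f k) = (\<Sum>k\<in>{1..3} \<times> {1, 2}. f k)"
  proof (intro sum.mono_neutral_right ballI)
    fix x assume x: "x \<in> qrad_index N - {1..3} \<times> {1, 2}"
    obtain i k where ik: "x = (i, k)" by (cases x)
    then have "3 \<le> k" using x by (auto simp: qrad_index_def)
    then show "f x = 0" unfolding ik by (rule assms(2))
  qed (use assms(1) in \<open>auto simp: qrad_index_def\<close>)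
  also have "\<dots> = (\<Sum>i\<in>{1..3}. \<Sum>k\<in>{1, 2}. f (i, k))"
    by (simp only: sum.cartesian_product case_prod_eta)
  also have "{1..3} = {1, 2, 3 :: nat}" by auto
  finally show ?thesis by (simp add: add_ac)
qed

text \<open>The six nonzero coefficients are self-adjoint unitaries. The value is used twice: it
  makes \<open>c\<close> divided by \<open>sqrt 6\<close> a dual contraction, and it gives the trace
  of \<open>S * S\<close>.\<close>

lemma singlet_coeff_squares:
  assumes "2 \<le> N"
  shows "(\<Sum>k\<in>qrad_index N. amp n (singlet_coeff k) * amp n (singlet_coeff k)) = 6 *\<^sub>R amp n (1\<^sub>m 4)"
proof -
  have 1: "amp n (singlet_coeff (i, 1)) * amp n (singlet_coeff (i, 1)) = amp n (1\<^sub>m 4)" if "i \<in> {1, 2, 3}" for i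
    using kron_pauli_square(1)[OF that]
    by (simp add: singlet_coeff_def flip: amp_mult[OF kron_pauli_carrier(1,1)])
  have 2: "amp n (singlet_coeff (i, 2)) * amp n (singlet_coeff (i, 2)) = amp n (1\<^sub>m 4)" if "i \<in> {1, 2, 3}" for i
    using kron_pauli_square(2)[OF that] amp_smult[OF kron_pauli_carrier(2), of n "-1" i]
    by (simp add: singlet_coeff_def flip: amp_mult[OF kron_pauli_carrier(2,2)])
  have 0: "amp n (singlet_coeff (i, k)) * amp n (singlet_coeff (i, k)) = 0" if "3 \<le> k" for i k
    using that by (simp add: singlet_coeff_def amp_zero)
  have six: "x + x + x + (x + x + x) = 6 *\<^sub>R x" for x :: fmat
  proof -
    have "6 *\<^sub>R x = (1 + 1 + 1 + (1 + 1 + 1) :: real) *\<^sub>R x" by simp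
    then show ?thesis by (simp only: scaleR_left_distrib scaleR_one)
  qed
  show ?thesis
    using sum_qrad_index_two_sites[of N "\<lambda>k. amp n (singlet_coeff k) * amp n (singlet_coeff k)", OF assms 0]
    by (simp only: 1 2 six insert_iff simp_thms)
qed

lemma fm_kron_mult:
  assumes "A \<in> carrier_mat d d" "C \<in> carrier_mat d d" "p \<in> carrier_mat n n" "q \<in> carrier_mat n n"
  shows "fm (kron A p) * fm (kron C q) = fm (kron (A * C) (p * q))"
  using fm_mult[OF kron_carrier[OF assms(1,3)] kron_carrier[OF assms(2,4)]] kron_mult[OF assms(1,3,2,4)] by simp

lemma singlet_embed_cube:
  assumes N: "2 \<le> N"
  defines "S \<equiv> (\<Sum>k\<in>qrad_index N. amp (2 ^ N) (singlet_coeff k) * fm (kron (1\<^sub>m 4) (qrad N k)))"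
  shows "S * S * S = 16 *\<^sub>R S"
proof -
  define n :: nat where "n = 2 ^ N"
  define e where "e = fm (kron (1\<^sub>m 4) (1\<^sub>m n))"
  define V where "V = (\<lambda>i. fm (kron (kron (pauli i) (1\<^sub>m 2)) (qrad N (i, 1))))"
  define W where "W = (\<lambda>i. fm (kron (kron (1\<^sub>m 2) (pauli i)) (qrad N (i, 2))))"
  have N1: "1 \<le> (1 :: nat)" "1 \<le> N" and N2: "1 \<le> (2 :: nat)" "2 \<le> N" using N by auto
  have q1: "qrad N (i, 1) \<in> carrier_mat n n" and q2: "qrad N (i, 2) \<in> carrier_mat n n" for i
    unfolding n_def by (rule qrad_carrier[OF N1], rule qrad_carrier[OF N2])
  note c1 = kron_pauli_carrier(1) and c2 = kron_pauli_carrier(2)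
  have VV: "V i * V i = e" "W i * W i = e" if i: "i \<in> {1, 2, 3}" for i
    using fm_kron_mult[OF c1 c1 q1 q1, of i i i i] fm_kron_mult[OF c2 c2 q2 q2, of i i i i]
      kron_pauli_square[OF i] qrad_square[OF N1 i] qrad_square[OF N2 i]
    by (simp_all add: V_def W_def e_def n_def)
  have unit: "e * V i = V i" "V i * e = V i" "e * W i = W i" "W i * e = W i" for i
    using fm_kron_mult[OF one_carrier_mat c1 one_carrier_mat q1, of i i] fm_kron_mult[OF c1 one_carrier_mat q1 one_carrier_mat, of i i]
      fm_kron_mult[OF one_carrier_mat c2 one_carrier_mat q2, of i i] fm_kron_mult[OF c2 one_carrier_mat q2 one_carrier_mat, of i i]
      left_mult_one_mat[OF c1] right_mult_one_mat[OF c1] left_mult_one_mat[OF c2] right_mult_one_mat[OF c2]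
      left_mult_one_mat[OF q1] right_mult_one_mat[OF q1] left_mult_one_mat[OF q2] right_mult_one_mat[OF q2]
    by (simp_all add: V_def W_def e_def)
  have sa: "adj (V i) = V i" "adj (W i) = W i" if i: "i \<in> {1, 2, 3}" for i
    using fm_adj[OF kron_carrier[OF c1 q1], of i i] fm_adj[OF kron_carrier[OF c2 q2], of i i]
      pauli_adjoint[OF i] qrad_adjoint[OF i]
    by (simp_all add: V_def W_def mat_adjoint_kron mat_adjoint_one)
  \<comment> \<open>The product of the first two Pauli matrices brings a factor \<open>\<i>\<close>
    in the coefficient and another in the generator; together they are the sign in
    \<open>V 1 * V 2 = - V 3\<close>.\<close>
  have neg: "fm (kron (\<i> \<cdot>\<^sub>m C) (\<i> \<cdot>\<^sub>m q)) = - fm (kron C q)" if "C \<in> carrier_mat 4 4" "q \<in> carrier_mat n n" for C q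
  proof -
    have "kron (\<i> \<cdot>\<^sub>m C) (\<i> \<cdot>\<^sub>m q) = complex_of_real (- 1) \<cdot>\<^sub>m kron C q"
      unfolding kron_smult_left kron_smult_right
      by (rule eq_matI) (simp_all flip: mult.assoc)
    then show ?thesis using fm_smult[OF kron_carrier[OF that], of "- 1"] by simp
  qed
  have q12: "qrad N (1, k) * qrad N (2, k) = \<i> \<cdot>\<^sub>m qrad N (3, k)" if "1 \<le> k" "k \<le> N" for k
    unfolding qrad_mult_same[OF that] pauli_1_2 kron_smult_left kron_smult_right unfolding qrad_eq ..
  have c12: "kron (pauli 1) (1\<^sub>m 2) * kron (pauli 2) (1\<^sub>m 2) = \<i> \<cdot>\<^sub>m kron (pauli 3) (1\<^sub>m 2)"
    "kron (1\<^sub>m 2) (pauli 1) * kron (1\<^sub>m 2) (pauli 2) = \<i> \<cdot>\<^sub>m kron (1\<^sub>m 2) (pauli 3)"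
    using kron_mult[OF pauli_carrier one_carrier_mat pauli_carrier one_carrier_mat, of 1 2 2]
      kron_mult[OF one_carrier_mat pauli_carrier one_carrier_mat pauli_carrier, of 2 1 2]
    unfolding pauli_1_2 by (simp_all add: kron_smult_left kron_smult_right)
  have V12: "V 1 * V 2 = - V 3"
    unfolding V_def fm_kron_mult[OF c1 c1 q1 q1] c12 q12[OF N1] by (rule neg[OF c1 q1])
  have W12: "W 1 * W 2 = - W 3"
    unfolding W_def fm_kron_mult[OF c2 c2 q2 q2] c12 q12[OF N2] by (rule neg[OF c2 q2])
  have WV: "W i * V j = V j * W i" for i j
  proof -
    have "kron (1\<^sub>m 2) (pauli i) * kron (pauli j) (1\<^sub>m 2) = kron (pauli j) (1\<^sub>m 2) * kron (1\<^sub>m 2) (pauli i)"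
      using kron_one_commute[OF pauli_carrier pauli_carrier] by simp
    moreover have "qrad N (i, 2) * qrad N (j, 1) = qrad N (j, 1) * qrad N (i, 2)"
      by (rule qrad_commute[OF N2 N1]) simp
    ultimately show ?thesis
      unfolding V_def W_def fm_kron_mult[OF c2 c1 q2 q1] fm_kron_mult[OF c1 c2 q1 q2] by simp
  qed
  define A where "A = V 1 + V 2 + V 3"
  define B where "B = W 1 + W 2 + W 3"
  have AA: "A * A = e + e + e - A - A"
    unfolding A_def using VV(1)[of 1] VV(1)[of 2] VV(1)[of 3] sa(1)[of 1] sa(1)[of 2] sa(1)[of 3] unit V12
    by (intro singlet_square) auto
  have BB: "B * B = e + e + e - B - B"
    unfolding B_def using VV(2)[of 1] VV(2)[of 2] VV(2)[of 3] sa(2)[of 1] sa(2)[of 2] sa(2)[of 3] unit W12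
    by (intro singlet_square) auto
  have BA: "B * A = A * B" unfolding A_def B_def by (simp add: distrib_left distrib_right WV add_ac)
  have SAB: "S = A - B"
  proof -
    let ?f = "\<lambda>k. amp (2 ^ N) (singlet_coeff k) * fm (kron (1\<^sub>m 4) (qrad N k))"
    have f1: "?f (i, 1) = V i" for i
      using amp_times_kron[OF c1 q1, of i i] by (simp add: V_def n_def singlet_coeff_def)
    have f2: "?f (i, 2) = - W i" for i
      using amp_times_kron[OF c2 q2, of i i] amp_smult[OF c2, of n "- 1" i] by (simp add: W_def n_def singlet_coeff_def)
    have "?f (i, k) = 0" if "3 \<le> k" for i k
      using that by (simp add: singlet_coeff_def amp_zero)
    then have "S = (V 1 + V 2 + V 3) + (- W 1 + - W 2 + - W 3)"
      unfolding S_def using sum_qrad_index_two_sites[OF N, of ?f] by (simp only: f1 f2)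
    then show ?thesis by (simp add: A_def B_def)
  qed
  show ?thesis
    unfolding SAB by (rule singlet_difference_cube[OF AA BB BA]) (simp_all add: A_def B_def distrib_left distrib_right unit)
qed

lemma image2_nonempty: "P x y \<Longrightarrow> {f x y | x y. P x y} \<noteq> {}"
  by blast

text \<open>\<open>trace_duality\<close> with \<open>y = c\<close> and \<open>C = sqrt 6\<close> is
  applied to both parts of a decomposition. The pairings add up to
  \<open>trc (\<Sum>k\<in>K. adj (c k) * c k) = 6 * 4\<close>, whence
  \<open>24 \<le> sqrt 6 * v\<close>.\<close>

lemma S1_l2_norm_singlet_ge:
  assumes N: "2 \<le> N"
  shows "4 * sqrt 6 \<le> S1_l2_norm 4 (qrad_index N) singlet_coeff"
  unfolding S1_l2_norm_def
proof (rule cInf_greatest)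
  let ?K = "qrad_index N" and ?c = "\<lambda>k. amp 1 (singlet_coeff k)"
  show "{Re (mat_trace (mat_sqrt (mat_fsum 4 (\<lambda>k. mat_adjoint (X k) * X k) ?K)))
      + Re (mat_trace (mat_sqrt (mat_fsum 4 (\<lambda>k. Y k * mat_adjoint (Y k)) ?K))) | X Y.
      \<forall>k\<in>?K. X k \<in> carrier_mat 4 4 \<and> Y k \<in> carrier_mat 4 4 \<and> singlet_coeff k = X k + Y k} \<noteq> {}"
  proof -
    have *: "\<forall>k\<in>?K. singlet_coeff k \<in> carrier_mat 4 4 \<and> 0\<^sub>m 4 4 \<in> carrier_mat 4 4
        \<and> singlet_coeff k = singlet_coeff k + 0\<^sub>m 4 4"
      using singlet_coeff_carrier by simp
    show ?thesis by (rule image2_nonempty) (rule *)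
  qed
  fix v assume "v \<in> {Re (mat_trace (mat_sqrt (mat_fsum 4 (\<lambda>k. mat_adjoint (X k) * X k) ?K)))
      + Re (mat_trace (mat_sqrt (mat_fsum 4 (\<lambda>k. Y k * mat_adjoint (Y k)) ?K))) | X Y.
      \<forall>k\<in>?K. X k \<in> carrier_mat 4 4 \<and> Y k \<in> carrier_mat 4 4 \<and> singlet_coeff k = X k + Y k}"
  then obtain X Y where XY: "\<forall>k\<in>?K. X k \<in> carrier_mat 4 4 \<and> Y k \<in> carrier_mat 4 4 \<and> singlet_coeff k = X k + Y k"
    and v: "v = Re (mat_trace (mat_sqrt (mat_fsum 4 (\<lambda>k. mat_adjoint (X k) * X k) ?K)))
      + Re (mat_trace (mat_sqrt (mat_fsum 4 (\<lambda>k. Y k * mat_adjoint (Y k)) ?K)))"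
    unfolding mem_Collect_eq by (elim exE conjE)
  have X: "X k \<in> carrier_mat 4 4" and Y: "Y k \<in> carrier_mat 4 4" and cXY: "singlet_coeff k = X k + Y k"
    if "k \<in> ?K" for k using XY that by auto
  define P where "P = mat_fsum 4 (\<lambda>k. mat_adjoint (X k) * X k) ?K"
  define Q where "Q = mat_fsum 4 (\<lambda>k. Y k * mat_adjoint (Y k)) ?K"
  have PQ: "P \<in> carrier_mat 4 4" "Q \<in> carrier_mat 4 4" by (simp_all add: P_def Q_def mat_fsum_carrier)
  have aP: "amp 1 P = (\<Sum>k\<in>?K. adj (amp 1 (X k)) * amp 1 (X k))"
    unfolding P_def by (rule amp_gram(1)) (rule X)
  \<comment> \<open>The row sum of \<open>Y\<close> is written as the column sum of its adjoints, so
    one duality lemma serves both parts; self-adjointness of \<open>c\<close> makes the two pairings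
    match.\<close>
  have aQ: "amp 1 Q = (\<Sum>k\<in>?K. adj (adj (amp 1 (Y k))) * adj (amp 1 (Y k)))"
    unfolding Q_def adj_adj by (rule amp_gram(2)) (rule Y)
  have psd: "psd (amp 1 P)" "psd (amp 1 Q)"
    unfolding aP aQ by (intro psd_sum psd_square)+
  have one: "(0 :: nat) < 1" by simp
  interpret trace_corner "amp 1 ` carrier_mat 4 4" "amp 1 (1\<^sub>m 4)" by (rule trace_corner_amp[OF one])
  note rP = mat_sqrt_amp[OF PQ(1) psd(1) one] and rQ = mat_sqrt_amp[OF PQ(2) psd(2) one]
  have cD: "?c k \<in> amp 1 ` carrier_mat 4 4" for k by (rule imageI[OF singlet_coeff_carrier])
  have csa: "adj (?c k) = ?c k" if "k \<in> ?K" for k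
    using amp_adj[OF singlet_coeff_carrier, of 1 k] singlet_coeff_adjoint[OF that] by simp
  have csq: "(\<Sum>k\<in>?K. adj (?c k) * ?c k) = 6 *\<^sub>R amp 1 (1\<^sub>m 4)"
    using singlet_coeff_squares[OF N, of 1] csa by simp
  have le: "psd ((sqrt 6)\<^sup>2 *\<^sub>R amp 1 (1\<^sub>m 4) - (\<Sum>k\<in>?K. adj (?c k) * ?c k))"
    unfolding csq by simp
  have sq6: "0 < sqrt 6" by simp
  have gP: "amp 1 (mat_sqrt P) * amp 1 (mat_sqrt P) = (\<Sum>k\<in>?K. adj (amp 1 (X k)) * amp 1 (X k))"
    by (simp only: amp_mult[OF rP(1) rP(1), symmetric] rP(3) aP)
  have gQ: "amp 1 (mat_sqrt Q) * amp 1 (mat_sqrt Q) = (\<Sum>k\<in>?K. adj (adj (amp 1 (Y k))) * adj (amp 1 (Y k)))"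
    by (simp only: amp_mult[OF rQ(1) rQ(1), symmetric] rQ(3) aQ)
  have 1: "(\<Sum>k\<in>?K. trc (amp 1 (X k) * adj (?c k))) \<le> sqrt 6 * trc (amp 1 (mat_sqrt P))"
    by (rule trace_duality[OF imageI[OF rP(1)] rP(2) gP imageI[OF X] cD sq6 le])
  have 2: "(\<Sum>k\<in>?K. trc (adj (amp 1 (Y k)) * adj (?c k))) \<le> sqrt 6 * trc (amp 1 (mat_sqrt Q))"
    by (rule trace_duality[OF imageI[OF rQ(1)] rQ(2) gQ adj_in[OF imageI[OF Y]] cD sq6 le])
  have "trc (amp 1 (X k) * adj (?c k)) + trc (adj (amp 1 (Y k)) * adj (?c k)) = trc (adj (?c k) * ?c k)"
    if k: "k \<in> ?K" for k
  proof -
    have "trc (adj (amp 1 (Y k)) * adj (?c k)) = trc (amp 1 (Y k) * ?c k)" by (simp add: trc_adj_swap)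
    then have "trc (amp 1 (X k) * adj (?c k)) + trc (adj (amp 1 (Y k)) * adj (?c k))
        = trc ((amp 1 (X k) + amp 1 (Y k)) * ?c k)"
      by (simp only: csa[OF k] distrib_right trc_add)
    also have "amp 1 (X k) + amp 1 (Y k) = adj (?c k)"
      unfolding csa[OF k] by (simp only: cXY[OF k] amp_add[OF X[OF k] Y[OF k]])
    finally show ?thesis .
  qed
  then have "(\<Sum>k\<in>?K. trc (amp 1 (X k) * adj (?c k))) + (\<Sum>k\<in>?K. trc (adj (amp 1 (Y k)) * adj (?c k)))
      = trc (\<Sum>k\<in>?K. adj (?c k) * ?c k)"
    by (simp add: trc_sum flip: sum.distrib)
  also have "\<dots> = 24"
    unfolding csq trc_scaleR trc_amp[OF one_carrier_mat] by (simp add: mat_trace_def)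
  finally have "24 \<le> sqrt 6 * trc (amp 1 (mat_sqrt P)) + sqrt 6 * trc (amp 1 (mat_sqrt Q))" using 1 2 by linarith
  moreover have "v = trc (amp 1 (mat_sqrt P)) + trc (amp 1 (mat_sqrt Q))"
    by (simp only: v P_def[symmetric] Q_def[symmetric] trc_amp[OF rP(1)] trc_amp[OF rQ(1)] of_nat_1 mult_1_left)
  ultimately have "24 \<le> sqrt 6 * v" by (simp only: distrib_left)
  moreover have "sqrt 6 * (4 * sqrt 6) = 24" by simp
  ultimately have "sqrt 6 * (4 * sqrt 6) \<le> sqrt 6 * v" by linarith
  then show "4 * sqrt 6 \<le> v" using sq6 by (simp only: mult_le_cancel_left_pos)
qed

text \<open>The cube identity gives \<open>(S * S / 4)^2 = S * S\<close>, so uniqueness of roots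
  identifies the absolute value without diagonalisation. Orthonormality in the form
  \<open>trc_embed2\<close> then yields the trace \<open>6 * (4 * n) / 4\<close>.\<close>

lemma trace_abs_singlet:
  assumes N: "2 \<le> N"
  shows "Re (mat_trace (mat_abs (mat_fsum (4 * 2 ^ N) (\<lambda>k. kron (singlet_coeff k) (qrad N k)) (qrad_index N)))) = 6 * 2 ^ N"
proof -
  define n :: nat where "n = 2 ^ N"
  interpret commutation_system "amp n ` carrier_mat 4 4" "fm ` carrier_mat (4 * n) (4 * n)" "amp n (1\<^sub>m 4)"
    "qrad_index N" site_sign "\<lambda>k. fm (kron (1\<^sub>m 4) (qrad N k))"
    unfolding n_def by (rule qrad_system)
  define M where "M = mat_fsum (4 * n) (\<lambda>k. kron (singlet_coeff k) (qrad N k)) (qrad_index N)"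
  define S where "S = embed (\<lambda>k. amp n (singlet_coeff k))"
  have M: "M \<in> carrier_mat (4 * n) (4 * n)" by (simp add: M_def mat_fsum_carrier)
  have fmM: "fm M = S"
    unfolding M_def S_def embed_def n_def by (rule fm_kron_fsum[OF singlet_coeff_carrier])
  have cD: "amp n (singlet_coeff k) \<in> amp n ` carrier_mat 4 4" for k by (rule imageI[OF singlet_coeff_carrier])
  have SB: "S \<in> fm ` carrier_mat (4 * n) (4 * n)" unfolding S_def by (rule embed_in) (rule cD)
  have Ssa: "adj S = S"
  proof -
    have "adj S = embed (\<lambda>k. adj (amp n (singlet_coeff k)))" unfolding S_def by (rule adj_embed) (rule cD)
    also have "\<dots> = S" unfolding S_def embed_def
      using amp_adj[OF singlet_coeff_carrier, of n] singlet_coeff_adjoint by (intro sum.cong refl) metis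
    finally show ?thesis .
  qed
  have cube: "S * S * S = 16 *\<^sub>R S"
    using singlet_embed_cube[OF N] by (simp add: S_def embed_def n_def)
  define \<sigma> where "\<sigma> = (1/4) *\<^sub>R (S * S)"
  have \<sigma>: "\<sigma> \<in> fm ` carrier_mat (4 * n) (4 * n)" "psd \<sigma>"
    using psd_square[of S] SB by (auto simp: \<sigma>_def Ssa intro!: psd_scaleR B.scaleR_in B.mult_in)
  have "\<sigma> * \<sigma> = (1/16) *\<^sub>R (S * S * S * S)" by (simp add: \<sigma>_def mult.assoc)
  also have "\<dots> = adj S * S" by (simp add: cube Ssa)
  finally have \<sigma>\<sigma>: "\<sigma> * \<sigma> = adj S * S" .
  note abs = mat_abs_fm[OF M, unfolded fmM]
  have "fm (mat_abs M) = \<sigma>"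
    by (rule B.psd_sqrt_unique[OF imageI[OF abs(1)] abs(2) \<sigma>]) (simp only: abs(3) \<sigma>\<sigma>)
  then have "Re (mat_trace (mat_abs M)) = trc \<sigma>" using trc_fm[OF abs(1)] by simp
  also have "\<dots> = trc (amp n (1\<^sub>m 4) * (S * S)) / 4"
    using SB by (simp add: \<sigma>_def trc_scaleR)
  also have "trc (amp n (1\<^sub>m 4) * (S * S)) = (\<Sum>k\<in>qrad_index N. trc (amp n (1\<^sub>m 4) * (amp n (singlet_coeff k) * amp n (singlet_coeff k))))"
    unfolding S_def by (rule trc_embed2) (use cD D.e_in in auto)
  also have "\<dots> = trc (amp n (1\<^sub>m 4) * (\<Sum>k\<in>qrad_index N. amp n (singlet_coeff k) * amp n (singlet_coeff k)))"
    by (simp only: sum_distrib_left trc_sum)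
  also have "\<dots> = 6 * trc (amp n (1\<^sub>m 4))"
    unfolding singlet_coeff_squares[OF N] by (simp add: trc_scaleR)
  also have "trc (amp n (1\<^sub>m 4)) = 4 * real n"
    unfolding trc_amp[OF one_carrier_mat] by (simp add: mat_trace_def)
  finally show ?thesis by (simp add: M_def n_def)
qed

lemma self_adjoint_constant_ge:
  assumes N: "2 \<le> N"
    and A: "\<forall>d c. d \<ge> 1 \<longrightarrow> (\<forall>k \<in> qrad_index N. c k \<in> carrier_mat d d \<and> self_adjoint_mat (c k)) \<longrightarrow>
      L1_ineq (2 ^ N) (qrad_index N) (qrad N) A d c"
  shows "sqrt (8 / 3) \<le> A"
proof -
  have "\<forall>k\<in>qrad_index N. singlet_coeff k \<in> carrier_mat 4 4 \<and> self_adjoint_mat (singlet_coeff k)"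
    using singlet_coeff_adjoint
    by (simp add: self_adjoint_mat_def singlet_coeff_carrier carrier_matD[OF singlet_coeff_carrier])
  then have "L1_ineq (2 ^ N) (qrad_index N) (qrad N) A 4 singlet_coeff" using A by simp
  then have "4 * sqrt 6 \<le> A * 6"
    using S1_l2_norm_singlet_ge[OF N] trace_abs_singlet[OF N] unfolding L1_ineq_def tr_tau_def by simp
  moreover have "sqrt (8 / 3) * 6 = 4 * sqrt 6"
  proof (rule power2_eq_imp_eq)
    show "(sqrt (8 / 3) * 6)\<^sup>2 = (4 * sqrt 6)\<^sup>2" by (simp only: power_mult_distrib) simp
  qed auto
  ultimately show ?thesis by linarith
qed

theorem proposition5p10:
  fixes N :: nat
  assumes "N \<ge> 2"
  shows "sqrt (8 / 3) \<le> A1_const (2 ^ N) (qrad_index N) (qrad N)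
    \<and> A1_const (2 ^ N) (qrad_index N) (qrad N) \<le> sqrt 3
    \<and> (\<forall>A :: real.
        (\<forall>d c. d \<ge> 1 \<longrightarrow>
           (\<forall>k \<in> qrad_index N. c k \<in> carrier_mat d d \<and> self_adjoint_mat (c k)) \<longrightarrow>
           L1_ineq (2 ^ N) (qrad_index N) (qrad N) A d c)
        \<longrightarrow> sqrt (8 / 3) \<le> A)"
proof -
  define G where "G = {A. \<forall>d c. d \<ge> 1 \<longrightarrow> (\<forall>k\<in>qrad_index N. c k \<in> carrier_mat d d) \<longrightarrow>
    L1_ineq (2 ^ N) (qrad_index N) (qrad N) A d c}"
  have top: "sqrt 3 \<in> G" unfolding G_def using L1_ineq_sqrt3 by blast
  have bot: "sqrt (8 / 3) \<le> A" if "A \<in> G" for A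
    using self_adjoint_constant_ge[OF assms, of A] that unfolding G_def by blast
  have bdd: "bdd_below G" using bot by (rule bdd_belowI)
  \<comment> \<open>\<open>LEAST\<close> over the reals needs an attained minimum. Each condition is
    closed in \<open>A\<close> and, as the trace \<open>t\<close> is nonnegative, passes to the
    infimum.\<close>
  have Inf_in: "Inf G \<in> G"
    unfolding G_def
  proof (intro CollectI allI impI)
    fix d and c :: "nat \<times> nat \<Rightarrow> complex mat"
    assume dc: "d \<ge> 1" "\<forall>k\<in>qrad_index N. c k \<in> carrier_mat d d"
    define t where "t = Re (tr_tau (2 ^ N) (mat_abs (mat_fsum (d * 2 ^ N) (\<lambda>k. kron (c k) (qrad N k)) (qrad_index N))))"
    have t: "0 \<le> t"
      using mat_abs_fm(4)[OF mat_fsum_carrier[of "d * 2 ^ N" "\<lambda>k. kron (c k) (qrad N k)" "qrad_index N"]]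
      by (simp add: t_def tr_tau_def)
    have le: "S1_l2_norm d (qrad_index N) c \<le> A * t" if "A \<in> G" for A
      using that dc unfolding G_def L1_ineq_def t_def by blast
    have "S1_l2_norm d (qrad_index N) c \<le> Inf G * t"
    \<comment> \<open>Division by \<open>t\<close> fails here, but the condition no longer depends
      on \<open>A\<close>, and the member \<open>sqrt 3\<close> of \<open>G\<close> supplies
      it.\<close>
    proof (cases "t = 0")
      case True
      then show ?thesis using le[OF top] by simp
    next
      case False
      then have "0 < t" using t by simp
      then have "S1_l2_norm d (qrad_index N) c / t \<le> Inf G"
        using le top by (intro cInf_greatest) (auto simp: pos_divide_le_eq)
      then show ?thesis using \<open>0 < t\<close> by (simp add: pos_divide_le_eq)
    qed
    then show "L1_ineq (2 ^ N) (qrad_index N) (qrad N) (Inf {A. \<forall>d c. d \<ge> 1 \<longrightarrow>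
        (\<forall>k\<in>qrad_index N. c k \<in> carrier_mat d d) \<longrightarrow> L1_ineq (2 ^ N) (qrad_index N) (qrad N) A d c}) d c"
      unfolding L1_ineq_def[of _ _ _ "Inf _"] t_def G_def .
  qed
  have "A1_const (2 ^ N) (qrad_index N) (qrad N) = Inf G"
    unfolding A1_const_def
  proof (rule Least_equality)
    show "\<forall>d c. d \<ge> 1 \<longrightarrow> (\<forall>k\<in>qrad_index N. c k \<in> carrier_mat d d) \<longrightarrow>
        L1_ineq (2 ^ N) (qrad_index N) (qrad N) (Inf G) d c"
      using Inf_in by (subst (asm) (2) G_def) blast
    fix A assume "\<forall>d c. d \<ge> 1 \<longrightarrow> (\<forall>k\<in>qrad_index N. c k \<in> carrier_mat d d) \<longrightarrow>
        L1_ineq (2 ^ N) (qrad_index N) (qrad N) A d c"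
    then have "A \<in> G" unfolding G_def by blast
    then show "Inf G \<le> A" using bdd by (rule cInf_lower)
  qed
  then show ?thesis
    using bot[OF Inf_in] cInf_lower[OF top bdd] self_adjoint_constant_ge[OF assms] by simp
qed

end
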